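(* Let $P$ be a nanophrase over $\alpha_1=\{-1,1\}$, let $C(P)$ be the free abelian group generated by the enhanced states of $P$, and let $d:C(P)\to C(P)$ be the homomorphism $d(S)=\sum_{T}(S:T)\,T$, where $T$ runs over all enhanced states of $P$ and $(S:T)\in\{0,1\}$ are the incidence numbers. Then $d\circ d=0$ modulo $2$.
   Context: Nanophrases. An $\alpha$-alphabet is a finite set $\mathcal A$ with a map (projection) $\mathcal A\to\alpha$, $A\mapsto |A|$. A nanophrase of length $k$ over $\alpha$ is a pair $(\mathcal A, w_1|\cdots|w_k)$ where $\mathcal A$ is an $\alpha$-alphabet and $w_1,\dots,w_k$ are (possibly empty) words in $\mathcal A$ (the components) such that each letter of $\mathcal A$ occurs exactly twice in $w_1w_2\cdots w_k$. States. A state $s$ of a nanophrase $P$ over $\alpha_1=\{-1,1\}$ is an assignment of a marker $\mathrm{mark}(A)\in\{-1,1\}$ to each letter $A$. Deformation $(\ast\ast)$. Components may be permuted, and the first letter of any component may be moved to the end of that component (projections and markers unchanged). For a word $x$, $x^-$ is the word $x$ written in opposite order, and for a phrase $Q$, $(Q)_x$ is the same phrase in which the projection of every letter occurring exactly once in $x$ is multiplied by $-1$ (all other projections and all markers unchanged). A letter $A$ is replaced by inert reminders $a$ as follows, where $|A|$ is its current projection. (1) $w_1|\cdots|AxAy|\cdots|w_k$ becomes $w_1|\cdots|ax|ay|\cdots|w_k$ if $\mathrm{mark}(A)=|A|$, and $(w_1|\cdots|ax^-ay|\cdots|w_k)_x$ if $\mathrm{mark}(A)=-|A|$. (2) $w_1|\cdots|Ax|Ay|\cdots|w_k$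 becomes $w_1|\cdots|axay|\cdots|w_k$ if $\mathrm{mark}(A)=|A|$, and $(w_1|\cdots|ax^-ay|\cdots|w_k)_x$ if $\mathrm{mark}(A)=-|A|$. Applying this to all letters of $P$ gives a phrase consisting of reminders only; its components are called the components of the state $s$ and do not depend on the order in which letters are treated. A component of $s$ contains the letter $A$ if a reminder $a$ occurs in it; each letter is contained in one or two components of $s$. (Bookkeeping: regard each word as cyclic. A word with $n\geq 1$ letters has $n$ gaps between cyclically consecutive positions, and an empty word has one gap; the deformation carries gaps along, so the components of $s$ correspond to the blocks of a partition of the set of gaps of $P$. If two states differ only in the marker of $A$, then treating $A$ last shows that their components not containing $A$ are the same blocks, and these are identified.) Enhanced states. An enhanced state $S$ of $P$ is a state $s$ of $P$ together with a sign $+$ or $-$ for each component of $s$. Incidence numbers. $(S:T)=1$ if: the markers of $S$ and $T$ differ at exactly one letter $A$; the marker of $A$ is positive in $S$ and negative in $T$; all components not containing $A$ have the same signs in $S$ and $T$; and the signs of the components containing $A$ are as in one of the following cases: - two components of $S$ containing $A$ correspond to one component of $T$, with signs $(-,-)\to -$, or $(-,+)\to +$, or $(+,-)\to+$; - one component of $S$ containing $A$ corresponds to two components of $T$, with signs $+\to(+,+)$, or $-\to(+,-)$, or $-\to(-,+)$. In all other cases (in particular if $A$ is contained in one component of $S$ and in one component of $T$) $(S:T)=0$. *)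

theory Defs
  imports "HOL-Library.FuncSet" "HOL-Library.Multiset" "HOL-Library.Poly_Mapping"
    "HOL-Algebra.Free_Abelian_Groups"
begin

section \<open>Nanophrases\<close>

record ('a, 'b) nanophrase =
  alphabet :: "'a set"
  proj :: "'a \<Rightarrow> 'b"
  words :: "'a list list"

definition nanophrase_over :: "'b set \<Rightarrow> ('a, 'b) nanophrase \<Rightarrow> bool" where
  "nanophrase_over \<alpha> P \<longleftrightarrow>
     finite (alphabet P) \<and>
     proj P \<in> alphabet P \<rightarrow> \<alpha> \<and>
     (\<forall>w\<in>set (words P). set w \<subseteq> alphabet P) \<and>
     (\<forall>A\<in>alphabet P. count_list (concat (words P)) A = 2)"

definition states :: "('a, int) nanophrase \<Rightarrow> ('a \<Rightarrow> int) set" where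
  "states P = alphabet P \<rightarrow>\<^sub>E {-1, 1}"


section \<open>The deformation\<close>

text \<open>
  The gaps of a phrase are carried along as explicit tokens. In the phrase one starts from, the
  gap \<open>(i, j)\<close> directly follows the \<open>j\<close>-th letter of the \<open>i\<close>-th component (cyclically, it precedes
  the next letter of that component); an empty component \<open>i\<close> has the single gap \<open>(i, 0)\<close>.
\<close>

type_synonym gap = "nat \<times> nat"

datatype 'a token = Letter 'a | Reminder 'a | Gap gap

definition gapped_word :: "nat \<Rightarrow> 'a list \<Rightarrow> 'a token list" where
  "gapped_word i w =
     (if w = [] then [Gap (i, 0)]
      else concat (map (\<lambda>(j, A). [Letter A, Gap (i, j)]) (List.enumerate 0 w)))"

definition gapped_words :: "('a, 'b) nanophrase \<Rightarrow> 'a token list list" where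
  "gapped_words P = map (\<lambda>(i, w). gapped_word i w) (List.enumerate 0 (words P))"

text \<open>The change of projections in \<open>(Q)\<^sub>x\<close>; reminders in \<open>x\<close> play no role.\<close>

definition flip_proj :: "'a token list \<Rightarrow> ('a \<Rightarrow> int) \<Rightarrow> 'a \<Rightarrow> int" where
  "flip_proj x p = (\<lambda>B. if count_list x (Letter B) = 1 then - p B else p B)"

text \<open>
  One step of the deformation, on pairs of a phrase and its current projection, for the markers
  \<open>m\<close>. Since words are regarded as cyclic, \<open>rotate\<close> moves single tokens; moving the first letter
  of a component to its end means moving that letter and then the gap following it.
\<close>

inductive deform ::
  "('a \<Rightarrow> int) \<Rightarrow> 'a token list list \<times> ('a \<Rightarrow> int) \<Rightarrow> 'a token list list \<times> ('a \<Rightarrow> int) \<Rightarrow> bool"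
  for m :: "'a \<Rightarrow> int"
where
  permute: "mset ws = mset ws' \<Longrightarrow> deform m (ws, p) (ws', p)"
| rotate: "deform m (us @ [t # w] @ vs, p) (us @ [w @ [t]] @ vs, p)"
| split_eq: "m A = p A \<Longrightarrow>
    deform m (us @ [Letter A # x @ Letter A # y] @ vs, p)
             (us @ [Reminder A # x, Reminder A # y] @ vs, p)"
| split_neg: "m A = - p A \<Longrightarrow>
    deform m (us @ [Letter A # x @ Letter A # y] @ vs, p)
             (us @ [Reminder A # rev x @ Reminder A # y] @ vs, flip_proj x p)"
| join_eq: "m A = p A \<Longrightarrow>
    deform m (us @ [Letter A # x, Letter A # y] @ vs, p)
             (us @ [Reminder A # x @ Reminder A # y] @ vs, p)"
| join_neg: "m A = - p A \<Longrightarrow>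
    deform m (us @ [Letter A # x, Letter A # y] @ vs, p)
             (us @ [Reminder A # rev x @ Reminder A # y] @ vs, flip_proj x p)"

definition resolution :: "('a, int) nanophrase \<Rightarrow> ('a \<Rightarrow> int) \<Rightarrow> 'a token list list \<Rightarrow> bool" where
  "resolution P s Q \<longleftrightarrow>
     (\<exists>p. (deform s)\<^sup>*\<^sup>* (gapped_words P, proj P) (Q, p)) \<and>
     (\<forall>w\<in>set Q. \<forall>A. Letter A \<notin> set w)"


section \<open>Components of a state\<close>

text \<open>
  The words of a fully deformed phrase are determined only up to order, rotation and reversal,
  but the gaps and the reminders occurring together in one word do not depend on the choices
  made, so any resolution may be used. A component is represented by its block of gaps; thereby
  components of different states can be identified.
\<close>

definition resolved :: "('a, int) nanophrase \<Rightarrow> ('a \<Rightarrow> int) \<Rightarrow> 'a token list list" where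
  "resolved P s = (SOME Q. resolution P s Q)"

definition gap_block :: "'a token list \<Rightarrow> gap set" where
  "gap_block w = {g. Gap g \<in> set w}"

definition components :: "('a, int) nanophrase \<Rightarrow> ('a \<Rightarrow> int) \<Rightarrow> gap set set" where
  "components P s = gap_block ` set (resolved P s)"

definition components_containing ::
  "('a, int) nanophrase \<Rightarrow> ('a \<Rightarrow> int) \<Rightarrow> 'a \<Rightarrow> gap set set" where
  "components_containing P s A = gap_block ` {w \<in> set (resolved P s). Reminder A \<in> set w}"


section \<open>Enhanced states and incidence numbers\<close>

datatype sign = Plus | Minus

type_synonym 'a enhanced_state = "('a \<Rightarrow> int) \<times> (gap set \<Rightarrow> sign)"

definition enhanced_states :: "('a, int) nanophrase \<Rightarrow> 'a enhanced_state set" where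
  "enhanced_states P = (SIGMA s : states P. components P s \<rightarrow>\<^sub>E UNIV)"

definition incident_at ::
  "('a, int) nanophrase \<Rightarrow> 'a \<Rightarrow> 'a enhanced_state \<Rightarrow> 'a enhanced_state \<Rightarrow> bool" where
  "incident_at P A S T \<longleftrightarrow>
     (case (S, T) of ((s, \<sigma>), (t, \<tau>)) \<Rightarrow>
        s A = 1 \<and> t A = -1 \<and> (\<forall>B\<in>alphabet P - {A}. s B = t B) \<and>
        (\<forall>c\<in>components P s - components_containing P s A. \<sigma> c = \<tau> c) \<and>
        ((\<exists>b1 b2 c. b1 \<noteq> b2 \<and>
            components_containing P s A = {b1, b2} \<and> components_containing P t A = {c} \<and>
            (\<sigma> b1, \<sigma> b2, \<tau> c) \<in>
              {(Minus, Minus, Minus), (Minus, Plus, Plus), (Plus, Minus, Plus)}) \<or>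
         (\<exists>b c1 c2. c1 \<noteq> c2 \<and>
            components_containing P s A = {b} \<and> components_containing P t A = {c1, c2} \<and>
            (\<sigma> b, \<tau> c1, \<tau> c2) \<in>
              {(Plus, Plus, Plus), (Minus, Plus, Minus), (Minus, Minus, Plus)})))"

definition incidence ::
  "('a, int) nanophrase \<Rightarrow> 'a enhanced_state \<Rightarrow> 'a enhanced_state \<Rightarrow> int" where
  "incidence P S T = (if \<exists>A\<in>alphabet P. incident_at P A S T then 1 else 0)"


section \<open>The chain group and the boundary homomorphism\<close>

definition chain_group :: "('a, int) nanophrase \<Rightarrow> ('a enhanced_state \<Rightarrow>\<^sub>0 int) monoid" where
  "chain_group P = free_Abelian_group (enhanced_states P)"

text \<open>Only its restriction to the carrier of the chain group is meaningful.\<close>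

definition boundary ::
  "('a, int) nanophrase \<Rightarrow> ('a enhanced_state \<Rightarrow>\<^sub>0 int) \<Rightarrow> ('a enhanced_state \<Rightarrow>\<^sub>0 int)" where
  "boundary P =
     frag_extend (\<lambda>S. \<Sum>T\<in>enhanced_states P. frag_cmul (incidence P S T) (frag_of T))"

end

theory Submission
  imports Defs "HOL-Library.Disjoint_Sets"
begin

text \<open>
  Regard the components of a state as a partition of the set of gaps. Changing one marker merges
  two blocks, splits a block into two, or leaves the partition unchanged; in the last case the
  incidence numbers vanish, so the entries of \<open>d\<close> depend only on the two partitions. To see this,
  treat the letter \<open>A\<close> last: one is left with \<open>AxAy\<close> or \<open>Ax|Ay\<close>, where \<open>x\<close> and \<open>y\<close> are already
  connected, so that each marker of \<open>A\<close> joins these two arcs in an explicit way.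

  Given two states that differ at two letters, compare the two ways of changing the markers
  one after the other. Two merges compose to a map that depends only on the first and the last
  partition, and so do two splits. If first and last partition have equally many blocks but differ,
  a merge followed by a split passes through their join and a split followed by a merge through
  their meet, and the two composites agree by the Frobenius relation. If first and last partition
  coincide, a split followed by a merge contributes 0 or 2, and a merge followed by a split
  cannot occur.
\<close>

section \<open>Signs on partitions that differ by merging two blocks\<close>

text \<open>Components come from an arbitrarily chosen resolution, so two states cannot be compared
  until their blocks are described without reference to a deformation. To each letter and each
  marker two unordered links between the gaps next to its occurrences are attached, read off from
  the initial phrase. Reversing a stretch that contains the letter once interchanges the two
  possible pairs of links, and the sign change in (Q)_x undoes exactly this. Hence the links are
  invariant, and the components of a state are the connectivity classes of the union of its links.
  Changing a marker then replaces two links and keeps all others. The number of blocks changes by at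
  most one per step, so first and last partition alone tell which kinds of two-step paths can carry
  nonzero entries. A merge undone by a split has to be excluded by the geometry of the links:
  algebraically it leads from signs (-,-) to (+,-) in exactly one way, which is odd.\<close>

definition merge_rule :: "sign \<Rightarrow> sign \<Rightarrow> sign \<Rightarrow> bool" where
  "merge_rule x y z \<longleftrightarrow>
     (x, y, z) \<in> {(Minus, Minus, Minus), (Minus, Plus, Plus), (Plus, Minus, Plus)}"

text \<open>The coefficients of comultiplication, as \<open>merge_rule\<close> has those of
  multiplication, on Z[x]/(x^2), the Frobenius algebra of Khovanov homology, with
  \<open>Minus\<close> for 1 and \<open>Plus\<close> for x. The missing input (Plus, Plus) of
  \<open>merge_rule\<close> is x^2 = 0.\<close>

definition split_rule :: "sign \<Rightarrow> sign \<Rightarrow> sign \<Rightarrow> bool" where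
  "split_rule x y z \<longleftrightarrow>
     (x, y, z) \<in> {(Plus, Plus, Plus), (Minus, Plus, Minus), (Minus, Minus, Plus)}"

definition merges :: "'x set set \<Rightarrow> 'x set set \<Rightarrow> 'x set \<Rightarrow> 'x set \<Rightarrow> bool" where
  "merges \<pi> \<rho> b c \<longleftrightarrow> b \<in> \<pi> \<and> c \<in> \<pi> \<and> b \<noteq> c \<and> \<rho> = insert (b \<union> c) (\<pi> - {b, c})"

definition merged :: "'x set set \<Rightarrow> 'x set set \<Rightarrow> bool" where
  "merged \<pi> \<rho> \<longleftrightarrow> (\<exists>b c. merges \<pi> \<rho> b c)"

definition merge_entry ::
  "'x set set \<Rightarrow> 'x set set \<Rightarrow> ('x set \<Rightarrow> sign) \<Rightarrow> ('x set \<Rightarrow> sign) \<Rightarrow> bool" where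
  "merge_entry \<pi> \<rho> \<sigma> \<tau> \<longleftrightarrow>
     (\<exists>b c. merges \<pi> \<rho> b c \<and> (\<forall>a\<in>\<pi> - {b, c}. \<sigma> a = \<tau> a) \<and> merge_rule (\<sigma> b) (\<sigma> c) (\<tau> (b \<union> c)))"

definition split_entry ::
  "'x set set \<Rightarrow> 'x set set \<Rightarrow> ('x set \<Rightarrow> sign) \<Rightarrow> ('x set \<Rightarrow> sign) \<Rightarrow> bool" where
  "split_entry \<pi> \<rho> \<sigma> \<tau> \<longleftrightarrow>
     (\<exists>b c. merges \<rho> \<pi> b c \<and> (\<forall>a\<in>\<rho> - {b, c}. \<sigma> a = \<tau> a) \<and> split_rule (\<sigma> (b \<union> c)) (\<tau> b) (\<tau> c))"

definition entry ::
  "'x set set \<Rightarrow> 'x set set \<Rightarrow> ('x set \<Rightarrow> sign) \<Rightarrow> ('x set \<Rightarrow> sign) \<Rightarrow> bool" where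
  "entry \<pi> \<rho> \<sigma> \<tau> \<longleftrightarrow> merge_entry \<pi> \<rho> \<sigma> \<tau> \<or> split_entry \<pi> \<rho> \<sigma> \<tau>"

text \<open>Its cardinality is the contribution to a coefficient of \<open>d \<circ> d\<close> made
  by one intermediate state with components \<rho>. Extensionality makes each sign assignment count
  once.\<close>

definition paths_through ::
  "'x set set \<Rightarrow> 'x set set \<Rightarrow> 'x set set \<Rightarrow> ('x set \<Rightarrow> sign) \<Rightarrow> ('x set \<Rightarrow> sign) \<Rightarrow> ('x set \<Rightarrow> sign) set" where
  "paths_through \<pi> \<rho> \<pi>' \<sigma> \<upsilon> = {\<tau> \<in> \<rho> \<rightarrow>\<^sub>E UNIV. entry \<pi> \<rho> \<sigma> \<tau> \<and> entry \<rho> \<pi>' \<tau> \<upsilon>}"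

text \<open>
  In a merge the numbers of plus signs add up, in a split the numbers of minus signs do. In this
  form the composition law needs no case distinction on how the blocks overlap.
\<close>

definition count_entry ::
  "sign \<Rightarrow> 'x set set \<Rightarrow> 'x set set \<Rightarrow> ('x set \<Rightarrow> sign) \<Rightarrow> ('x set \<Rightarrow> sign) \<Rightarrow> bool" where
  "count_entry z \<pi> \<rho> \<sigma> \<tau> \<longleftrightarrow>
     (\<forall>c\<in>\<rho>. card {b \<in> \<pi>. b \<subseteq> c \<and> \<sigma> b = z} = of_bool (\<tau> c = z))"

section \<open>Merging two blocks of a partition\<close>

lemma merges_sym: "merges \<pi> \<rho> b c \<Longrightarrow> merges \<pi> \<rho> c b"
  by (auto simp: merges_def)

lemma merge_rule_sym: "merge_rule x y z \<Longrightarrow> merge_rule y x z"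
  by (auto simp: merge_rule_def)

lemma split_rule_sym: "split_rule x y z \<Longrightarrow> split_rule x z y"
  by (auto simp: split_rule_def)

lemma partition_block_eq:
  "partition_on X \<pi> \<Longrightarrow> b \<in> \<pi> \<Longrightarrow> c \<in> \<pi> \<Longrightarrow> x \<in> b \<Longrightarrow> x \<in> c \<Longrightarrow> b = c"
  unfolding partition_on_def disjoint_def by blast

lemma partition_subset_eq:
  "partition_on X \<pi> \<Longrightarrow> b \<in> \<pi> \<Longrightarrow> c \<in> \<pi> \<Longrightarrow> b \<subseteq> c \<Longrightarrow> b = c"
  by (metis partition_block_eq partition_onD3 subset_empty subsetD equals0I)

lemma merges_union_notin:
  assumes "partition_on X \<pi>" "merges \<pi> \<rho> b c"
  shows "b \<union> c \<notin> \<pi>"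
proof
  assume "b \<union> c \<in> \<pi>"
  moreover have "b \<in> \<pi>" "c \<in> \<pi>" using assms(2) by (auto simp: merges_def)
  ultimately have "b = b \<union> c" "c = b \<union> c"
    using partition_subset_eq[OF assms(1)] by (meson Un_upper1 Un_upper2)+
  then have "b = c" by (rule trans[OF _ sym])
  then show False using assms by (auto simp: merges_def)
qed

text \<open>The new block is not an old one, so the merged pair can be recovered from the two
  partitions. Hence any witness of \<open>merges\<close> may replace the bound variables of
  \<open>merge_entry\<close> and \<open>split_entry\<close>.\<close>

lemma merges_diff:
  assumes "partition_on X \<pi>" "merges \<pi> \<rho> b c"
  shows "\<pi> - \<rho> = {b, c}"
  using merges_union_notin[OF assms] assms(2) by (auto simp: merges_def)

lemma merges_unique:
  assumes "partition_on X \<pi>" "merges \<pi> \<rho> b c" "merges \<pi> \<rho> b' c'"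
  shows "b' = b \<and> c' = c \<or> b' = c \<and> c' = b"
  using merges_diff[OF assms(1,2)] merges_diff[OF assms(1,3)] by (auto simp: doubleton_eq_iff)

lemma card_merged:
  assumes "partition_on X \<pi>" "finite \<pi>" "merged \<pi> \<rho>"
  shows "card \<pi> = Suc (card \<rho>)"
proof -
  obtain b c where m: "merges \<pi> \<rho> b c" using assms(3) by (auto simp: merged_def)
  have "card {b, c} \<le> card \<pi>" using m assms(2) by (intro card_mono) (auto simp: merges_def)
  then show ?thesis
    using m assms(2) merges_union_notin[OF assms(1) m]
    by (auto simp: merges_def card_insert_if card_Diff_subset)
qed

lemma merged_block:
  assumes "merged \<pi> \<rho>" "b \<in> \<pi>"
  shows "\<exists>c\<in>\<rho>. b \<subseteq> c"
proof -
  obtain p q where m: "merges \<pi> \<rho> p q" using assms(1) by (auto simp: merged_def)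
  then have "p \<union> q \<in> \<rho>" "b \<in> {p, q} \<or> b \<in> \<rho>" using assms(2) by (auto simp: merges_def)
  then show ?thesis by blast
qed

lemma merge_entry_iff:
  assumes "partition_on X \<pi>" "merges \<pi> \<rho> b c"
  shows "merge_entry \<pi> \<rho> \<sigma> \<tau> \<longleftrightarrow>
    (\<forall>a\<in>\<pi> - {b, c}. \<sigma> a = \<tau> a) \<and> merge_rule (\<sigma> b) (\<sigma> c) (\<tau> (b \<union> c))"
proof
  assume "merge_entry \<pi> \<rho> \<sigma> \<tau>"
  then obtain b' c' where *: "merges \<pi> \<rho> b' c'" "\<forall>a\<in>\<pi> - {b', c'}. \<sigma> a = \<tau> a"
    "merge_rule (\<sigma> b') (\<sigma> c') (\<tau> (b' \<union> c'))"
    by (auto simp: merge_entry_def)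
  from merges_unique[OF assms *(1)] * show
    "(\<forall>a\<in>\<pi> - {b, c}. \<sigma> a = \<tau> a) \<and> merge_rule (\<sigma> b) (\<sigma> c) (\<tau> (b \<union> c))"
    by (auto simp: insert_commute Un_commute intro: merge_rule_sym)
qed (use assms in \<open>auto simp: merge_entry_def\<close>)

lemma split_entry_iff:
  assumes "partition_on X \<rho>" "merges \<rho> \<pi> b c"
  shows "split_entry \<pi> \<rho> \<sigma> \<tau> \<longleftrightarrow>
    (\<forall>a\<in>\<rho> - {b, c}. \<sigma> a = \<tau> a) \<and> split_rule (\<sigma> (b \<union> c)) (\<tau> b) (\<tau> c)"
proof
  assume "split_entry \<pi> \<rho> \<sigma> \<tau>"
  then obtain b' c' where *: "merges \<rho> \<pi> b' c'" "\<forall>a\<in>\<rho> - {b', c'}. \<sigma> a = \<tau> a"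
    "split_rule (\<sigma> (b' \<union> c')) (\<tau> b') (\<tau> c')"
    by (auto simp: split_entry_def)
  from merges_unique[OF assms *(1)] * show
    "(\<forall>a\<in>\<rho> - {b, c}. \<sigma> a = \<tau> a) \<and> split_rule (\<sigma> (b \<union> c)) (\<tau> b) (\<tau> c)"
    by (auto simp: insert_commute Un_commute intro: split_rule_sym)
qed (use assms in \<open>auto simp: split_entry_def\<close>)

section \<open>Entries as additive conditions on numbers of signs\<close>

lemma ball_merges_iff:
  assumes "merges \<pi> \<rho> b c"
  shows "(\<forall>a\<in>\<rho>. Q a) \<longleftrightarrow> (\<forall>a\<in>\<pi> - {b, c}. Q a) \<and> Q (b \<union> c)"
  using assms by (auto simp: merges_def)

lemma sign_exhaust: "x = Plus \<or> x = Minus"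
  by (cases x) auto

text \<open>A block other than \<open>b\<close> and \<open>c\<close> contains no block of \<pi> but
  itself, so there the count says that both signs are \<open>z\<close> or neither is; with two signs
  this is equality. Inside \<open>b \<union> c\<close> lie exactly \<open>b\<close> and
  \<open>c\<close>.\<close>

lemma count_entry_merges:
  assumes part: "partition_on X \<pi>" and m: "merges \<pi> \<rho> b c"
  shows "count_entry z \<pi> \<rho> \<sigma> \<tau> \<longleftrightarrow>
    (\<forall>a\<in>\<pi> - {b, c}. \<sigma> a = \<tau> a) \<and>
    of_bool (\<sigma> b = z) + of_bool (\<sigma> c = z) = (of_bool (\<tau> (b \<union> c) = z) :: nat)"
proof -
  have bc: "b \<in> \<pi>" "c \<in> \<pi>" "b \<noteq> c" using m by (auto simp: merges_def)
  have single: "card {b' \<in> \<pi>. b' \<subseteq> a \<and> \<sigma> b' = z} = of_bool (\<tau> a = z) \<longleftrightarrow> \<sigma> a = \<tau> a"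
    if "a \<in> \<pi> - {b, c}" for a
  proof -
    have "{b' \<in> \<pi>. b' \<subseteq> a \<and> \<sigma> b' = z} = (if \<sigma> a = z then {a} else {})"
      using that partition_subset_eq[OF part] by auto
    then show ?thesis
      using sign_exhaust[of "\<sigma> a"] sign_exhaust[of "\<tau> a"] sign_exhaust[of z] by auto
  qed
  have "{b' \<in> \<pi>. b' \<subseteq> b \<union> c \<and> \<sigma> b' = z} =
     (if \<sigma> b = z then {b} else {}) \<union> (if \<sigma> c = z then {c} else {})"
  proof -
    have "b' = b \<or> b' = c" if "b' \<in> \<pi>" "b' \<subseteq> b \<union> c" for b'
    proof -
      have "b' \<noteq> {}" using that(1) partition_onD3[OF part] by blast
      then obtain x where "x \<in> b'" by blast
      with that partition_block_eq[OF part] bc show ?thesis by blast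
    qed
    with bc show ?thesis by auto
  qed
  then have "card {b' \<in> \<pi>. b' \<subseteq> b \<union> c \<and> \<sigma> b' = z} = of_bool (\<sigma> b = z) + of_bool (\<sigma> c = z)"
    using bc by auto
  with single show ?thesis
    unfolding count_entry_def ball_merges_iff[OF m] by simp
qed

text \<open>Two plus signs add up to 2, which is no value of \<open>of_bool\<close>: this is the
  forbidden input of \<open>merge_rule\<close>. For the other three inputs the sum determines the
  output.\<close>

lemma merge_entry_count:
  assumes "partition_on X \<pi>" "merged \<pi> \<rho>"
  shows "merge_entry \<pi> \<rho> \<sigma> \<tau> \<longleftrightarrow> count_entry Plus \<pi> \<rho> \<sigma> \<tau>"
proof -
  obtain b c where m: "merges \<pi> \<rho> b c" using assms(2) by (auto simp: merged_def)
  show ?thesis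
    unfolding merge_entry_iff[OF assms(1) m] count_entry_merges[OF assms(1) m]
    using sign_exhaust[of "\<sigma> b"] sign_exhaust[of "\<sigma> c"] sign_exhaust[of "\<tau> (b \<union> c)"]
    by (auto simp: merge_rule_def)
qed

text \<open>The same additive law with minus signs, read against the direction of the split: the
  finer partition \<rho> comes first in \<open>count_entry\<close>, and \<sigma>, \<tau> change
  places.\<close>

lemma split_entry_count:
  assumes "partition_on X \<rho>" "merged \<rho> \<pi>"
  shows "split_entry \<pi> \<rho> \<sigma> \<tau> \<longleftrightarrow> count_entry Minus \<rho> \<pi> \<tau> \<sigma>"
proof -
  obtain b c where m: "merges \<rho> \<pi> b c" using assms(2) by (auto simp: merged_def)
  have "split_rule (\<sigma> (b \<union> c)) (\<tau> b) (\<tau> c) \<longleftrightarrow>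
      of_bool (\<tau> b = Minus) + of_bool (\<tau> c = Minus) = (of_bool (\<sigma> (b \<union> c) = Minus) :: nat)"
    using sign_exhaust[of "\<tau> b"] sign_exhaust[of "\<tau> c"] sign_exhaust[of "\<sigma> (b \<union> c)"]
    by (auto simp: split_rule_def)
  moreover have "(\<forall>a\<in>\<rho> - {b, c}. \<sigma> a = \<tau> a) \<longleftrightarrow> (\<forall>a\<in>\<rho> - {b, c}. \<tau> a = \<sigma> a)" by metis
  ultimately show ?thesis
    unfolding split_entry_iff[OF assms(1) m] count_entry_merges[OF assms(1) m] by simp
qed

text \<open>Counts are additive: a block \<open>d\<close> of the coarsest partition collects the
  counts of the blocks of \<rho> inside it. The intermediate \<tau> is forced by the counts in the
  blocks of \<rho> and exists when these are at most 1, which the total in \<open>d\<close>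
  guarantees. For \<open>z = Plus\<close> this is associativity, for \<open>z = Minus\<close>
  coassociativity.\<close>

lemma count_entry_comp:
  assumes \<pi>: "partition_on X \<pi>" "finite \<pi>" and \<rho>: "partition_on X \<rho>" "finite \<rho>"
    and \<pi>': "partition_on X \<pi>'"
    and ref: "\<And>b. b \<in> \<pi> \<Longrightarrow> \<exists>c\<in>\<rho>. b \<subseteq> c" "\<And>c. c \<in> \<rho> \<Longrightarrow> \<exists>d\<in>\<pi>'. c \<subseteq> d"
  shows "card {\<tau> \<in> \<rho> \<rightarrow>\<^sub>E UNIV. count_entry z \<pi> \<rho> \<sigma> \<tau> \<and> count_entry z \<rho> \<pi>' \<tau> \<upsilon>} =
    of_bool (count_entry z \<pi> \<pi>' \<sigma> \<upsilon>)"
proof -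
  define f where "f c = card {b \<in> \<pi>. b \<subseteq> c \<and> \<sigma> b = z}" for c
  have add: "f d = (\<Sum>c | c \<in> \<rho> \<and> c \<subseteq> d. f c)" if d: "d \<in> \<pi>'" for d
  proof -
    have "{b \<in> \<pi>. b \<subseteq> d \<and> \<sigma> b = z} = (\<Union>c\<in>{c \<in> \<rho>. c \<subseteq> d}. {b \<in> \<pi>. b \<subseteq> c \<and> \<sigma> b = z})"
    proof (intro equalityI subsetI)
      fix b assume "b \<in> {b \<in> \<pi>. b \<subseteq> d \<and> \<sigma> b = z}"
      then have b: "b \<in> \<pi>" "b \<subseteq> d" "\<sigma> b = z" by auto
      obtain c where c: "c \<in> \<rho>" "b \<subseteq> c" using ref(1) b by blast
      obtain d' where d': "d' \<in> \<pi>'" "c \<subseteq> d'" using ref(2) c by blast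
      have "b \<noteq> {}" using b(1) partition_onD3[OF \<pi>(1)] by blast
      then obtain x where "x \<in> b" by blast
      then have "d' = d" using partition_block_eq[OF \<pi>' d'(1) d] b c d' by blast
      then show "b \<in> (\<Union>c\<in>{c \<in> \<rho>. c \<subseteq> d}. {b \<in> \<pi>. b \<subseteq> c \<and> \<sigma> b = z})"
        using b c d' by blast
    qed auto
    moreover have "{b \<in> \<pi>. b \<subseteq> c \<and> \<sigma> b = z} \<inter> {b \<in> \<pi>. b \<subseteq> c' \<and> \<sigma> b = z} = {}"
      if "c \<in> \<rho>" "c' \<in> \<rho>" "c \<noteq> c'" for c c'
    proof -
      have "b = {}" if "b \<subseteq> c" "b \<subseteq> c'" for b
        using that partition_block_eq[OF \<rho>(1) \<open>c \<in> \<rho>\<close> \<open>c' \<in> \<rho>\<close>] \<open>c \<noteq> c'\<close> by blast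
      then show ?thesis using \<pi> by (auto simp: partition_on_def)
    qed
    ultimately show ?thesis
      unfolding f_def using \<rho> \<pi> by (simp add: card_UN_disjoint)
  qed
  \<comment> \<open>The only candidate: \<open>z\<close> where the count is 1, the other sign
    elsewhere.\<close>
  define \<tau>0 where "\<tau>0 = restrict (\<lambda>c. if f c = 1 then z else (if z = Plus then Minus else Plus)) \<rho>"
  have \<tau>0: "\<tau>0 c = z \<longleftrightarrow> f c = 1" if "c \<in> \<rho>" for c
    using that sign_exhaust[of z] by (auto simp: \<tau>0_def)
  have uniq: "\<tau> = \<tau>0" if \<tau>: "\<tau> \<in> \<rho> \<rightarrow>\<^sub>E UNIV" "count_entry z \<pi> \<rho> \<sigma> \<tau>" for \<tau>
  proof (rule PiE_ext[OF \<tau>(1)])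
    show "\<tau>0 \<in> \<rho> \<rightarrow>\<^sub>E UNIV" by (auto simp: \<tau>0_def)
    fix c assume c: "c \<in> \<rho>"
    then have "f c = of_bool (\<tau> c = z)" using \<tau>(2) by (auto simp: count_entry_def f_def)
    then show "\<tau> c = \<tau>0 c"
      using \<tau>0[OF c] sign_exhaust[of "\<tau> c"] sign_exhaust[of z] sign_exhaust[of "\<tau>0 c"]
      by (metis One_nat_def of_bool_eq(1,2) sign.distinct(1) zero_neq_one)
  qed
  have key: "count_entry z \<rho> \<pi>' \<tau> \<upsilon> \<longleftrightarrow> count_entry z \<pi> \<pi>' \<sigma> \<upsilon>"
    if \<tau>: "count_entry z \<pi> \<rho> \<sigma> \<tau>" for \<tau>
  proof -
    have "card {c \<in> \<rho>. c \<subseteq> d \<and> \<tau> c = z} = f d" if "d \<in> \<pi>'" for d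
    proof -
      have "f d = (\<Sum>c | c \<in> \<rho> \<and> c \<subseteq> d. of_bool (\<tau> c = z))"
        using add[OF that] \<tau> by (auto simp: count_entry_def f_def)
      also have "\<dots> = card ({c. c \<in> \<rho> \<and> c \<subseteq> d} \<inter> {c. \<tau> c = z})"
        using \<rho>(2) by (subst sum_of_bool_eq) auto
      also have "{c. c \<in> \<rho> \<and> c \<subseteq> d} \<inter> {c. \<tau> c = z} = {c \<in> \<rho>. c \<subseteq> d \<and> \<tau> c = z}" by auto
      finally show ?thesis by simp
    qed
    then show ?thesis by (auto simp: count_entry_def f_def)
  qed
  have ex: "count_entry z \<pi> \<rho> \<sigma> \<tau>0" if "count_entry z \<pi> \<pi>' \<sigma> \<upsilon>"
    unfolding count_entry_def
  proof
    fix c assume c: "c \<in> \<rho>"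
    obtain d where d: "d \<in> \<pi>'" "c \<subseteq> d" using ref(2) c by blast
    \<comment> \<open>No block of \<rho> can have a count above 1, since the larger block
      \<open>d\<close> already has count at most 1.\<close>
    have "f c \<le> f d" unfolding f_def using d \<pi> by (intro card_mono) auto
    also have "f d \<le> 1" using that d by (auto simp: count_entry_def f_def)
    finally show "card {b \<in> \<pi>. b \<subseteq> c \<and> \<sigma> b = z} = of_bool (\<tau>0 c = z)"
      using \<tau>0[OF c] by (auto simp: f_def)
  qed
  have \<tau>0_in: "\<tau>0 \<in> \<rho> \<rightarrow>\<^sub>E UNIV" by (auto simp: \<tau>0_def)
  show ?thesis (is "card ?S = _")
  proof (cases "count_entry z \<pi> \<pi>' \<sigma> \<upsilon>")
    case True
    then have "\<tau>0 \<in> ?S" using \<tau>0_in ex key by blast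
    moreover have "?S \<subseteq> {\<tau>0}" using uniq by blast
    ultimately have "?S = {\<tau>0}" by blast
    then show ?thesis using True by simp
  next
    case False
    then have "?S = {}" using key by blast
    then show ?thesis using False by (simp only: card.empty of_bool_eq)
  qed
qed

section \<open>Direction of an edge, and composites of two edges of equal direction\<close>

lemma merged_imp_not:
  assumes "partition_on X \<pi>" "finite \<pi>" "merged \<pi> \<rho>" 
  shows "\<pi> \<noteq> \<rho>"
  using card_merged[OF assms] by auto

lemma merged_partition:
  assumes "partition_on X \<pi>" "merged \<pi> \<rho>"
  shows "partition_on X \<rho>"
proof -
  obtain b c where m: "merges \<pi> \<rho> b c" using assms(2) by (auto simp: merged_def)
  show ?thesis
  proof (rule partition_onI)
    show "\<Union>\<rho> = X" using m partition_onD1[OF assms(1)] by (auto simp: merges_def)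
    show "{} \<notin> \<rho>"
      using m partition_onD3[OF assms(1)] by (auto simp: merges_def)
    show "disjnt p q" if "p \<in> \<rho>" "q \<in> \<rho>" "p \<noteq> q" for p q
      using that m partition_block_eq[OF assms(1)] by (auto simp: merges_def disjnt_def)
  qed
qed

lemma merged_finite: "merged \<pi> \<rho> \<Longrightarrow> finite \<pi> \<Longrightarrow> finite \<rho>"
  by (auto simp: merged_def merges_def)

text \<open>A merge lowers the number of blocks by one, so the opposite disjunct of
  \<open>entry\<close> would need \<rho> to have more blocks than \<pi>.\<close>

lemma entry_merged:
  assumes "partition_on X \<pi>" "finite \<pi>" "merged \<pi> \<rho>"
  shows "entry \<pi> \<rho> \<sigma> \<tau> \<longleftrightarrow> merge_entry \<pi> \<rho> \<sigma> \<tau>"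
proof -
  have "finite \<rho>" using assms(2,3) by (auto simp: merged_def merges_def)
  then have "\<not> merged \<rho> \<pi>"
    using card_merged[OF assms] card_merged[OF merged_partition[OF assms(1,3)]] by force
  then show ?thesis by (auto simp: entry_def split_entry_def merged_def)
qed

lemma entry_split:
  assumes "partition_on X \<rho>" "finite \<rho>" "merged \<rho> \<pi>"
  shows "entry \<pi> \<rho> \<sigma> \<tau> \<longleftrightarrow> split_entry \<pi> \<rho> \<sigma> \<tau>"
proof -
  have "finite \<pi>" using assms(2,3) by (auto simp: merged_def merges_def)
  then have "\<not> merged \<pi> \<rho>"
    using card_merged[OF assms] card_merged[OF merged_partition[OF assms(1,3)]] by force
  then show ?thesis by (auto simp: entry_def merge_entry_def merged_def)
qed

text \<open>Merging changes the number of blocks. Hence a change of marker that keeps the partition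
  carries no entry, in agreement with the incidence number 0 for one component passing to one
  component.\<close>

lemma entry_same:
  assumes "partition_on X \<pi>" "finite \<pi>"
  shows "\<not> entry \<pi> \<pi> \<sigma> \<tau>"
proof -
  have "\<not> merged \<pi> \<pi>" using merged_imp_not[OF assms] by blast
  then show ?thesis unfolding entry_def merge_entry_def split_entry_def merged_def by blast
qed

lemma card_paths_merge_merge:
  assumes "partition_on X \<pi>" "finite \<pi>" "merged \<pi> \<rho>" "merged \<rho> \<pi>'"
  shows "card (paths_through \<pi> \<rho> \<pi>' \<sigma> \<upsilon>) = of_bool (count_entry Plus \<pi> \<pi>' \<sigma> \<upsilon>)"
proof -
  have \<rho>: "partition_on X \<rho>" "finite \<rho>"
    by (rule merged_partition[OF assms(1,3)], rule merged_finite[OF assms(3,2)])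
  have \<pi>': "partition_on X \<pi>'" "finite \<pi>'"
    by (rule merged_partition[OF \<rho>(1) assms(4)], rule merged_finite[OF assms(4) \<rho>(2)])
  show ?thesis
    unfolding paths_through_def entry_merged[OF assms(1-3)] entry_merged[OF \<rho> assms(4)]
      merge_entry_count[OF assms(1,3)] merge_entry_count[OF \<rho>(1) assms(4)]
    by (rule count_entry_comp[OF assms(1,2) \<rho> \<pi>'(1) merged_block[OF assms(3)] merged_block[OF assms(4)]])
qed

text \<open>Read backwards, two splits are two merges that start at the finest partition
  \<open>\<pi>'\<close>, with minus signs counted; so the same composition law applies.\<close>

lemma card_paths_split_split:
  assumes "partition_on X \<pi>'" "finite \<pi>'" "merged \<pi>' \<rho>" "merged \<rho> \<pi>"
  shows "card (paths_through \<pi> \<rho> \<pi>' \<sigma> \<upsilon>) = of_bool (count_entry Minus \<pi>' \<pi> \<upsilon> \<sigma>)"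
proof -
  have \<rho>: "partition_on X \<rho>" "finite \<rho>"
    by (rule merged_partition[OF assms(1,3)], rule merged_finite[OF assms(3,2)])
  have \<pi>: "partition_on X \<pi>" "finite \<pi>"
    by (rule merged_partition[OF \<rho>(1) assms(4)], rule merged_finite[OF assms(4) \<rho>(2)])
  have "paths_through \<pi> \<rho> \<pi>' \<sigma> \<upsilon> =
    {\<tau> \<in> \<rho> \<rightarrow>\<^sub>E UNIV. count_entry Minus \<pi>' \<rho> \<upsilon> \<tau> \<and> count_entry Minus \<rho> \<pi> \<tau> \<sigma>}"
    unfolding paths_through_def entry_split[OF assms(1-3)] entry_split[OF \<rho> assms(4)]
      split_entry_count[OF assms(1,3)] split_entry_count[OF \<rho>(1) assms(4)] by blast
  then show ?thesis
    using count_entry_comp[OF assms(1,2) \<rho> \<pi>(1) merged_block[OF assms(3)] merged_block[OF assms(4)]]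
    by simp
qed


text \<open>Distinct partitions with equally many blocks cannot refine one another, so some block
  \<open>b\<close> of \<open>\<pi>'\<close> meets two blocks \<open>c\<close>, \<open>d\<close> of
  \<pi>. A common coarsening has a block containing \<open>b\<close>, hence a single merge of \<pi>
  leading to it must join \<open>c\<close> and \<open>d\<close>.\<close>

lemma merged_coarsening_unique:
  assumes \<pi>: "partition_on X \<pi>" "finite \<pi>" and \<pi>': "partition_on X \<pi>'" and ne: "\<pi> \<noteq> \<pi>'"
    and m: "merged \<pi> \<rho>\<^sub>1" "merged \<pi>' \<rho>\<^sub>1" "merged \<pi> \<rho>\<^sub>2" "merged \<pi>' \<rho>\<^sub>2"
  shows "\<rho>\<^sub>1 = \<rho>\<^sub>2"
proof -
  have fin: "finite \<pi>'"
  proof -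
    obtain b c where "\<rho>\<^sub>1 = insert (b \<union> c) (\<pi>' - {b, c})" using m(2) by (auto simp: merged_def merges_def)
    moreover have "finite \<rho>\<^sub>1" by (rule merged_finite[OF m(1) \<pi>(2)])
    ultimately show ?thesis by simp
  qed
  have card: "card \<pi> = card \<pi>'"
    using card_merged[OF \<pi> m(1)] card_merged[OF \<pi>'(1) fin m(2)] by simp
  \<comment> \<open>Otherwise the map \<open>f\<close> from a block of \<open>\<pi>'\<close> to the
    block of \<pi> around it would be onto, hence injective by the equal cardinalities, and then
    \<open>f b = b\<close> throughout.\<close>
  have "\<exists>b\<in>\<pi>'. \<not> (\<exists>c\<in>\<pi>. b \<subseteq> c)"
  proof (rule ccontr)
    assume "\<not> ?thesis"
    then have "\<forall>b\<in>\<pi>'. \<exists>c. c \<in> \<pi> \<and> b \<subseteq> c" by blast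
    then obtain f where f: "\<forall>b\<in>\<pi>'. f b \<in> \<pi> \<and> b \<subseteq> f b" by metis
    have "\<pi> \<subseteq> f ` \<pi>'"
    proof
      fix c assume c: "c \<in> \<pi>"
      then have "c \<noteq> {}" using partition_onD3[OF \<pi>(1)] by blast
      then obtain x where x: "x \<in> c" by blast
      then have "x \<in> X" using c partition_onD1[OF \<pi>(1)] by blast
      then obtain b where "b \<in> \<pi>'" "x \<in> b" using partition_onD1[OF \<pi>'] by blast
      then have "f b = c" using f x c partition_block_eq[OF \<pi>(1)] by blast
      then show "c \<in> f ` \<pi>'" using \<open>b \<in> \<pi>'\<close> by blast
    qed
    moreover have "f ` \<pi>' \<subseteq> \<pi>" using f by blast
    ultimately have "f ` \<pi>' = \<pi>" by blast
    then have inj: "inj_on f \<pi>'" using card fin by (intro eq_card_imp_inj_on) auto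
    have "f b = b" if b: "b \<in> \<pi>'" for b
    proof
      show "b \<subseteq> f b" using f b by blast
      show "f b \<subseteq> b"
      proof
        fix x assume x: "x \<in> f b"
        then have "x \<in> X" using f b partition_onD1[OF \<pi>(1)] by blast
        then obtain b' where b': "b' \<in> \<pi>'" "x \<in> b'" using partition_onD1[OF \<pi>'] by blast
        then have "f b' = f b" using f x b partition_block_eq[OF \<pi>(1)] by blast
        then show "x \<in> b" using inj b b' by (auto dest: inj_onD)
      qed
    qed
    then have "f ` \<pi>' = \<pi>'" by force
    then show False using \<open>f ` \<pi>' = \<pi>\<close> ne by simp
  qed
  then obtain b where b: "b \<in> \<pi>'" "\<And>c. c \<in> \<pi> \<Longrightarrow> \<not> b \<subseteq> c" by blast
  have "b \<noteq> {}" using b(1) partition_onD3[OF \<pi>'] by blast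
  then obtain x where x: "x \<in> b" by blast
  then have "x \<in> X" using b(1) partition_onD1[OF \<pi>'] by blast
  then obtain c where c: "c \<in> \<pi>" "x \<in> c" using partition_onD1[OF \<pi>(1)] by blast
  obtain y where y: "y \<in> b" "y \<notin> c" using b(2)[OF c(1)] by blast
  then have "y \<in> X" using b(1) partition_onD1[OF \<pi>'] by blast
  then obtain d where d: "d \<in> \<pi>" "y \<in> d" using partition_onD1[OF \<pi>(1)] by blast
  have "\<rho> = insert (c \<union> d) (\<pi> - {c, d})" if h: "merged \<pi> \<rho>" "merged \<pi>' \<rho>" for \<rho>
  proof -
    obtain p q where pq: "merges \<pi> \<rho> p q" using h by (auto simp: merged_def)
    obtain r where r: "r \<in> \<rho>" "b \<subseteq> r" using merged_block[OF h(2) b(1)] by blast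
    have "r = p \<union> q"
    proof (rule ccontr)
      assume "r \<noteq> p \<union> q"
      then have "r \<in> \<pi>" using pq r by (auto simp: merges_def)
      then show False using b(2) r by blast
    qed
    then have "x \<in> p \<union> q" "y \<in> p \<union> q" using x y r by auto
    then have "c \<in> {p, q}" "d \<in> {p, q}" "c \<noteq> d"
      using c d y pq partition_block_eq[OF \<pi>(1)] by (auto simp: merges_def)
    then have "{c, d} = {p, q}" "c \<union> d = p \<union> q" by auto
    then show ?thesis using pq by (simp add: merges_def)
  qed
  then show ?thesis using m by metis
qed

text \<open>A partition that reaches both \<pi> and \<open>\<pi>'\<close> by one merge is recovered
  by intersecting: it is the set \<open>K\<close> of nonempty intersections of their blocks. The two
  merged pairs must differ for this, and they do, as a common pair would give
  \<open>\<pi> = \<pi>'\<close>.\<close>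

lemma merged_refinement_unique:
  assumes \<pi>: "partition_on X \<pi>" and \<pi>': "partition_on X \<pi>'" "finite \<pi>'" and ne: "\<pi> \<noteq> \<pi>'"
    and \<rho>\<^sub>1: "partition_on X \<rho>\<^sub>1" and \<rho>\<^sub>2: "partition_on X \<rho>\<^sub>2"
    and m: "merged \<rho>\<^sub>1 \<pi>" "merged \<rho>\<^sub>1 \<pi>'" "merged \<rho>\<^sub>2 \<pi>" "merged \<rho>\<^sub>2 \<pi>'"
  shows "\<rho>\<^sub>1 = \<rho>\<^sub>2"
proof -
  have sub: "\<rho> \<subseteq> \<rho>'" if \<rho>: "partition_on X \<rho>" "merged \<rho> \<pi>" "merged \<rho> \<pi>'"
    and \<rho>': "partition_on X \<rho>'" "merged \<rho>' \<pi>" "merged \<rho>' \<pi>'" for \<rho> \<rho>'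
  proof -
    define K where "K = {b \<inter> c |b c. b \<in> \<pi> \<and> c \<in> \<pi>' \<and> b \<inter> c \<noteq> {}}"
    have "\<tau> = K" if \<tau>: "partition_on X \<tau>" "merged \<tau> \<pi>" "merged \<tau> \<pi>'" for \<tau>
    proof -
      obtain p q where pq: "merges \<tau> \<pi> p q" using \<tau> by (auto simp: merged_def)
      obtain p' q' where pq': "merges \<tau> \<pi>' p' q'" using \<tau> by (auto simp: merged_def)
      have ne': "{p, q} \<noteq> {p', q'}"
      proof
        assume "{p, q} = {p', q'}"
        moreover from this have "p \<union> q = p' \<union> q'" by (auto simp: doubleton_eq_iff)
        ultimately show False using pq pq' ne by (simp add: merges_def)
      qed
      have dj: "r \<inter> r' = {}" if "r \<in> \<tau>" "r' \<in> \<tau>" "r \<noteq> r'" for r r'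
        using partition_block_eq[OF \<tau>(1)] that by blast
      have e: "r \<noteq> {}" if "r \<in> \<tau>" for r using partition_onD3[OF \<tau>(1)] that by blast
      have mem: "p \<in> \<tau>" "q \<in> \<tau>" "p' \<in> \<tau>" "q' \<in> \<tau>" "p \<noteq> q" "p' \<noteq> q'"
        using pq pq' by (auto simp: merges_def)
      show "\<tau> = K"
      proof
        show "\<tau> \<subseteq> K"
        proof
          fix r assume r: "r \<in> \<tau>"
          obtain b where b: "b \<in> \<pi>" "r \<subseteq> b" using merged_block[OF \<tau>(2) r] by blast
          obtain c where c: "c \<in> \<pi>'" "r \<subseteq> c" using merged_block[OF \<tau>(3) r] by blast
          have bform: "b = r \<or> (r \<in> {p, q} \<and> b = p \<union> q)"
          proof (cases "b = p \<union> q")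
            case True
            then have "r = p \<or> r = q" using dj[OF r mem(1)] dj[OF r mem(2)] b e[OF r] by blast
            then show ?thesis using True by blast
          next
            case False
            then have "b \<in> \<tau>" using b pq by (auto simp: merges_def)
            then show ?thesis using dj[OF r] b e[OF r] by blast
          qed
          have cform: "c = r \<or> (r \<in> {p', q'} \<and> c = p' \<union> q')"
          proof (cases "c = p' \<union> q'")
            case True
            then have "r = p' \<or> r = q'" using dj[OF r mem(3)] dj[OF r mem(4)] c e[OF r] by blast
            then show ?thesis using True by blast
          next
            case False
            then have "c \<in> \<tau>" using c pq' by (auto simp: merges_def)
            then show ?thesis using dj[OF r] c e[OF r] by blast
          qed
          \<comment> \<open>Only a block \<open>r\<close> in both merged pairs is critical; its
            partners \<open>u\<close> and \<open>v\<close> are different blocks, so they add nothing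
            to the intersection.\<close>
          have "b \<inter> c = r"
          proof (cases "b = r \<or> c = r")
            case True then show ?thesis using b c by blast
          next
            case False
            then have f: "r \<in> {p, q}" "b = p \<union> q" "r \<in> {p', q'}" "c = p' \<union> q'"
              using bform cform by auto
            obtain u where u: "u \<in> \<tau>" "u \<noteq> r" "b = r \<union> u" "{p, q} = {r, u}"
              using f mem by blast
            obtain v where v: "v \<in> \<tau>" "v \<noteq> r" "c = r \<union> v" "{p', q'} = {r, v}"
              using f mem by blast
            have "u \<noteq> v" using ne' u v by auto
            then have "u \<inter> v = {}" using dj u v by blast
            then show ?thesis using u v by blast
          qed
          then show "r \<in> K" using b c e[OF r] unfolding K_def by blast
        qed
        show "K \<subseteq> \<tau>"
        proof
          fix k assume "k \<in> K"
          then obtain b c where bc: "b \<in> \<pi>" "c \<in> \<pi>'" "k = b \<inter> c" "k \<noteq> {}"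
            unfolding K_def by blast
          show "k \<in> \<tau>"
          proof (cases "b = p \<union> q")
            case False
            then have b: "b \<in> \<tau>" using bc pq by (auto simp: merges_def)
            obtain c' where c': "c' \<in> \<pi>'" "b \<subseteq> c'" using merged_block[OF \<tau>(3) b] by blast
            have "c' = c" using partition_block_eq[OF \<pi>'(1) c'(1) bc(2)] bc c' by blast
            then show ?thesis using b bc c' by (simp add: Int_absorb2)
          next
            case T: True
            show ?thesis
            proof (cases "c = p' \<union> q'")
              case False
              then have c: "c \<in> \<tau>" using bc pq' by (auto simp: merges_def)
              obtain b' where b': "b' \<in> \<pi>" "c \<subseteq> b'" using merged_block[OF \<tau>(2) c] by blast
              have "b' = b" using partition_block_eq[OF \<pi> b'(1) bc(1)] bc b' by blast
              then show ?thesis using c bc b' by (simp add: Int_absorb1)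
            next
              case True
              \<comment> \<open>Pairs without a common block have disjoint unions, so two merged
                blocks that meet share a block.\<close>
              have "{p, q} \<inter> {p', q'} \<noteq> {}"
              proof
                assume "{p, q} \<inter> {p', q'} = {}"
                then have "b \<inter> c = {}" using T True dj mem by blast
                then show False using bc by simp
              qed
              then obtain r where r: "r \<in> {p, q}" "r \<in> {p', q'}" by blast
              obtain u where u: "u \<in> \<tau>" "u \<noteq> r" "b = r \<union> u" "{p, q} = {r, u}"
                using r T mem by blast
              obtain v where v: "v \<in> \<tau>" "v \<noteq> r" "c = r \<union> v" "{p', q'} = {r, v}"
                using r True mem by blast
              have "u \<noteq> v" using ne' u v by auto
              moreover have "r \<in> \<tau>" using r mem by blast
              ultimately have "u \<inter> v = {}" using dj u v by blast
              then have "b \<inter> c = r" using u v by blast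
              then show ?thesis using bc \<open>r \<in> \<tau>\<close> by simp
            qed
          qed
        qed
      qed
    qed
    then show ?thesis using \<rho> \<rho>' by blast
  qed
  show ?thesis using sub[OF \<rho>\<^sub>1 m(1,2) \<rho>\<^sub>2 m(3,4)] sub[OF \<rho>\<^sub>2 m(3,4) \<rho>\<^sub>1 m(1,2)] by blast
qed

text \<open>Turns path counts into counts of signs at one block \<open>k\<close>: once
  \<open>f\<close> fixes the other values, extensionality leaves only the value at
  \<open>k\<close>.\<close>

lemma card_extensions:
  fixes f :: "'b \<Rightarrow> sign"
  assumes "k \<in> K"
  shows "card {\<tau> \<in> K \<rightarrow>\<^sub>E UNIV. (\<forall>a\<in>K - {k}. \<tau> a = f a) \<and> Q (\<tau> k)} = card {x. Q x}"
proof -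
  have "bij_betw (\<lambda>x. restrict (f(k := x)) K) {x. Q x}
    {\<tau> \<in> K \<rightarrow>\<^sub>E UNIV. (\<forall>a\<in>K - {k}. \<tau> a = f a) \<and> Q (\<tau> k)}"
  proof (rule bij_betwI[where g = "\<lambda>\<tau>. \<tau> k"])
    show "(\<lambda>x. restrict (f(k := x)) K) \<in> {x. Q x} \<rightarrow>
      {\<tau> \<in> K \<rightarrow>\<^sub>E UNIV. (\<forall>a\<in>K - {k}. \<tau> a = f a) \<and> Q (\<tau> k)}"
      using assms by auto
    fix \<tau> assume "\<tau> \<in> {\<tau> \<in> K \<rightarrow>\<^sub>E UNIV. (\<forall>a\<in>K - {k}. \<tau> a = f a) \<and> Q (\<tau> k)}"
    then have t: "\<tau> \<in> K \<rightarrow>\<^sub>E UNIV" "\<forall>a\<in>K - {k}. \<tau> a = f a" by auto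
    show "restrict (f(k := \<tau> k)) K = \<tau>"
    proof
      fix a show "restrict (f(k := \<tau> k)) K a = \<tau> a"
        using t by (cases "a \<in> K") (auto simp: PiE_def extensional_def)
    qed
  qed (use assms in auto)
  then show ?thesis by (rule bij_betw_same_card[symmetric])
qed

lemma sign_sets:
  "{x. Q x} = (if Q Plus then {Plus} else {}) \<union> (if Q Minus then {Minus} else {})"
proof -
  have "x \<in> {x. Q x} \<longleftrightarrow> x \<in> (if Q Plus then {Plus} else {}) \<union> (if Q Minus then {Minus} else {})" for x
    by (cases x) auto
  then show ?thesis by blast
qed

text \<open>Away from the changed blocks a path keeps all signs. The right side separates this into
  a condition that fixes \<tau> and one that does not mention \<tau>, which is the form used by
  \<open>card_extensions\<close>.\<close>

lemma ball_eq_trans: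
  "(\<forall>a\<in>R. \<sigma> a = \<tau> a) \<and> (\<forall>a\<in>R. \<tau> a = \<upsilon> a) \<longleftrightarrow> (\<forall>a\<in>R. \<tau> a = \<sigma> a) \<and> (\<forall>a\<in>R. \<sigma> a = \<upsilon> a)"
  by metis

lemma ball_fun_upd:
  "p \<notin> R \<Longrightarrow> (\<forall>a\<in>R. \<tau> a = (\<sigma>(p := x)) a) \<longleftrightarrow> (\<forall>a\<in>R. \<tau> a = \<sigma> a)"
  by (metis fun_upd_other)

lemma union_by_sign:
  assumes "\<And>\<tau>. \<tau> \<in> L \<longleftrightarrow> \<tau> \<in> A (v \<tau>)" "\<And>\<tau> x. \<tau> \<in> A x \<Longrightarrow> v \<tau> = x"
  shows "L = A Plus \<union> A Minus"
proof (intro equalityI subsetI)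
  fix \<tau> assume "\<tau> \<in> L"
  then have "\<tau> \<in> A (v \<tau>)" by (simp only: assms(1))
  then show "\<tau> \<in> A Plus \<union> A Minus" by (cases "v \<tau>") simp_all
next
  fix \<tau> assume "\<tau> \<in> A Plus \<union> A Minus"
  then obtain x where x: "\<tau> \<in> A x" by (elim UnE)
  have "\<tau> \<in> A (v \<tau>)" using x by (simp only: assms(2)[OF x])
  then show "\<tau> \<in> L" by (simp only: assms(1))
qed

text \<open>Multiplication after comultiplication sends 1 to 2x and x to 0: a minus block splits
  into the two orders of (+,-), both of which merge to plus, while a plus block splits into (+,+),
  which does not merge.\<close>

lemma even_paths_split_merge_same:
  assumes K: "partition_on X K" "finite K" and m: "merged K \<pi>"
  shows "even (card (paths_through \<pi> K \<pi> \<sigma> \<upsilon>))"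
proof -
  obtain p q where pq: "merges K \<pi> p q" using m by (auto simp: merged_def)
  then have mem: "p \<in> K" "q \<in> K" "p \<noteq> q" by (auto simp: merges_def)
  let ?Q = "\<lambda>x y. split_rule (\<sigma> (p \<union> q)) x y \<and> merge_rule x y (\<upsilon> (p \<union> q)) \<and> (\<forall>a\<in>K - {p, q}. \<sigma> a = \<upsilon> a)"
  let ?S = "\<lambda>x. {\<tau> \<in> K \<rightarrow>\<^sub>E UNIV. (\<forall>a\<in>K - {q}. \<tau> a = (\<sigma>(p := x)) a) \<and> ?Q x (\<tau> q)}"
  \<comment> \<open>The signs at \<open>p\<close> and \<open>q\<close> are both free, while
    \<open>card_extensions\<close> admits one free value; hence the division by the sign at
    \<open>p\<close>.\<close>
  have S: "paths_through \<pi> K \<pi> \<sigma> \<upsilon> = ?S Plus \<union> ?S Minus" (is "?L = ?R")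
  proof -
    define R where "R = K - {p, q}"
    have R: "K - {p, q} = R" "K - {q} = insert p R" "p \<notin> R" using mem by (auto simp: R_def)
    have *: "\<tau> \<in> ?L \<longleftrightarrow> \<tau> \<in> ?S (\<tau> p)" for \<tau>
    proof -
      define e\<^sub>1 e\<^sub>2 e\<^sub>3 e\<^sub>4 where e: "e\<^sub>1 = (\<forall>a\<in>R. \<sigma> a = \<tau> a)" "e\<^sub>2 = (\<forall>a\<in>R. \<tau> a = \<upsilon> a)"
        "e\<^sub>3 = (\<forall>a\<in>R. \<tau> a = \<sigma> a)" "e\<^sub>4 = (\<forall>a\<in>R. \<sigma> a = \<upsilon> a)"
      have e': "e\<^sub>1 \<and> e\<^sub>2 \<longleftrightarrow> e\<^sub>3 \<and> e\<^sub>4" unfolding e by (rule ball_eq_trans)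
      show ?thesis
        unfolding paths_through_def entry_split[OF K m] entry_merged[OF K m]
          split_entry_iff[OF K(1) pq] merge_entry_iff[OF K(1) pq] R ball_simps(7)
          ball_fun_upd[OF R(3)] mem_Collect_eq e[symmetric]
        using e' by auto
    qed
    have "\<tau> \<in> ?S x \<Longrightarrow> \<tau> p = x" for \<tau> x using mem by simp
    with * show ?thesis by (rule union_by_sign[where v = "\<lambda>\<tau>. \<tau> p" and A = ?S])
  qed
  have disj: "?S Plus \<inter> ?S Minus = {}"
  proof -
    have *: "\<tau> \<in> ?S x \<Longrightarrow> \<tau> p = x" for \<tau> x using mem by simp
    show ?thesis
    proof (rule equals0I)
      fix \<tau> assume "\<tau> \<in> ?S Plus \<inter> ?S Minus"
      then have "\<tau> \<in> ?S Plus" "\<tau> \<in> ?S Minus" by (rule IntD1, rule IntD2)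
      from *[OF this(1)] *[OF this(2)] show False by simp
    qed
  qed
  have fin: "finite (?S x)" for x
  proof -
    have "finite (UNIV :: sign set)"
      by (rule finite_subset[of _ "{Plus, Minus}"]) (use sign_exhaust in auto)
    then have "finite (K \<rightarrow>\<^sub>E (UNIV :: sign set))" using K by (intro finite_PiE) auto
    then show ?thesis by (rule rev_finite_subset) auto
  qed
  have "card ?L = card (?S Plus) + card (?S Minus)"
    unfolding S by (rule card_Un_disjoint[OF fin fin disj])
  also have "\<dots> = card {y. ?Q Plus y} + card {y. ?Q Minus y}"
    by (rule arg_cong2[of _ _ _ _ "(+)"];
      rule card_extensions[OF mem(2), where f = "\<sigma>(p := _)" and Q = "?Q _"])
  also have "even \<dots>"
    unfolding sign_sets[of "?Q _"]
    by (cases "\<sigma> (p \<union> q)"; cases "\<upsilon> (p \<union> q)"; cases "\<forall>a\<in>K - {p, q}. \<sigma> a = \<upsilon> a")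
      (simp_all add: split_rule_def merge_rule_def)
  finally show ?thesis .
qed

text \<open>If the merged pairs share a block, the composites are the two sides of (id tensor
  m)(Delta tensor id) = Delta m; if the pairs are disjoint, the split and the merge act on different
  blocks and commute.\<close>

lemma card_paths_frobenius:
  assumes K: "partition_on X K" "finite K" and m: "merged K \<pi>" "merged K \<pi>'" "\<pi> \<noteq> \<pi>'"
    and J: "merged \<pi> J" "merged \<pi>' J"
  shows "card (paths_through \<pi> K \<pi>' \<sigma> \<upsilon>) = card (paths_through \<pi> J \<pi>' \<sigma> \<upsilon>)"
proof -
  have \<pi>: "partition_on X \<pi>" "finite \<pi>"
    by (rule merged_partition[OF K(1) m(1)], rule merged_finite[OF m(1) K(2)])
  have \<pi>': "partition_on X \<pi>'" "finite \<pi>'"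
    by (rule merged_partition[OF K(1) m(2)], rule merged_finite[OF m(2) K(2)])
  note Juniq = merged_coarsening_unique[OF \<pi> \<pi>'(1) m(3) J]
  have SM: "paths_through \<pi> K \<pi>' \<sigma> \<upsilon> =
      {\<tau> \<in> K \<rightarrow>\<^sub>E UNIV. split_entry \<pi> K \<sigma> \<tau> \<and> merge_entry K \<pi>' \<tau> \<upsilon>}"
    unfolding paths_through_def entry_split[OF K m(1)] entry_merged[OF K m(2)] ..
  have MS: "paths_through \<pi> J \<pi>' \<sigma> \<upsilon> =
      {\<tau> \<in> J \<rightarrow>\<^sub>E UNIV. merge_entry \<pi> J \<sigma> \<tau> \<and> split_entry J \<pi>' \<tau> \<upsilon>}"
    unfolding paths_through_def entry_merged[OF \<pi> J(1)] entry_split[OF \<pi>' J(2)] ..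
  obtain p q where pq: "merges K \<pi> p q" using m by (auto simp: merged_def)
  obtain p' q' where pq': "merges K \<pi>' p' q'" using m by (auto simp: merged_def)
  have mem: "p \<in> K" "q \<in> K" "p \<noteq> q" "p' \<in> K" "q' \<in> K" "p' \<noteq> q'"
    using pq pq' by (auto simp: merges_def)
  have \<pi>_eq: "\<pi> = insert (p \<union> q) (K - {p, q})" and \<pi>'_eq: "\<pi>' = insert (p' \<union> q') (K - {p', q'})"
    using pq pq' by (auto simp: merges_def)
  have ne: "{p, q} \<noteq> {p', q'}"
  proof
    assume "{p, q} = {p', q'}"
    moreover from this have "p \<union> q = p' \<union> q'" by (auto simp: doubleton_eq_iff)
    ultimately show False using m(3) by (simp add: \<pi>_eq \<pi>'_eq)
  qed
  have notin: "a \<union> b \<notin> K" if "a \<in> K" "b \<in> K" "a \<noteq> b" for a b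
    using merges_union_notin[OF K(1), of _ a b] that by (auto simp: merges_def)
  \<comment> \<open>The shared block is called \<open>q\<close>; by the symmetry of
    \<open>merges\<close> every coincidence between the two pairs reduces to this one.\<close>
  have overlap: ?thesis
    if "merges K \<pi> p q" "merges K \<pi>' q r" "r \<noteq> p" for p q r
  proof -
    have mem: "p \<in> K" "q \<in> K" "r \<in> K" "p \<noteq> q" "q \<noteq> r" "p \<noteq> r"
      using that by (auto simp: merges_def)
    have \<pi>_eq: "\<pi> = insert (p \<union> q) (K - {p, q})" and \<pi>'_eq: "\<pi>' = insert (q \<union> r) (K - {q, r})"
      using that by (auto simp: merges_def)
    have nin: "p \<union> q \<notin> K" "q \<union> r \<notin> K" using notin mem by auto
    define j where "j = p \<union> q \<union> r"
    define R where "R = K - {p, q, r}"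
    have R: "\<pi> - {p \<union> q, r} = R" "\<pi>' - {p, q \<union> r} = R"
      using nin mem by (auto simp: R_def \<pi>_eq \<pi>'_eq)
    have e: "p \<union> q \<noteq> r" "p \<noteq> q \<union> r" using nin mem by auto
    have J1: "merges \<pi> (insert j R) (p \<union> q) r"
      using mem e R(1) by (auto simp: merges_def j_def \<pi>_eq)
    have J2: "merges \<pi>' (insert j R) p (q \<union> r)"
      using mem e R(2) by (auto simp: merges_def j_def \<pi>'_eq Un_assoc)
    \<comment> \<open>\<open>J\<close> is given only abstractly; uniqueness of the join identifies
      it with the explicit one.\<close>
    have JR: "J = insert j R" using Juniq J1 J2 by (auto simp: merged_def)
    have jR: "j \<notin> R"
      using merges_union_notin[OF \<pi>(1) J1] by (auto simp: R_def j_def \<pi>_eq)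
    let ?E = "\<forall>a\<in>R. \<sigma> a = \<upsilon> a"
    let ?x = "\<lambda>x. ?E \<and> split_rule (\<sigma> (p \<union> q)) (\<upsilon> p) x \<and> merge_rule x (\<sigma> r) (\<upsilon> (q \<union> r))"
    let ?y = "\<lambda>y. ?E \<and> merge_rule (\<sigma> (p \<union> q)) (\<sigma> r) y \<and> split_rule y (\<upsilon> p) (\<upsilon> (q \<union> r))"
    have KK: "K - {p, q} = insert r R" "K - {q, r} = insert p R" "K - {q} = insert p (insert r R)"
      using mem by (auto simp: R_def)
    have RR: "p \<notin> R" "q \<notin> R" "r \<notin> R" by (auto simp: R_def)
    \<comment> \<open>On the way through \<open>K\<close> the sign at \<open>p\<close> is already
      the final one and the signs outside \<open>p\<close>, \<open>q\<close> are still the initial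
      ones, so only the sign at \<open>q\<close> is free.\<close>
    have "paths_through \<pi> K \<pi>' \<sigma> \<upsilon> =
      {\<tau> \<in> K \<rightarrow>\<^sub>E UNIV. (\<forall>a\<in>K - {q}. \<tau> a = (\<sigma>(p := \<upsilon> p)) a) \<and> ?x (\<tau> q)}"
      unfolding SM split_entry_iff[OF K(1) that(1)] merge_entry_iff[OF K(1) that(2)] KK
    proof (rule Collect_cong, rule conj_cong[OF refl])
      fix \<tau>
      define e\<^sub>1 e\<^sub>2 e\<^sub>3 e\<^sub>4 where e: "e\<^sub>1 = (\<forall>a\<in>R. \<sigma> a = \<tau> a)" "e\<^sub>2 = (\<forall>a\<in>R. \<tau> a = \<upsilon> a)"
        "e\<^sub>3 = (\<forall>a\<in>R. \<tau> a = \<sigma> a)" "e\<^sub>4 = (\<forall>a\<in>R. \<sigma> a = \<upsilon> a)"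
      have e': "e\<^sub>1 \<and> e\<^sub>2 \<longleftrightarrow> e\<^sub>3 \<and> e\<^sub>4" unfolding e by (rule ball_eq_trans)
      show "((\<forall>a\<in>insert r R. \<sigma> a = \<tau> a) \<and> split_rule (\<sigma> (p \<union> q)) (\<tau> p) (\<tau> q)) \<and>
          (\<forall>a\<in>insert p R. \<tau> a = \<upsilon> a) \<and> merge_rule (\<tau> q) (\<tau> r) (\<upsilon> (q \<union> r)) \<longleftrightarrow>
        (\<forall>a\<in>insert p (insert r R). \<tau> a = (\<sigma>(p := \<upsilon> p)) a) \<and> ?x (\<tau> q)"
        unfolding ball_simps(7) ball_fun_upd[OF RR(1)] e[symmetric]
        using e' mem by auto
    qed
    then have L: "card (paths_through \<pi> K \<pi>' \<sigma> \<upsilon>) = card {x. ?x x}"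
      using card_extensions[OF mem(2), where f = "\<sigma>(p := \<upsilon> p)" and Q = ?x] by (simp only:)
    have "paths_through \<pi> J \<pi>' \<sigma> \<upsilon> =
      {\<tau> \<in> J \<rightarrow>\<^sub>E UNIV. (\<forall>a\<in>J - {j}. \<tau> a = \<sigma> a) \<and> ?y (\<tau> j)}"
      unfolding MS merge_entry_iff[OF \<pi>(1) J1[folded JR]] split_entry_iff[OF \<pi>'(1) J2[folded JR]] R
    proof (rule Collect_cong, rule conj_cong[OF refl])
      fix \<tau>
      have J': "J - {j} = R" "p \<union> q \<union> r = j" "p \<union> (q \<union> r) = j"
        using jR by (auto simp: JR j_def)
      define e\<^sub>1 e\<^sub>2 e\<^sub>3 e\<^sub>4 where e: "e\<^sub>1 = (\<forall>a\<in>R. \<sigma> a = \<tau> a)" "e\<^sub>2 = (\<forall>a\<in>R. \<tau> a = \<upsilon> a)"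
        "e\<^sub>3 = (\<forall>a\<in>R. \<tau> a = \<sigma> a)" "e\<^sub>4 = (\<forall>a\<in>R. \<sigma> a = \<upsilon> a)"
      have e': "e\<^sub>1 \<and> e\<^sub>2 \<longleftrightarrow> e\<^sub>3 \<and> e\<^sub>4" unfolding e by (rule ball_eq_trans)
      show "((\<forall>a\<in>R. \<sigma> a = \<tau> a) \<and> merge_rule (\<sigma> (p \<union> q)) (\<sigma> r) (\<tau> (p \<union> q \<union> r))) \<and>
          (\<forall>a\<in>R. \<tau> a = \<upsilon> a) \<and> split_rule (\<tau> (p \<union> (q \<union> r))) (\<upsilon> p) (\<upsilon> (q \<union> r)) \<longleftrightarrow>
        (\<forall>a\<in>J - {j}. \<tau> a = \<sigma> a) \<and> ?y (\<tau> j)"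
        unfolding J' e[symmetric] using e' by auto
    qed
    then have "card (paths_through \<pi> J \<pi>' \<sigma> \<upsilon>) = card {x. ?y x}"
      using card_extensions[of j J, where f = \<sigma> and Q = ?y] JR by simp
    also have "\<dots> = card {x. ?x x}"
      unfolding sign_sets[of "?x"] sign_sets[of "?y"]
      by (cases "\<sigma> (p \<union> q)"; cases "\<upsilon> (q \<union> r)"; cases "\<sigma> r"; cases "\<upsilon> p"; cases ?E)
        (simp_all add: split_rule_def merge_rule_def)
    finally show ?thesis using L by simp
  qed
  show ?thesis
  proof (cases "{p, q} \<inter> {p', q'} = {}")
    case False
    consider "p = p'" | "p = q'" | "q = p'" | "q = q'" using False by auto
    then show ?thesis
    proof cases
      case 1 then show ?thesis using overlap[of q p q'] merges_sym[OF pq] pq' ne by auto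
    next
      case 2 then show ?thesis using overlap[of q p p'] merges_sym[OF pq] merges_sym[OF pq'] ne by auto
    next
      case 3 then show ?thesis using overlap[of p q q'] pq pq' ne by auto
    next
      case 4 then show ?thesis using overlap[of p q p'] pq merges_sym[OF pq'] ne by auto
    qed
  next
    case True
    then have ds: "p \<noteq> p'" "p \<noteq> q'" "q \<noteq> p'" "q \<noteq> q'" by auto
    define j where "j = p \<union> q"
    define j' where "j' = p' \<union> q'"
    define R where "R = K - {p, q, p', q'}"
    have nin: "j \<notin> K" "j' \<notin> K" using notin mem by (auto simp: j_def j'_def)
    have R: "\<pi> - {p', q'} = insert j R" "\<pi>' - {p, q} = insert j' R"
      using nin mem ds by (auto simp: R_def \<pi>_eq \<pi>'_eq j_def j'_def)
    have J1: "merges \<pi> (insert j' (insert j R)) p' q'"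
      using mem ds R(1) by (auto simp: merges_def j'_def \<pi>_eq)
    have J2: "merges \<pi>' (insert j' (insert j R)) p q"
      unfolding merges_def R(2) using mem ds by (auto simp: j_def \<pi>'_eq)
    have JR: "J = insert j' (insert j R)" using Juniq J1 J2 by (auto simp: merged_def)
    have jR: "j \<notin> R" "j' \<notin> R" using nin by (auto simp: R_def)
    have "j \<noteq> j'"
      using merges_union_notin[OF \<pi>(1) J1] by (auto simp: j_def j'_def \<pi>_eq)
    note jR = jR this
    let ?E = "\<forall>a\<in>R. \<sigma> a = \<upsilon> a"
    \<comment> \<open>The same condition arises on both sides: the split of \<open>j\<close> and the
      merge of \<open>p'\<close>, \<open>q'\<close> involve separate blocks, and every intermediate
      sign is forced by \<sigma> or \<upsilon>.\<close>
    let ?C = "?E \<and> split_rule (\<sigma> j) (\<upsilon> p) (\<upsilon> q) \<and> merge_rule (\<sigma> p') (\<sigma> q') (\<upsilon> j')"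
    have KK: "K - {p, q} = insert p' (insert q' R)" "K - {p', q'} = insert p (insert q R)"
       "K - {q} = insert p (insert p' (insert q' R))"
      using mem ds by (auto simp: R_def)
    have RR: "p \<notin> R" "q \<notin> R" "p' \<notin> R" "q' \<notin> R" by (auto simp: R_def)
    have "paths_through \<pi> K \<pi>' \<sigma> \<upsilon> =
      {\<tau> \<in> K \<rightarrow>\<^sub>E UNIV. (\<forall>a\<in>K - {q}. \<tau> a = (\<sigma>(p := \<upsilon> p)) a) \<and> (?C \<and> \<tau> q = \<upsilon> q)}"
      unfolding SM split_entry_iff[OF K(1) pq] merge_entry_iff[OF K(1) pq'] KK
    proof (rule Collect_cong, rule conj_cong[OF refl])
      fix \<tau>
      define e\<^sub>1 e\<^sub>2 e\<^sub>3 e\<^sub>4 where e: "e\<^sub>1 = (\<forall>a\<in>R. \<sigma> a = \<tau> a)" "e\<^sub>2 = (\<forall>a\<in>R. \<tau> a = \<upsilon> a)"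
        "e\<^sub>3 = (\<forall>a\<in>R. \<tau> a = \<sigma> a)" "e\<^sub>4 = (\<forall>a\<in>R. \<sigma> a = \<upsilon> a)"
      have e': "e\<^sub>1 \<and> e\<^sub>2 \<longleftrightarrow> e\<^sub>3 \<and> e\<^sub>4" unfolding e by (rule ball_eq_trans)
      show "((\<forall>a\<in>insert p' (insert q' R). \<sigma> a = \<tau> a) \<and> split_rule (\<sigma> (p \<union> q)) (\<tau> p) (\<tau> q)) \<and>
          (\<forall>a\<in>insert p (insert q R). \<tau> a = \<upsilon> a) \<and> merge_rule (\<tau> p') (\<tau> q') (\<upsilon> (p' \<union> q')) \<longleftrightarrow>
        (\<forall>a\<in>insert p (insert p' (insert q' R)). \<tau> a = (\<sigma>(p := \<upsilon> p)) a) \<and> (?C \<and> \<tau> q = \<upsilon> q)"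
        unfolding ball_simps(7) ball_fun_upd[OF RR(1)] e[symmetric] j_def[symmetric] j'_def[symmetric]
        using e' ds by auto
    qed
    then have L: "card (paths_through \<pi> K \<pi>' \<sigma> \<upsilon>) = card {x. ?C \<and> x = \<upsilon> q}"
      using card_extensions[OF mem(2), where f = "\<sigma>(p := \<upsilon> p)" and Q = "\<lambda>x. ?C \<and> x = \<upsilon> q"] by (simp only:)
    have "paths_through \<pi> J \<pi>' \<sigma> \<upsilon> =
      {\<tau> \<in> J \<rightarrow>\<^sub>E UNIV. (\<forall>a\<in>J - {j'}. \<tau> a = \<sigma> a) \<and> (?C \<and> \<tau> j' = \<upsilon> j')}"
      unfolding MS merge_entry_iff[OF \<pi>(1) J1[folded JR]] split_entry_iff[OF \<pi>'(1) J2[folded JR]] R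
    proof (rule Collect_cong, rule conj_cong[OF refl])
      fix \<tau>
      have J': "J - {j'} = insert j R" using jR by (auto simp: JR)
      define e\<^sub>1 e\<^sub>2 e\<^sub>3 e\<^sub>4 where e: "e\<^sub>1 = (\<forall>a\<in>R. \<sigma> a = \<tau> a)" "e\<^sub>2 = (\<forall>a\<in>R. \<tau> a = \<upsilon> a)"
        "e\<^sub>3 = (\<forall>a\<in>R. \<tau> a = \<sigma> a)" "e\<^sub>4 = (\<forall>a\<in>R. \<sigma> a = \<upsilon> a)"
      have e': "e\<^sub>1 \<and> e\<^sub>2 \<longleftrightarrow> e\<^sub>3 \<and> e\<^sub>4" unfolding e by (rule ball_eq_trans)
      show "((\<forall>a\<in>insert j R. \<sigma> a = \<tau> a) \<and> merge_rule (\<sigma> p') (\<sigma> q') (\<tau> (p' \<union> q'))) \<and>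
          (\<forall>a\<in>insert j' R. \<tau> a = \<upsilon> a) \<and> split_rule (\<tau> (p \<union> q)) (\<upsilon> p) (\<upsilon> q) \<longleftrightarrow>
        (\<forall>a\<in>J - {j'}. \<tau> a = \<sigma> a) \<and> (?C \<and> \<tau> j' = \<upsilon> j')"
        unfolding J' ball_simps(7) e[symmetric] j_def[symmetric] j'_def[symmetric] using e' by auto
    qed
    then have "card (paths_through \<pi> J \<pi>' \<sigma> \<upsilon>) = card {x. ?C \<and> x = \<upsilon> j'}"
      using card_extensions[of j' J, where f = \<sigma> and Q = "\<lambda>x. ?C \<and> x = \<upsilon> j'"] JR by simp
    then show ?thesis using L by (cases ?C) simp_all
  qed
qed

text \<open>Here \<open>a\<close>, \<open>b\<close> stand for the block numbers of first and last
  partition, \<open>e\<close> for the equality of these partitions, and \<open>x\<close>,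
  \<open>y\<close> for the counts of two merges and of two splits. The difference of
  \<open>a\<close> and \<open>b\<close> forces both path counts \<open>n\<close>, \<open>n'\<close>
  into the same alternative; \<open>m\<close>, \<open>m'\<close> say that the middle is a common
  coarsening or refinement.\<close>

lemma even_add_cases:
  fixes n n' a b x y :: nat
  assumes 1: "(a = b + 2 \<and> n = x) \<or> (b = a + 2 \<and> n = y) \<or> (a = b \<and> \<not> e \<and> m) \<or> (e \<and> even n) \<or>
        ((a = Suc b \<or> b = Suc a) \<and> n = 0)"
   and 2:   "(a = b + 2 \<and> n' = x) \<or> (b = a + 2 \<and> n' = y) \<or> (a = b \<and> \<not> e \<and> m') \<or> (e \<and> even n') \<or>
        ((a = Suc b \<or> b = Suc a) \<and> n' = 0)"
   and 3:   "e \<Longrightarrow> a = b" and 4: "\<not> e \<Longrightarrow> m \<Longrightarrow> m' \<Longrightarrow> n = n'"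
  shows "even (n + n')"
proof (cases e)
  case True
  then have ab: "a = b" by (rule 3)
  have "even n" using 1 True unfolding ab by simp
  moreover have "even n'" using 2 True unfolding ab by simp
  ultimately show ?thesis by simp
next
  case False
  have "m \<and> m' \<longrightarrow> n = n'" using 4 False by blast
  then have "n = n'" using 1 2 False by arith
  then show ?thesis by simp
qed

text \<open>Equality is included for a change of marker that leaves the partition as it is.\<close>

definition adjacent :: "'x set set \<Rightarrow> 'x set set \<Rightarrow> bool" where
  "adjacent \<pi> \<rho> \<longleftrightarrow> \<pi> = \<rho> \<or> merged \<pi> \<rho> \<or> merged \<rho> \<pi>"

lemma even_paths_square:
  assumes fin: "finite X"
    and part: "partition_on X \<pi>" "partition_on X \<rho>\<^sub>1" "partition_on X \<rho>\<^sub>2" "partition_on X \<pi>'"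
    and adj: "adjacent \<pi> \<rho>\<^sub>1" "adjacent \<rho>\<^sub>1 \<pi>'" "adjacent \<pi> \<rho>\<^sub>2" "adjacent \<rho>\<^sub>2 \<pi>'"
    and ms: "merged \<pi> \<rho>\<^sub>1 \<Longrightarrow> merged \<pi>' \<rho>\<^sub>1 \<Longrightarrow> \<pi> \<noteq> \<pi>'" "merged \<pi> \<rho>\<^sub>2 \<Longrightarrow> merged \<pi>' \<rho>\<^sub>2 \<Longrightarrow> \<pi> \<noteq> \<pi>'"
  shows "even (card (paths_through \<pi> \<rho>\<^sub>1 \<pi>' \<sigma> \<upsilon>) + card (paths_through \<pi> \<rho>\<^sub>2 \<pi>' \<sigma> \<upsilon>))"
proof -
  have fins: "finite \<pi>" "finite \<rho>\<^sub>1" "finite \<rho>\<^sub>2" "finite \<pi>'"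
    using part fin finite_elements by auto
  define P where "P \<rho> \<longleftrightarrow> partition_on X \<rho> \<and> finite \<rho> \<and> adjacent \<pi> \<rho> \<and> adjacent \<rho> \<pi>' \<and>
    (merged \<pi> \<rho> \<longrightarrow> merged \<pi>' \<rho> \<longrightarrow> \<pi> \<noteq> \<pi>')" for \<rho>
  let ?N = "\<lambda>\<rho>. card (paths_through \<pi> \<rho> \<pi>' \<sigma> \<upsilon>)"
  have zero: "?N \<rho> = 0" if "P \<rho>" "\<pi> = \<rho> \<or> \<rho> = \<pi>'" for \<rho>
    using that entry_same unfolding P_def paths_through_def by fastforce
  have c: "card \<pi> = Suc (card \<rho>)" if "P \<rho>" "merged \<pi> \<rho>" for \<rho>
    using card_merged[OF part(1) fins(1)] that by auto
  have c': "card \<rho> = Suc (card \<pi>)" if "P \<rho>" "merged \<rho> \<pi>" for \<rho>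
    using card_merged that by (auto simp: P_def)
  have d: "card \<rho> = Suc (card \<pi>')" if "P \<rho>" "merged \<rho> \<pi>'" for \<rho>
    using card_merged that by (auto simp: P_def)
  have d': "card \<pi>' = Suc (card \<rho>)" if "P \<rho>" "merged \<pi>' \<rho>" for \<rho>
    using card_merged[OF part(4) fins(4)] that by auto
  \<comment> \<open>The alternatives are sorted by the difference of the block numbers: 2, -2, 0
    with distinct or equal ends, and 1 or -1. In the last case one of the two steps keeps the
    partition, so no path survives.\<close>
  have cases: "(card \<pi> = card \<pi>' + 2 \<and> ?N \<rho> = of_bool (count_entry Plus \<pi> \<pi>' \<sigma> \<upsilon>)) \<or>
      (card \<pi>' = card \<pi> + 2 \<and> ?N \<rho> = of_bool (count_entry Minus \<pi>' \<pi> \<upsilon> \<sigma>)) \<or>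
      (card \<pi> = card \<pi>' \<and> \<pi> \<noteq> \<pi>' \<and> (merged \<pi> \<rho> \<and> merged \<pi>' \<rho> \<or> merged \<rho> \<pi> \<and> merged \<rho> \<pi>')) \<or>
      (\<pi> = \<pi>' \<and> even (?N \<rho>)) \<or>
      ((card \<pi> = Suc (card \<pi>') \<or> card \<pi>' = Suc (card \<pi>)) \<and> ?N \<rho> = 0)" if \<rho>: "P \<rho>" for \<rho>
  proof -
    have part\<rho>: "partition_on X \<rho>" "finite \<rho>" 
      and adj\<rho>: "\<pi> = \<rho> \<or> merged \<pi> \<rho> \<or> merged \<rho> \<pi>" "\<rho> = \<pi>' \<or> merged \<rho> \<pi>' \<or> merged \<pi>' \<rho>"
      and ms\<rho>: "merged \<pi> \<rho> \<longrightarrow> merged \<pi>' \<rho> \<longrightarrow> \<pi> \<noteq> \<pi>'"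
      using \<rho> unfolding P_def adjacent_def by blast+
    consider (a) "\<pi> = \<rho>" | (b) "merged \<pi> \<rho>" | (c) "merged \<rho> \<pi>"
      using adj\<rho> by blast
    then show ?thesis
    proof cases
      case a
      have "?N \<rho> = 0" using zero[OF \<rho>] a by blast
      moreover have "\<rho> = \<pi>' \<or> card \<rho> = Suc (card \<pi>') \<or> card \<pi>' = Suc (card \<rho>)"
        using adj\<rho>(2) d[OF \<rho>] d'[OF \<rho>] by blast
      ultimately show ?thesis using a by (elim disjE) simp_all
    next
      case b
      consider (x) "\<rho> = \<pi>'" | (y) "merged \<rho> \<pi>'" | (z) "merged \<pi>' \<rho>"
        using adj\<rho> by blast
      then show ?thesis
      proof cases
        case x
        have "?N \<rho> = 0" by (rule zero[OF \<rho> disjI2[OF x]])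
        then show ?thesis using x c[OF \<rho> b] by simp
      next
        case y then show ?thesis
          using card_paths_merge_merge[OF part(1) fins(1) b y] c[OF \<rho> b] d[OF \<rho> y] by simp
      next
        case z then show ?thesis using b c[OF \<rho> b] d'[OF \<rho> z] ms\<rho> by simp
      qed
    next
      case c
      consider (x) "\<rho> = \<pi>'" | (y) "merged \<rho> \<pi>'" | (z) "merged \<pi>' \<rho>"
        using adj\<rho> by blast
      then show ?thesis
      proof cases
        case x
        have "?N \<rho> = 0" by (rule zero[OF \<rho> disjI2[OF x]])
        then show ?thesis using x c'[OF \<rho> c] by simp
      next
        case y
        show ?thesis
        proof (cases "\<pi> = \<pi>'")
          case True then show ?thesis using even_paths_split_merge_same[OF part\<rho> c] by simp
        next
          case False then show ?thesis using c y c'[OF \<rho> c] d[OF \<rho> y] by simp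
        qed
      next
        case z then show ?thesis
          using card_paths_split_split[OF part(4) fins(4) z c] c'[OF \<rho> c] d'[OF \<rho> z] by simp
      qed
    qed
  qed
  have eq: "?N \<rho>\<^sub>1 = ?N \<rho>\<^sub>2" if "\<pi> \<noteq> \<pi>'"
    "merged \<pi> \<rho>\<^sub>1 \<and> merged \<pi>' \<rho>\<^sub>1 \<or> merged \<rho>\<^sub>1 \<pi> \<and> merged \<rho>\<^sub>1 \<pi>'"
    "merged \<pi> \<rho>\<^sub>2 \<and> merged \<pi>' \<rho>\<^sub>2 \<or> merged \<rho>\<^sub>2 \<pi> \<and> merged \<rho>\<^sub>2 \<pi>'"
  proof -
    note frob\<^sub>1 = card_paths_frobenius[OF part(2) fins(2) _ _ that(1)]
    note frob\<^sub>2 = card_paths_frobenius[OF part(3) fins(3) _ _ that(1)]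
    note coarse = merged_coarsening_unique[OF part(1) fins(1) part(4) that(1)]
    note fine = merged_refinement_unique[OF part(1,4) fins(4) that(1) part(2,3)]
    from that(2) show ?thesis
    proof (elim disjE conjE)
      assume 1: "merged \<pi> \<rho>\<^sub>1" "merged \<pi>' \<rho>\<^sub>1"
      from that(3) show ?thesis
      proof (elim disjE conjE)
        assume 2: "merged \<pi> \<rho>\<^sub>2" "merged \<pi>' \<rho>\<^sub>2"
        show ?thesis by (simp only: coarse[OF 1 2])
      next
        assume 2: "merged \<rho>\<^sub>2 \<pi>" "merged \<rho>\<^sub>2 \<pi>'"
        show ?thesis by (rule frob\<^sub>2[OF 2 1, symmetric])
      qed
    next
      assume 1: "merged \<rho>\<^sub>1 \<pi>" "merged \<rho>\<^sub>1 \<pi>'"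
      from that(3) show ?thesis
      proof (elim disjE conjE)
        assume 2: "merged \<pi> \<rho>\<^sub>2" "merged \<pi>' \<rho>\<^sub>2"
        show ?thesis by (rule frob\<^sub>1[OF 1 2])
      next
        assume 2: "merged \<rho>\<^sub>2 \<pi>" "merged \<rho>\<^sub>2 \<pi>'"
        show ?thesis by (simp only: fine[OF 1 2])
      qed
    qed
  qed
  have P: "P \<rho>\<^sub>1" "P \<rho>\<^sub>2" using part fins adj ms unfolding P_def by blast+
  show ?thesis
    by (rule even_add_cases[OF cases[OF P(1)] cases[OF P(2)] arg_cong[where f = card] eq])
qed

section \<open>Cyclic words of gaps and letters\<close>

definition is_gap :: "'a token \<Rightarrow> bool" where
  "is_gap t \<longleftrightarrow> (\<exists>g. t = Gap g)"

lemma is_gap_simps [simp]: "is_gap (Gap g)" "\<not> is_gap (Letter A)" "\<not> is_gap (Reminder A)"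
  by (auto simp: is_gap_def)

text \<open>Such a list begins and ends with a gap: it is what remains of a cyclic word cut open at
  a letter or reminder, and also any arc between two such tokens. The class is closed under
  reversal, under joining two arcs by a token and under cutting at one.\<close>

inductive alternating :: "'a token list \<Rightarrow> bool" where
  single: "alternating [Gap g]"
| step: "alternating x \<Longrightarrow> \<not> is_gap t \<Longrightarrow> alternating (Gap g # t # x)"

lemma alternating_appendI:
  "alternating x \<Longrightarrow> alternating y \<Longrightarrow> \<not> is_gap t \<Longrightarrow> alternating (x @ t # y)"
  by (induction rule: alternating.induct) (auto intro: alternating.intros)

lemma alternating_appendD:
  assumes "alternating (x @ t # y)" "\<not> is_gap t"
  shows "alternating x \<and> alternating y"
  using assms
proof (induction "x @ t # y" arbitrary: x rule: alternating.induct)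
  case (single g)
  then show ?case by (cases x) auto
next
  case (step z t' g)
  obtain x' where x: "x = Gap g # x'" using step.hyps(4) step.prems by (cases x) auto
  show ?case
  proof (cases x')
    case Nil
    then show ?thesis using x step.hyps by (auto intro: alternating.intros)
  next
    case (Cons t'' x'')
    then have "t'' = t'" "z = x'' @ t # y" using x step.hyps(4) by auto
    then show ?thesis using step.hyps(2)[of x''] step x Cons by (auto intro: alternating.intros)
  qed
qed

lemma alternating_append_iff:
  "\<not> is_gap t \<Longrightarrow> alternating (x @ t # y) \<longleftrightarrow> alternating x \<and> alternating y"
  using alternating_appendI alternating_appendD by blast

lemma alternating_rev: "alternating x \<Longrightarrow> alternating (rev x)"
proof (induction rule: alternating.induct)
  case (step x t g)
  then have "alternating (rev x @ t # [Gap g])" by (intro alternating_appendI alternating.intros)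
  then show ?case by simp
qed (auto intro: alternating.intros)

lemma alternating_hd:
  assumes "alternating x" obtains h x' where "x = Gap h # x'"
  using assms by (cases rule: alternating.cases) auto

lemma alternating_last:
  assumes "alternating x" obtains g x' where "x = x' @ [Gap g]"
proof -
  obtain g x' where "rev x = Gap g # x'" using alternating_hd[OF alternating_rev[OF assms]] .
  then have "x = rev x' @ [Gap g]" by (simp add: rev_eq_Cons_iff)
  then show thesis using that by blast
qed

definition rotations :: "'b list \<Rightarrow> 'b list set" where
  "rotations w = {v @ u |u v. w = u @ v}"

lemma rotations_rotate1: "rotations (t # w) = rotations (w @ [t])"
proof (rule equalityI; rule subsetI)
  fix z assume "z \<in> rotations (t # w)"
  then obtain u v where uv: "t # w = u @ v" "z = v @ u" by (auto simp: rotations_def)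
  show "z \<in> rotations (w @ [t])"
  proof (cases u)
    case Nil
    then have "w @ [t] = w @ [t]" "z = [t] @ w" using uv by auto
    then show ?thesis unfolding rotations_def by blast
  next
    case (Cons t' u')
    then have "w @ [t] = u' @ (v @ [t])" "z = (v @ [t]) @ u'" using uv by auto
    then show ?thesis unfolding rotations_def by blast
  qed
next
  fix z assume "z \<in> rotations (w @ [t])"
  then obtain u v where uv: "w @ [t] = u @ v" "z = v @ u" by (auto simp: rotations_def)
  show "z \<in> rotations (t # w)"
  proof (cases v rule: rev_cases)
    case Nil
    then have "t # w = [t] @ w" "z = w @ [t]" using uv by auto
    then show ?thesis unfolding rotations_def by blast
  next
    case (snoc v' t')
    then have "t # w = (t # u) @ v'" "z = v' @ (t # u)" using uv by auto
    then show ?thesis unfolding rotations_def by blast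
  qed
qed

lemma rotations_append: "rotations (u @ v) = rotations (v @ u)"
proof (induction u arbitrary: v)
  case (Cons t u)
  have "rotations ((t # u) @ v) = rotations (u @ (v @ [t]))" using rotations_rotate1[of t "u @ v"] by simp
  also have "\<dots> = rotations ((v @ [t]) @ u)" by (rule Cons.IH)
  finally show ?case by simp
qed simp

lemma rotations_eq: "z \<in> rotations w \<Longrightarrow> rotations z = rotations w"
proof -
  assume "z \<in> rotations w"
  then obtain u v where "w = u @ v" "z = v @ u" by (auto simp: rotations_def)
  then show ?thesis by (simp only: rotations_append[of v u])
qed

lemma rotations_refl: "w \<in> rotations w"
  by (auto simp: rotations_def intro: exI[of _ "[]"])

lemma mset_rotations: "z \<in> rotations w \<Longrightarrow> mset z = mset w"
  by (auto simp: rotations_def)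

text \<open>The first alternative is the word of an empty component, which has no token to cut
  at.\<close>

definition cyclic_alternating :: "'a token list \<Rightarrow> bool" where
  "cyclic_alternating w \<longleftrightarrow>
     (\<exists>z\<in>rotations w. (\<exists>g. z = [Gap g]) \<or> (\<exists>t x. z = t # x \<and> \<not> is_gap t \<and> alternating x))"

lemma cyclic_alternating_rotations:
  "z \<in> rotations w \<Longrightarrow> cyclic_alternating z = cyclic_alternating w"
  by (simp only: cyclic_alternating_def rotations_eq)

text \<open>The place of the cut does not matter: cutting at another token \<open>t'\<close> turns
  \<open>u' @ t' # v'\<close> into \<open>v' @ t # u'\<close>, and both alternate exactly if
  \<open>u'\<close> and \<open>v'\<close> do.\<close>

lemma cyclic_alternating_Cons:
  assumes "\<not> is_gap t"
  shows "cyclic_alternating (t # x) \<longleftrightarrow> alternating x"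
proof
  assume "alternating x"
  then show "cyclic_alternating (t # x)"
    using assms rotations_refl[of "t # x"] unfolding cyclic_alternating_def by blast
next
  assume "cyclic_alternating (t # x)"
  then obtain z where z: "z \<in> rotations (t # x)"
    "(\<exists>g. z = [Gap g]) \<or> (\<exists>t x. z = t # x \<and> \<not> is_gap t \<and> alternating x)"
    by (auto simp: cyclic_alternating_def)
  obtain u v where uv: "t # x = u @ v" "z = v @ u" using z by (auto simp: rotations_def)
  show "alternating x"
  proof (cases "u = [] \<or> v = []")
    case True
    then have "z = t # x" using uv by auto
    then show ?thesis using z assms by auto
  next
    case False
    then obtain u' t' v' where u: "u = t # u'" and v: "v = t' # v'"
      using uv by (cases u; cases v) auto
    then have "z = t' # v' @ t # u'" "x = u' @ t' # v'" using uv by auto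
    then show ?thesis using z assms by (auto simp: alternating_append_iff)
  qed
qed

text \<open>Collects the gaps before and after the occurrences of \<open>t\<close>. Some rotation
  brings each occurrence to the front, where these gaps are the two ends of the rest.\<close>

definition neighbours :: "'a token list \<Rightarrow> 'a token \<Rightarrow> (gap \<times> gap) set" where
  "neighbours w t = {(g, h). \<exists>x. t # x \<in> rotations w \<and> x \<noteq> [] \<and> hd x = Gap h \<and> last x = Gap g}"

definition inner_neighbours :: "'a token list \<Rightarrow> 'a token \<Rightarrow> (gap \<times> gap) set" where
  "inner_neighbours x t = {(g, h). \<exists>u v. x = u @ [Gap g, t, Gap h] @ v}"

lemma neighbours_rotations: "z \<in> rotations w \<Longrightarrow> neighbours z = neighbours w"
  unfolding neighbours_def by (simp only: rotations_eq)

text \<open>Cutting at \<open>t'\<close> destroys only the adjacency at the cut, which the second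
  summand restores from the two ends of \<open>x\<close>.\<close>

lemma neighbours_Cons:
  assumes t: "\<not> is_gap t" "\<not> is_gap t'" and x: "alternating x"
  shows "neighbours (t' # x) t = inner_neighbours x t \<union>
     (if t = t' then {(g, h). hd x = Gap h \<and> last x = Gap g} else {})" (is "?L = ?R")
proof (rule equalityI; rule subrelI)
  fix g h assume "(g, h) \<in> ?L"
  then obtain y where y: "t # y \<in> rotations (t' # x)" "hd y = Gap h" "last y = Gap g"
    by (auto simp: neighbours_def)
  then obtain u v where uv: "t' # x = u @ v" "t # y = v @ u" by (auto simp: rotations_def)
  show "(g, h) \<in> ?R"
  proof (cases "u = [] \<or> v = []")
    case True
    then have "t' # x = t # y" using uv by auto
    then show ?thesis using y by auto
  next
    case False
    then obtain u' v' where "u = t' # u'" "v = t # v'" using uv by (cases u; cases v) auto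
    then have e: "y = v' @ t' # u'" "x = u' @ t # v'" using uv by auto
    then have "alternating u'" "alternating v'" using x t by (auto simp: alternating_append_iff)
    then obtain g' u'' h' v'' where "u' = u'' @ [Gap g']" "v' = Gap h' # v''"
      by (metis alternating_hd alternating_last)
    then have "x = u'' @ [Gap g, t, Gap h] @ v''" using e y by auto
    then show ?thesis unfolding inner_neighbours_def by blast
  qed
next
  fix g h assume R: "(g, h) \<in> ?R"
  show "(g, h) \<in> ?L"
  proof (cases "(g, h) \<in> inner_neighbours x t")
    case True
    then obtain u v where "x = u @ [Gap g, t, Gap h] @ v" by (auto simp: inner_neighbours_def)
    then have "t' # x = (t' # u @ [Gap g]) @ (t # Gap h # v)" by simp
    then have "(t # Gap h # v) @ (t' # u @ [Gap g]) \<in> rotations (t' # x)"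
      unfolding rotations_def by blast
    then have "t # (Gap h # v @ t' # u @ [Gap g]) \<in> rotations (t' # x)" by simp
    then show ?thesis unfolding neighbours_def by fastforce
  next
    case False
    then have "t = t'" "hd x = Gap h" "last x = Gap g" using R by (auto split: if_splits)
    moreover have "x \<noteq> []" using x by (auto elim: alternating_hd)
    ultimately show ?thesis using rotations_refl[of "t # x"] unfolding neighbours_def by blast
  qed
qed

lemma inner_neighbours_append:
  assumes t: "\<not> is_gap t" "\<not> is_gap t'" and xy: "alternating x" "alternating y"
  shows "inner_neighbours (x @ t' # y) t = inner_neighbours x t \<union> inner_neighbours y t \<union>
     (if t = t' then {(g, h). last x = Gap g \<and> hd y = Gap h} else {})" (is "?L = ?R")
proof (rule equalityI; rule subrelI)
  fix g h assume "(g, h) \<in> ?L"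
  then obtain u v where "x @ t' # y = u @ [Gap g, t, Gap h] @ v" by (auto simp: inner_neighbours_def)
  then have e: "x @ t' # y = (u @ [Gap g]) @ t # (Gap h # v)" by simp
  consider "x = u @ [Gap g]" "t = t'" "y = Gap h # v"
    | r where "x = (u @ [Gap g]) @ t # r" "Gap h # v = r @ t' # y"
    | r where "u @ [Gap g] = x @ t' # r" "y = r @ t # Gap h # v"
    using e by (auto simp: append_eq_append_conv2 Cons_eq_append_conv append_eq_Cons_conv)
  then show "(g, h) \<in> ?R"
  proof cases
    case 2
    then have "alternating r" using xy(1) t alternating_appendD[of "u @ [Gap g]" t r] by simp
    then obtain h' r' where "r = Gap h' # r'" by (rule alternating_hd)
    then have "x = u @ [Gap g, t, Gap h] @ r'" using 2 by auto
    then show ?thesis unfolding inner_neighbours_def by blast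
  next
    case 3
    then have "alternating r" using xy t by (auto simp: alternating_append_iff)
    then obtain g' r' where "r = r' @ [Gap g']" by (rule alternating_last)
    then have "y = r' @ [Gap g, t, Gap h] @ v" using 3 by auto
    then show ?thesis unfolding inner_neighbours_def by blast
  qed auto
next
  fix g h assume "(g, h) \<in> ?R"
  then consider "(g, h) \<in> inner_neighbours x t" | "(g, h) \<in> inner_neighbours y t"
    | "t = t'" "last x = Gap g" "hd y = Gap h" by (auto split: if_splits)
  then show "(g, h) \<in> ?L"
  proof cases
    case 1
    then obtain u v where "x = u @ [Gap g, t, Gap h] @ v" by (auto simp: inner_neighbours_def)
    then have "x @ t' # y = u @ [Gap g, t, Gap h] @ (v @ t' # y)" by simp
    then show ?thesis unfolding inner_neighbours_def by blast
  next
    case 2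
    then obtain u v where "y = u @ [Gap g, t, Gap h] @ v" by (auto simp: inner_neighbours_def)
    then have "x @ t' # y = (x @ t' # u) @ [Gap g, t, Gap h] @ v" by simp
    then show ?thesis unfolding inner_neighbours_def by blast
  next
    case 3
    obtain g' x' where "x = x' @ [Gap g']" using xy(1) by (rule alternating_last)
    moreover obtain h' y' where "y = Gap h' # y'" using xy(2) by (rule alternating_hd)
    ultimately have "x @ t' # y = x' @ [Gap g, t, Gap h] @ y'" using 3 by auto
    then show ?thesis unfolding inner_neighbours_def by blast
  qed
qed

lemma inner_neighbours_single: "\<not> is_gap t \<Longrightarrow> inner_neighbours [Gap g] t = {}"
  by (auto simp: inner_neighbours_def Cons_eq_append_conv)

lemma inner_neighbours_rev: "inner_neighbours (rev x) t = (inner_neighbours x t)\<inverse>"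
proof -
  have "(h, g) \<in> inner_neighbours (rev x) t" if gh: "(g, h) \<in> inner_neighbours x t" for g h x
  proof -
    obtain u v where "x = u @ [Gap g, t, Gap h] @ v" using gh by (auto simp: inner_neighbours_def)
    then have "rev x = rev v @ [Gap h, t, Gap g] @ rev u" by simp
    then show ?thesis unfolding inner_neighbours_def by blast
  qed
  from this[of _ _ x] this[of _ _ "rev x"] show ?thesis by auto
qed

text \<open>Equal pairs would collapse in a set. The list keeps the number of occurrences, which
  decides at a reversal whether the projection changes sign.\<close>

lemma inner_neighbours_list:
  assumes "alternating x" "\<not> is_gap t"
  shows "\<exists>xs. length xs = count_list x t \<and> inner_neighbours x t = set xs"
  using assms(1)
proof (induction rule: alternating.induct)
  case (single g)
  then show ?case using assms(2) by (auto simp: inner_neighbours_single)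
next
  case (step x t' g)
  obtain xs where xs: "length xs = count_list x t" "inner_neighbours x t = set xs" using step.IH by blast
  obtain h x' where h: "x = Gap h # x'" using step.hyps(1) by (rule alternating_hd)
  have "inner_neighbours ([Gap g] @ t' # x) t = set xs \<union> (if t = t' then {(g, h)} else {})"
    using assms(2) step.hyps xs h
    by (subst inner_neighbours_append) (auto simp: inner_neighbours_single intro: alternating.intros)
  then have "inner_neighbours (Gap g # t' # x) t = set ((if t = t' then [(g, h)] else []) @ xs)" by auto
  moreover have "length ((if t = t' then [(g, h)] else []) @ xs) = count_list (Gap g # t' # x) t"
    using xs assms(2) by auto
  ultimately show ?case by blast
qed

lemma neighbours_list:
  assumes "cyclic_alternating w" "\<not> is_gap t"
  shows "\<exists>xs. length xs = count_list w t \<and> neighbours w t = set xs"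
proof -
  obtain z where z: "z \<in> rotations w"
    "(\<exists>g. z = [Gap g]) \<or> (\<exists>t x. z = t # x \<and> \<not> is_gap t \<and> alternating x)"
    using assms(1) by (auto simp: cyclic_alternating_def)
  have "count_list w t = count_list z t"
    using mset_rotations[OF z(1)] by (metis count_mset)
  moreover have "\<exists>xs. length xs = count_list z t \<and> neighbours z t = set xs"
    using z(2)
  proof (elim disjE exE conjE)
    fix g assume zg: "z = [Gap g]"
    then have "rotations z = {z}" by (auto simp: rotations_def Cons_eq_append_conv)
    then have "neighbours z t = {}" using zg assms(2) by (auto simp: neighbours_def)
    then show ?thesis using zg assms(2) by auto
  next
    fix t' x assume tx: "z = t' # x" "\<not> is_gap t'" "alternating x"
    obtain xs where xs: "length xs = count_list x t" "inner_neighbours x t = set xs"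
      using inner_neighbours_list[OF tx(3) assms(2)] by blast
    obtain h x' where h: "x = Gap h # x'" using tx(3) by (rule alternating_hd)
    obtain g x'' where g: "x = x'' @ [Gap g]" using tx(3) by (rule alternating_last)
    have "hd x = Gap h" using h by simp
    moreover have "last x = Gap g" using g by simp
    ultimately have "neighbours z t = set ((if t = t' then [(g, h)] else []) @ xs)"
      unfolding tx(1) neighbours_Cons[OF assms(2) tx(2,3)] xs(2) by auto
    moreover have "length ((if t = t' then [(g, h)] else []) @ xs) = count_list z t"
      using xs tx by auto
    ultimately show ?thesis by blast
  qed
  ultimately show ?thesis using neighbours_rotations[OF z(1)] by metis
qed

definition all_neighbours :: "'a token list list \<Rightarrow> 'a token \<Rightarrow> (gap \<times> gap) set" where
  "all_neighbours ws t = (\<Union>w\<in>set ws. neighbours w t)"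

lemma all_neighbours_simps [simp]:
  "all_neighbours [] t = {}"
  "all_neighbours (w # ws) t = neighbours w t \<union> all_neighbours ws t"
  "all_neighbours (us @ vs) t = all_neighbours us t \<union> all_neighbours vs t"
  by (auto simp: all_neighbours_def)

lemma all_neighbours_list:
  assumes "\<And>w. w \<in> set ws \<Longrightarrow> cyclic_alternating w" "\<not> is_gap t"
  shows "\<exists>xs. length xs = count_list (concat ws) t \<and> all_neighbours ws t = set xs"
  using assms(1)
proof (induction ws)
  case (Cons w ws)
  obtain xs where "length xs = count_list (concat ws) t" "all_neighbours ws t = set xs"
    using Cons by auto
  moreover obtain ys where "length ys = count_list w t" "neighbours w t = set ys"
    using Cons.prems neighbours_list[OF _ assms(2)] by (meson list.set_intros(1))
  ultimately have "length (ys @ xs) = count_list (concat (w # ws)) t"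
    "all_neighbours (w # ws) t = set (ys @ xs)" by auto
  then show ?case by blast
qed auto

section \<open>An invariant of the deformation\<close>

text \<open>
  The links created at a letter whose two occurrences are preceded by \<open>g\<close>, \<open>g'\<close> and followed by
  \<open>h\<close>, \<open>h'\<close>; the flag says whether marker and projection agree.
\<close>

definition smoothing :: "bool \<Rightarrow> (gap \<times> gap) set \<Rightarrow> gap set set \<Rightarrow> bool" where
  "smoothing b N k \<longleftrightarrow> (\<exists>g h g' h'. N = {(g, h), (g', h')} \<and>
     k = (if b then {{g, h'}, {g', h}} else {{g, g'}, {h, h'}}))"

text \<open>The two occurrences of a letter have no preferred order; exchanging them maps each of
  the two sets of links to itself.\<close>

lemma smoothing_iff:
  "smoothing b {(g, h), (g', h')} k \<longleftrightarrow> k = (if b then {{g, h'}, {g', h}} else {{g, g'}, {h, h'}})"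
proof
  assume "smoothing b {(g, h), (g', h')} k"
  then obtain x y x' y' where N: "{(g, h), (g', h')} = {(x, y), (x', y')}"
    and k: "k = (if b then {{x, y'}, {x', y}} else {{x, x'}, {y, y'}})"
    by (auto simp: smoothing_def)
  have "(x, y) = (g, h) \<and> (x', y') = (g', h') \<or> (x, y) = (g', h') \<and> (x', y') = (g, h)"
    using N by (auto simp: doubleton_eq_iff)
  then show "k = (if b then {{g, h'}, {g', h}} else {{g, g'}, {h, h'}})"
    unfolding k by (elim disjE conjE Pair_inject) (simp_all add: insert_commute)
next
  assume "k = (if b then {{g, h'}, {g', h}} else {{g, g'}, {h, h'}})"
  then show "smoothing b {(g, h), (g', h')} k" unfolding smoothing_def by blast
qed

lemma smoothing_exists:
  assumes "length xs = 2"
  shows "\<exists>k. smoothing b (set xs) k"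
proof -
  obtain a c where "xs = [a, c]" using assms by (auto simp: numeral_2_eq_2 length_Suc_conv)
  then have "set xs = {(fst a, snd a), (fst c, snd c)}" by auto
  then show ?thesis by (metis smoothing_iff)
qed

text \<open>
  Reversing a stretch that contains exactly one of the two occurrences interchanges the two
  smoothings, which is compensated by the change of projections in \<open>(Q)\<^sub>x\<close>.
\<close>

lemma smoothing_converse:
  assumes len: "length xs + length ys = 2" and sm: "smoothing b (set xs \<union> set ys) k"
  shows "smoothing (if length xs = 1 then \<not> b else b) ((set xs)\<inverse> \<union> set ys) k"
proof -
  consider "length xs = 0" "length ys = 2" | "length xs = 1" "length ys = 1" | "length xs = 2" "length ys = 0"
    using len by linarith
  then show ?thesis
  proof cases
    case 1
    then show ?thesis using sm by simp
  next
    case 2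
    then obtain g h g' h' where "xs = [(g, h)]" "ys = [(g', h')]"
      by (auto simp: length_Suc_conv)
    then have s: "set xs \<union> set ys = {(g, h), (g', h')}" "(set xs)\<inverse> \<union> set ys = {(h, g), (g', h')}" by auto
    \<comment> \<open>With one pair swapped, \<open>{{g, h'}, {g', h}}\<close> turns into
      \<open>{{h, h'}, {g', g}}\<close>, the links of the other smoothing.\<close>
    show ?thesis using sm 2(1) unfolding s smoothing_iff by (simp add: insert_commute)
  next
    case 3
    then obtain a c where "xs = [a, c]" "ys = []" by (auto simp: numeral_2_eq_2 length_Suc_conv)
    then obtain g h g' h' where "xs = [(g, h), (g', h')]" "ys = []" by (metis surj_pair)
    then have s: "set xs \<union> set ys = {(g, h), (g', h')}" "(set xs)\<inverse> \<union> set ys = {(h, g), (h', g')}" by auto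
    \<comment> \<open>With both pairs swapped, each set of links is mapped to itself.\<close>
    show ?thesis using sm 3(1) unfolding s smoothing_iff by (simp add: insert_commute)
  qed
qed

definition links :: "(gap \<times> gap) set \<Rightarrow> gap set set" where
  "links N = (\<lambda>(g, h). {g, h}) ` N"

lemma links_converse: "links (N\<inverse>) = links N"
  by (force simp: links_def insert_commute)

lemma links_Un: "links (M \<union> N) = links M \<union> links N"
  by (auto simp: links_def)

lemma neighbours_empty: "t \<notin> set w \<Longrightarrow> neighbours w t = {}"
  unfolding neighbours_def by (auto dest!: mset_rotations arg_cong[where f = set_mset])

lemma all_neighbours_empty: "t \<notin> set (concat ws) \<Longrightarrow> all_neighbours ws t = {}"
  by (auto simp: all_neighbours_def dest: neighbours_empty)

lemma inner_neighbours_empty: "t \<notin> set x \<Longrightarrow> inner_neighbours x t = {}"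
  by (auto simp: inner_neighbours_def)

lemma alternating_hd_last_append:
  assumes "alternating x" "alternating y"
  shows "hd (x @ t # y) = hd x" "last (x @ t # y) = last y"
  using assms by (auto elim!: alternating_hd)

text \<open>For \<open>t \<noteq> t'\<close> the result is the same as in
  \<open>all_neighbours_separate\<close>, so joining or separating words at one letter leaves the
  neighbours of all other letters and reminders alone.\<close>

lemma all_neighbours_joined:
  assumes "\<not> is_gap t" "\<not> is_gap t'" "alternating x" "alternating y"
  shows "all_neighbours [t' # x @ t' # y] t = inner_neighbours x t \<union> inner_neighbours y t \<union>
    (if t = t' then {(g, h). last y = Gap g \<and> hd x = Gap h} \<union> {(g, h). last x = Gap g \<and> hd y = Gap h} else {})"
proof -
  have "alternating (x @ t' # y)" using assms by (simp add: alternating_append_iff)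
  then show ?thesis
    unfolding all_neighbours_simps neighbours_Cons[OF assms(1,2) \<open>alternating (x @ t' # y)\<close>]
      inner_neighbours_append[OF assms] alternating_hd_last_append[OF assms(3,4)]
    by (cases "t = t'") auto
qed

lemma all_neighbours_separate:
  assumes "\<not> is_gap t" "\<not> is_gap t'" "alternating x" "alternating y"
  shows "all_neighbours [t' # x, t' # y] t = inner_neighbours x t \<union> inner_neighbours y t \<union>
    (if t = t' then {(g, h). last x = Gap g \<and> hd x = Gap h} \<union> {(g, h). last y = Gap g \<and> hd y = Gap h} else {})"
  using assms neighbours_Cons[of t t' x] neighbours_Cons[of t t' y] by auto

lemma hd_last_gaps:
  assumes "alternating x" obtains g h where "hd x = Gap h" "last x = Gap g"
  using assms by (metis alternating_hd alternating_last last_snoc list.sel(1))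

text \<open>
  \<open>K e A\<close> is the set of links at \<open>A\<close> for the marker \<open>e\<close>. Links carry no direction, so they survive
  reversals. The links for both markers are tracked as long as \<open>A\<close> is untreated; thereby one
  deformation yields information on both states that differ at \<open>A\<close>.
\<close>

locale resolving =
  fixes m :: "'a \<Rightarrow> int" and Al :: "'a set" and X :: "gap set" and K :: "int \<Rightarrow> 'a \<Rightarrow> gap set set"
  assumes marker: "A \<in> Al \<Longrightarrow> m A = 1 \<or> m A = -1"
begin

definition unresolved :: "'a token list list \<Rightarrow> ('a \<Rightarrow> int) \<Rightarrow> 'a \<Rightarrow> bool" where
  "unresolved ws p A \<longleftrightarrow> count_list (concat ws) (Letter A) = 2 \<and> Reminder A \<notin> set (concat ws) \<and>
     (p A = 1 \<or> p A = -1) \<and>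
     (\<forall>e\<in>{1, -1}. smoothing (e = p A) (all_neighbours ws (Letter A)) (K e A))"

definition treated :: "'a token list list \<Rightarrow> 'a \<Rightarrow> bool" where
  "treated ws A \<longleftrightarrow> Letter A \<notin> set (concat ws) \<and> K (m A) A = links (all_neighbours ws (Reminder A))"

text \<open>Gaps of \<open>X\<close> are counted exactly once so that a gap determines its word;
  later this prevents links from leaving a word.\<close>

definition invar :: "'a token list list \<Rightarrow> ('a \<Rightarrow> int) \<Rightarrow> bool" where
  "invar ws p \<longleftrightarrow> (\<forall>w\<in>set ws. cyclic_alternating w) \<and>
     (\<forall>g. count_list (concat ws) (Gap g) = of_bool (g \<in> X)) \<and>
     (\<forall>A. A \<notin> Al \<longrightarrow> Letter A \<notin> set (concat ws) \<and> Reminder A \<notin> set (concat ws)) \<and>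
     (\<forall>A\<in>Al. unresolved ws p A \<or> treated ws A)"

text \<open>Common core of the four rules: for the other letters each of them keeps or reverses an
  arc \<open>x\<close>. For a treated letter the reversal is invisible, as links are unordered. For
  an unresolved one it interchanges the smoothings exactly when the letter occurs once in
  \<open>x\<close>, and \<open>flip_proj\<close> corrects this.\<close>

lemma invar_replace:
  assumes inv: "invar (us @ W @ vs) p" and xy: "alternating x" "alternating y"
    and cW: "\<And>t. count_list (concat W) t = count_list x t + count_list y t + (if t = Letter A then 2 else 0)"
    and cW': "\<And>t. count_list (concat W') t = count_list x t + count_list y t + (if t = Reminder A then 2 else 0)"
    and nW: "\<And>t. \<not> is_gap t \<Longrightarrow> t \<noteq> Letter A \<Longrightarrow>
       all_neighbours W t = inner_neighbours x t \<union> inner_neighbours y t"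
    and nW': "\<And>t. \<not> is_gap t \<Longrightarrow> t \<noteq> Reminder A \<Longrightarrow>
       all_neighbours W' t = inner_neighbours z t \<union> inner_neighbours y t"
    and z: "z = x \<and> p' = p \<or> z = rev x \<and> p' = flip_proj x p"
    and cyc: "\<And>w. w \<in> set W' \<Longrightarrow> cyclic_alternating w"
    and K: "K (m A) A = links (all_neighbours W' (Reminder A))"
  shows "invar (us @ W' @ vs) p'"
proof -
  let ?ws = "us @ W @ vs" and ?ws' = "us @ W' @ vs"
  have "count_list (concat W) (Letter A) \<noteq> 0" by (simp add: cW)
  then have AW: "Letter A \<in> set (concat W)" by (metis count_notin)
  then have A: "A \<in> Al" "\<not> treated ?ws A"
    using inv by (auto simp: invar_def treated_def)
  then have unA: "unresolved ?ws p A" using inv by (auto simp: invar_def)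
  have zero: "count_list (concat us) (Letter A) = 0" "count_list (concat vs) (Letter A) = 0"
    "count_list x (Letter A) = 0" "count_list y (Letter A) = 0"
    using unA cW[of "Letter A"] by (auto simp: unresolved_def count_list_append)
  have noR: "Reminder A \<notin> set (concat us)" "Reminder A \<notin> set (concat vs)"
    using unA by (auto simp: unresolved_def)
  have cnt: "count_list (concat ?ws') t = count_list (concat ?ws) t"
    if "t \<noteq> Letter A" "t \<noteq> Reminder A" for t
    using that by (simp add: count_list_append cW cW')
  have memb: "t \<in> set (concat ?ws') \<longleftrightarrow> t \<in> set (concat ?ws)"
    if "t \<noteq> Letter A" "t \<noteq> Reminder A" for t
    using cnt[OF that] by (metis count_list_0_iff)
  have cyc': "\<forall>w\<in>set ?ws'. cyclic_alternating w" using inv cyc by (auto simp: invar_def)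
  have tA: "treated ?ws' A"
  proof -
    have "count_list (concat ?ws') (Letter A) = 0" using zero cW'[of "Letter A"] by (simp add: count_list_append)
    then have "Letter A \<notin> set (concat ?ws')" by (metis count_list_0_iff)
    moreover have "all_neighbours ?ws' (Reminder A) = all_neighbours W' (Reminder A)"
      using all_neighbours_empty[OF noR(1)] all_neighbours_empty[OF noR(2)] by simp
    ultimately show ?thesis using K by (simp add: treated_def)
  qed
  have other: "unresolved ?ws' p' B \<or> treated ?ws' B" if B: "B \<in> Al" "B \<noteq> A" for B
  proof -
    from inv B have "unresolved ?ws p B \<or> treated ?ws B" by (auto simp: invar_def)
    then show ?thesis
    proof
      assume tr: "treated ?ws B"
      have "all_neighbours ?ws' (Reminder B) = all_neighbours ?ws (Reminder B) \<or>
        all_neighbours ?ws (Reminder B) = inner_neighbours x (Reminder B) \<union>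
          (all_neighbours us (Reminder B) \<union> all_neighbours vs (Reminder B) \<union> inner_neighbours y (Reminder B)) \<and>
        all_neighbours ?ws' (Reminder B) = (inner_neighbours x (Reminder B))\<inverse> \<union>
          (all_neighbours us (Reminder B) \<union> all_neighbours vs (Reminder B) \<union> inner_neighbours y (Reminder B))"
        using z B nW[of "Reminder B"] nW'[of "Reminder B"] by (auto simp: inner_neighbours_rev)
      then have "links (all_neighbours ?ws' (Reminder B)) = links (all_neighbours ?ws (Reminder B))"
        by (elim disjE conjE) (simp_all only: links_Un links_converse)
      moreover have "Letter B \<notin> set (concat ?ws')"
        using tr memb[of "Letter B"] B by (auto simp: treated_def)
      ultimately show ?thesis using tr by (simp add: treated_def)
    next
      assume un: "unresolved ?ws p B"
      have nB: "all_neighbours ?ws (Letter B) = inner_neighbours x (Letter B) \<union>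
          (all_neighbours us (Letter B) \<union> all_neighbours vs (Letter B) \<union> inner_neighbours y (Letter B))"
        "all_neighbours ?ws' (Letter B) = inner_neighbours z (Letter B) \<union>
          (all_neighbours us (Letter B) \<union> all_neighbours vs (Letter B) \<union> inner_neighbours y (Letter B))"
        using B nW[of "Letter B"] nW'[of "Letter B"] by auto
      have c2: "count_list (concat ?ws') (Letter B) = 2" using cnt[of "Letter B"] B un by (simp add: unresolved_def)
      have nR: "Reminder B \<notin> set (concat ?ws')" using memb[of "Reminder B"] B un by (simp add: unresolved_def)
      from z show ?thesis
      proof (elim disjE conjE)
        assume "z = x" "p' = p"
        then show ?thesis using un nB c2 nR by (simp add: unresolved_def)
      next
        assume zp: "z = rev x" "p' = flip_proj x p"
        obtain xs where xs: "length xs = count_list x (Letter B)" "inner_neighbours x (Letter B) = set xs"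
          using inner_neighbours_list[OF xy(1)] by (metis is_gap_simps(2))
        obtain ys where ys: "length ys = count_list y (Letter B)" "inner_neighbours y (Letter B) = set ys"
          using inner_neighbours_list[OF xy(2)] by (metis is_gap_simps(2))
        obtain us' where us': "length us' = count_list (concat us) (Letter B)" "all_neighbours us (Letter B) = set us'"
          using all_neighbours_list[of us "Letter B"] inv by (auto simp: invar_def)
        obtain vs' where vs': "length vs' = count_list (concat vs) (Letter B)" "all_neighbours vs (Letter B) = set vs'"
          using all_neighbours_list[of vs "Letter B"] inv by (auto simp: invar_def)
        let ?r = "us' @ vs' @ ys"
        have len: "length xs + length ?r = 2"
          using c2 B xs(1) ys(1) us'(1) vs'(1) cW'[of "Letter B"] by (simp add: count_list_append)
        have N: "all_neighbours ?ws (Letter B) = set xs \<union> set ?r"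
          "all_neighbours ?ws' (Letter B) = (set xs)\<inverse> \<union> set ?r"
          using nB xs ys us' vs' zp by (auto simp: inner_neighbours_rev)
        have pB: "p B = 1 \<or> p B = -1" using un by (simp add: unresolved_def)
        have p'B: "p' B = (if length xs = 1 then - p B else p B)"
          unfolding zp xs(1) flip_proj_def ..
        have "smoothing (e = p' B) (all_neighbours ?ws' (Letter B)) (K e B)" if e: "e \<in> {1, -1}" for e
        proof -
          have "smoothing (e = p B) (set xs \<union> set ?r) (K e B)"
            using un e unfolding unresolved_def N(1) by blast
          then have "smoothing (if length xs = 1 then \<not> (e = p B) else e = p B) ((set xs)\<inverse> \<union> set ?r) (K e B)"
            by (rule smoothing_converse[OF len])
          \<comment> \<open>As \<open>e\<close> and \<open>p B\<close> are 1 or -1, negating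
            \<open>p B\<close> negates the test \<open>e = p B\<close>.\<close>
          moreover have "(if length xs = 1 then \<not> (e = p B) else e = p B) = (e = p' B)"
            using pB e unfolding p'B by auto
          ultimately show ?thesis using N by simp
        qed
        moreover have "p' B = 1 \<or> p' B = -1" using pB p'B by auto
        ultimately show ?thesis using c2 nR unfolding unresolved_def by blast
      qed
    qed
  qed
  show ?thesis
    unfolding invar_def
  proof (intro conjI allI ballI impI)
    fix w assume "w \<in> set ?ws'"
    then show "cyclic_alternating w" using cyc' by blast
  next
    fix g
    have "count_list (concat ?ws) (Gap g) = of_bool (g \<in> X)" using inv unfolding invar_def by blast
    then show "count_list (concat ?ws') (Gap g) = of_bool (g \<in> X)" by (subst cnt) simp_all
  next
    fix B assume "B \<notin> Al"
    then show "Letter B \<notin> set (concat ?ws')" "Reminder B \<notin> set (concat ?ws')"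
      using memb[of "Letter B"] memb[of "Reminder B"] A inv by (auto simp: invar_def)
  next
    fix B assume "B \<in> Al"
    then show "unresolved ?ws' p' B \<or> treated ?ws' B" using other tA by (cases "B = A") auto
  qed
qed

lemma invar_letter:
  assumes "invar ws p" "Letter A \<in> set (concat ws)"
  shows "A \<in> Al" "unresolved ws p A"
  using assms by (auto simp: invar_def treated_def)

text \<open>At \<open>A\<close> itself the links prescribed by \<open>K\<close> must be those next
  to the two new reminders. For each rule this is read off from the end gaps \<open>hx\<close>,
  \<open>lx\<close>, \<open>hy\<close>, \<open>ly\<close> of the arcs.\<close>

lemma invar_resolve:
  assumes inv: "invar (us @ W @ vs) p"
    and W: "W = [Letter A # x @ Letter A # y] \<or> W = [Letter A # x, Letter A # y]" (is "?J \<or> ?S")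
    and W': "W' = (if m A = p A then if W = [Letter A # x @ Letter A # y]
         then [Reminder A # x, Reminder A # y] else [Reminder A # x @ Reminder A # y]
       else [Reminder A # rev x @ Reminder A # y])"
    and p': "p' = (if m A = p A then p else flip_proj x p)"
  shows "invar (us @ W' @ vs) p'"
proof -
  have "\<forall>w\<in>set W. cyclic_alternating w" using inv by (auto simp: invar_def)
  then have xy: "alternating x" "alternating y"
    using W by (auto simp: cyclic_alternating_Cons alternating_append_iff)
  define z where "z = (if m A = p A then x else rev x)"
  have az: "alternating z" using xy by (auto simp: z_def alternating_rev)
  have un: "unresolved (us @ W @ vs) p A" "A \<in> Al"
    using invar_letter[OF inv, of A] W by auto
  have cW: "count_list (concat W) t = count_list x t + count_list y t + (if t = Letter A then 2 else 0)" for t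
    using W by (auto simp: count_list_append)
  have cz: "count_list z t = count_list x t" for t by (auto simp: z_def count_list_rev)
  have Wz: "W' = [Reminder A # z @ Reminder A # y] \<or> W' = [Reminder A # z, Reminder A # y]"
    using W' by (auto simp: z_def)
  have cW': "count_list (concat W') t = count_list x t + count_list y t + (if t = Reminder A then 2 else 0)" for t
    using Wz cz[of t] by (auto simp: count_list_append)
  have zero: "Letter A \<notin> set x" "Letter A \<notin> set y" "Letter A \<notin> set (concat us)" "Letter A \<notin> set (concat vs)"
    "Reminder A \<notin> set x" "Reminder A \<notin> set y"
  proof -
    have "count_list x (Letter A) = 0" "count_list y (Letter A) = 0"
      "count_list (concat us) (Letter A) = 0" "count_list (concat vs) (Letter A) = 0"
      using un(1) cW[of "Letter A"] by (auto simp: unresolved_def count_list_append)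
    then show "Letter A \<notin> set x" "Letter A \<notin> set y" "Letter A \<notin> set (concat us)" "Letter A \<notin> set (concat vs)"
      unfolding count_list_0_iff .
    show "Reminder A \<notin> set x" "Reminder A \<notin> set y" using un(1) W by (auto simp: unresolved_def)
  qed
  obtain lx hx where x: "hd x = Gap hx" "last x = Gap lx" using hd_last_gaps[OF xy(1)] .
  obtain ly hy where y: "hd y = Gap hy" "last y = Gap ly" using hd_last_gaps[OF xy(2)] .
  have xne: "x \<noteq> []" using xy(1) by (auto elim: alternating_hd)
  have zz: "hd z = (if m A = p A then Gap hx else Gap lx)" "last z = (if m A = p A then Gap lx else Gap hx)"
    using x xne by (auto simp: z_def hd_rev last_rev)
  have Rz: "Reminder A \<notin> set z" using zero by (auto simp: z_def)
  have inner0: "inner_neighbours x (Letter A) = {}" "inner_neighbours y (Letter A) = {}"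
    "inner_neighbours z (Reminder A) = {}" "inner_neighbours y (Reminder A) = {}"
    using zero Rz inner_neighbours_empty by metis+
  have "all_neighbours (us @ W @ vs) (Letter A) = all_neighbours W (Letter A)"
    using all_neighbours_empty[OF zero(3)] all_neighbours_empty[OF zero(4)] by simp
  \<comment> \<open>Of the two smoothings tracked so far, the marker \<open>m A\<close> selects
    one.\<close>
  then have sm: "smoothing (m A = p A) (all_neighbours W (Letter A)) (K (m A) A)"
    using un marker[OF un(2)] by (auto simp: unresolved_def)
  have K: "K (m A) A = links (all_neighbours W' (Reminder A))"
    using W
  proof
    assume J: ?J
    \<comment> \<open>In the cyclic word \<open>AxAy\<close> the first \<open>A\<close> is preceded
      by the end of \<open>y\<close>, the second by the end of \<open>x\<close>.\<close>
    have "all_neighbours W (Letter A) = {(ly, hx), (lx, hy)}"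
      unfolding J all_neighbours_joined[OF is_gap_simps(2) is_gap_simps(2) xy] using x y inner0 by auto
    then have k: "K (m A) A = (if m A = p A then {{ly, hy}, {lx, hx}} else {{ly, lx}, {hx, hy}})"
      using sm by (simp add: smoothing_iff)
    show ?thesis
    proof (cases "m A = p A")
      case True
      then have "W' = [Reminder A # z, Reminder A # y]" using W' J by (simp add: z_def)
      then have "all_neighbours W' (Reminder A) = {(lx, hx), (ly, hy)}"
        using all_neighbours_separate[OF is_gap_simps(3) is_gap_simps(3) az xy(2), of A A] zz y inner0 True by auto
      then show ?thesis using k True by (auto simp: links_def)
    next
      case False
      then have "W' = [Reminder A # z @ Reminder A # y]" using W' by (simp add: z_def)
      \<comment> \<open>Reversal puts \<open>lx\<close> at the beginning and \<open>hx\<close> at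
        the end of the arc.\<close>
      then have "all_neighbours W' (Reminder A) = {(ly, lx), (hx, hy)}"
        using all_neighbours_joined[OF is_gap_simps(3) is_gap_simps(3) az xy(2), of A A] zz y inner0 False by auto
      then show ?thesis using k False by (auto simp: links_def)
    qed
  next
    assume S: ?S
    have "all_neighbours W (Letter A) = {(lx, hx), (ly, hy)}"
      unfolding S all_neighbours_separate[OF is_gap_simps(2) is_gap_simps(2) xy] using x y inner0 by auto
    then have k: "K (m A) A = (if m A = p A then {{lx, hy}, {ly, hx}} else {{lx, ly}, {hx, hy}})"
      using sm by (simp add: smoothing_iff)
    have "W' = [Reminder A # z @ Reminder A # y]" using W' S by (simp add: z_def)
    then have "all_neighbours W' (Reminder A) =
      (if m A = p A then {(ly, hx), (lx, hy)} else {(ly, lx), (hx, hy)})"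
      using all_neighbours_joined[OF is_gap_simps(3) is_gap_simps(3) az xy(2), of A A] zz y inner0 by auto
    then show ?thesis using k by (auto simp: links_def insert_commute)
  qed
  show ?thesis
  proof (rule invar_replace[OF inv xy cW cW' _ _ _ _ K])
    show "all_neighbours W t = inner_neighbours x t \<union> inner_neighbours y t"
      if "\<not> is_gap t" "t \<noteq> Letter A" for t
      using W all_neighbours_joined[OF that(1) is_gap_simps(2) xy, of A]
        all_neighbours_separate[OF that(1) is_gap_simps(2) xy, of A] that(2) by (elim disjE) simp_all
    show "all_neighbours W' t = inner_neighbours z t \<union> inner_neighbours y t"
      if "\<not> is_gap t" "t \<noteq> Reminder A" for t
      using Wz all_neighbours_joined[OF that(1) is_gap_simps(3) az xy(2), of A]
        all_neighbours_separate[OF that(1) is_gap_simps(3) az xy(2), of A] that(2) by (elim disjE) simp_all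
    show "z = x \<and> p' = p \<or> z = rev x \<and> p' = flip_proj x p" using p' by (simp add: z_def)
    show "cyclic_alternating w" if "w \<in> set W'" for w
      using that Wz az xy by (auto simp: cyclic_alternating_Cons alternating_append_iff)
  qed
qed

lemma invar_cong:
  assumes "invar ws p"
    and "\<And>t. count_list (concat ws') t = count_list (concat ws) t"
    and nb: "\<And>t. all_neighbours ws' t = all_neighbours ws t"
    and "\<And>w. w \<in> set ws' \<Longrightarrow> cyclic_alternating w"
  shows "invar ws' p"
proof -
  have "t \<in> set (concat ws') \<longleftrightarrow> t \<in> set (concat ws)" for t
    using assms(2)[of t] by (metis count_list_0_iff)
  then show ?thesis
    using assms unfolding invar_def unresolved_def treated_def by simp
qed

lemma count_concat_mset:
  assumes "mset ws = mset ws'"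
  shows "count_list (concat ws) t = count_list (concat ws') t"
proof -
  have "mset (concat ws) = mset (concat ws')"
    unfolding mset_concat using assms by (metis mset_map sum_mset_sum_list)
  then show ?thesis by (metis count_mset)
qed

lemma all_neighbours_set: "set ws = set ws' \<Longrightarrow> all_neighbours ws t = all_neighbours ws' t"
  by (simp add: all_neighbours_def)

lemma deform_invar:
  assumes "deform m c c'" "invar (fst c) (snd c)"
  shows "invar (fst c') (snd c')"
  using assms
proof (induction rule: deform.induct)
  case (permute ws ws' p)
  have s: "set ws' = set ws" using permute.hyps by (metis set_mset_mset)
  show ?case
    unfolding fst_conv snd_conv
  proof (rule invar_cong)
    show "invar ws p" using permute by simp
    show "cyclic_alternating w" if "w \<in> set ws'" for w
      using that permute s by (simp add: invar_def)
    show "all_neighbours ws' t = all_neighbours ws t" for t by (rule all_neighbours_set[OF s])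
    show "count_list (concat ws') t = count_list (concat ws) t" for t
      using permute.hyps by (intro count_concat_mset) simp
  qed
next
  case (rotate us t w vs p)
  have r: "w @ [t] \<in> rotations (t # w)" using rotations_refl[of "w @ [t]"] by (simp only: rotations_rotate1)
  show ?case
    unfolding fst_conv snd_conv
  proof (rule invar_cong)
    show "invar (us @ [t # w] @ vs) p" using rotate by simp
    show "all_neighbours (us @ [w @ [t]] @ vs) t' = all_neighbours (us @ [t # w] @ vs) t'" for t'
      using neighbours_rotations[OF r] by simp
    show "cyclic_alternating w'" if "w' \<in> set (us @ [w @ [t]] @ vs)" for w'
      using that rotate cyclic_alternating_rotations[OF r] by (auto simp: invar_def)
  qed (simp add: count_list_append)
next
  case (split_eq A p us x y vs)
  then show ?case
    using invar_resolve[of us "[Letter A # x @ Letter A # y]" vs p A x y] by simp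
next
  case (split_neg A p us x y vs)
  then have "unresolved (us @ [Letter A # x @ Letter A # y] @ vs) p A"
    using invar_letter(2)[of "us @ [Letter A # x @ Letter A # y] @ vs" p A] by simp
  then have "m A \<noteq> p A" using split_neg by (auto simp: unresolved_def)
  then show ?case
    using split_neg invar_resolve[of us "[Letter A # x @ Letter A # y]" vs p A x y] by simp
next
  case (join_eq A p us x y vs)
  then show ?case
    using invar_resolve[of us "[Letter A # x, Letter A # y]" vs p A x y] by simp
next
  case (join_neg A p us x y vs)
  then have "unresolved (us @ [Letter A # x, Letter A # y] @ vs) p A"
    using invar_letter(2)[of "us @ [Letter A # x, Letter A # y] @ vs" p A] by simp
  then have "m A \<noteq> p A" using join_neg by (auto simp: unresolved_def)
  then show ?case
    using join_neg invar_resolve[of us "[Letter A # x, Letter A # y]" vs p A x y] by simp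
qed

lemma deforms_invar:
  assumes "(deform m)\<^sup>*\<^sup>* c c'" "invar (fst c) (snd c)"
  shows "invar (fst c') (snd c')"
  using assms by (induction rule: rtranclp_induct) (auto intro: deform_invar)

end

section \<open>Existence of resolutions and their components\<close>

lemma rotations_swap: "v @ u \<in> rotations (u @ v)"
  by (auto simp: rotations_def)

lemma neighbours_memb:
  assumes "(g, h) \<in> neighbours w t"
  shows "t \<in> set w" "Gap g \<in> set w" "Gap h \<in> set w"
proof -
  obtain x where x: "t # x \<in> rotations w" "x \<noteq> []" "hd x = Gap h" "last x = Gap g"
    using assms by (auto simp: neighbours_def)
  have "set w = set (t # x)" using mset_rotations[OF x(1)] by (metis set_mset_mset)
  then show "t \<in> set w" "Gap g \<in> set w" "Gap h \<in> set w"
    using x hd_in_set[OF x(2)] last_in_set[OF x(2)] by auto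
qed

lemma neighbours_nonempty:
  assumes "cyclic_alternating w" "t \<in> set w" "\<not> is_gap t"
  shows "neighbours w t \<noteq> {}"
proof -
  obtain u v where w: "w = u @ t # v" using split_list[OF assms(2)] by blast
  have r: "t # (v @ u) \<in> rotations w" unfolding w using rotations_swap[of "t # v" u] by simp
  then have "alternating (v @ u)"
    using assms cyclic_alternating_rotations[OF r] cyclic_alternating_Cons by metis
  then obtain g h where "hd (v @ u) = Gap h" "last (v @ u) = Gap g" by (rule hd_last_gaps)
  then have "(g, h) \<in> neighbours (t # (v @ u)) t"
    using neighbours_Cons[OF assms(3) assms(3) \<open>alternating (v @ u)\<close>] by auto
  then show ?thesis unfolding neighbours_rotations[OF r] by blast
qed

lemma cyclic_alternating_gap:
  assumes "cyclic_alternating w"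
  shows "\<exists>g. Gap g \<in> set w"
proof -
  obtain z where z: "z \<in> rotations w"
    "(\<exists>g. z = [Gap g]) \<or> (\<exists>t x. z = t # x \<and> \<not> is_gap t \<and> alternating x)"
    using assms by (auto simp: cyclic_alternating_def)
  have "\<exists>g. Gap g \<in> set z" using z(2) by (metis alternating_hd list.set_intros)
  moreover have "set w = set z" using mset_rotations[OF z(1)] by (metis set_mset_mset)
  ultimately show ?thesis by simp
qed

text \<open>Consecutive gaps of \<open>x\<close> are neighbours of the token between them, and
  symmetry of \<open>R\<close> lets this chain be followed in both directions.\<close>

lemma alternating_connected:
  assumes "alternating x" "\<And>t. \<not> is_gap t \<Longrightarrow> inner_neighbours x t \<subseteq> R" "sym R"
    "Gap g \<in> set x" "Gap h \<in> set x"
  shows "(g, h) \<in> R\<^sup>*"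
  using assms
proof (induction arbitrary: g h rule: alternating.induct)
  case (step x t a)
  obtain b x' where b: "x = Gap b # x'" using step.hyps(1) by (rule alternating_hd)
  have "inner_neighbours x t' \<subseteq> inner_neighbours (Gap a # t # x) t'" if "\<not> is_gap t'" for t'
    using inner_neighbours_append[of t' t "[Gap a]" x] step.hyps that by (auto intro: alternating.intros)
  then have IH: "(g, h) \<in> R\<^sup>*" if "Gap g \<in> set x" "Gap h \<in> set x" for g h
    using step.IH[OF _ step.prems(2) that] step.prems(1) by blast
  have "(a, b) \<in> inner_neighbours (Gap a # t # x) t"
    unfolding inner_neighbours_def b by force
  then have ab: "(a, b) \<in> R" "(b, a) \<in> R" using step.prems(1)[OF step.hyps(2)] step.prems(2) by (auto dest: symD)
  have bx: "Gap b \<in> set x" using b by simp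
  have tg: "t \<noteq> Gap g'" for g' using step.hyps(2) by auto
  have gh: "g = a \<or> Gap g \<in> set x" "h = a \<or> Gap h \<in> set x" using step.prems(3,4) tg[of g] tg[of h] by auto
  show ?case
  proof (cases "g = a"; cases "h = a")
    assume "g \<noteq> a" "h \<noteq> a" then show ?thesis using IH gh by blast
  next
    assume "g = a" "h \<noteq> a"
    then show ?thesis using IH[OF bx] gh ab by (meson converse_rtrancl_into_rtrancl)
  next
    assume "g \<noteq> a" "h = a"
    then show ?thesis using IH[OF _ bx] gh ab by (meson rtrancl_into_rtrancl)
  qed auto
qed auto

lemma cyclic_alternating_connected:
  assumes "cyclic_alternating w" "\<And>t. \<not> is_gap t \<Longrightarrow> neighbours w t \<subseteq> R" "sym R"
    "Gap g \<in> set w" "Gap h \<in> set w"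
  shows "(g, h) \<in> R\<^sup>*"
proof -
  obtain z where z: "z \<in> rotations w"
    "(\<exists>g. z = [Gap g]) \<or> (\<exists>t x. z = t # x \<and> \<not> is_gap t \<and> alternating x)"
    using assms(1) by (auto simp: cyclic_alternating_def)
  have s: "set w = set z" using mset_rotations[OF z(1)] by (metis set_mset_mset)
  show ?thesis
    using z(2)
  proof (elim disjE exE conjE)
    fix a assume "z = [Gap a]"
    then show ?thesis using assms(4,5) s by auto
  next
    fix t x assume tx: "z = t # x" "\<not> is_gap t" "alternating x"
    have "inner_neighbours x t' \<subseteq> R" if "\<not> is_gap t'" for t'
      using neighbours_Cons[OF that tx(2,3)] assms(2)[OF that] fun_cong[OF neighbours_rotations[OF z(1)], of t'] tx(1) by auto
    moreover have "Gap g \<in> set x" "Gap h \<in> set x" using assms(4,5) s tx by auto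
    ultimately show ?thesis using alternating_connected[OF tx(3) _ assms(3)] by blast
  qed
qed

lemma deform_rotations:
  "(deform m)\<^sup>*\<^sup>* (us @ [u @ v] @ vs, p) (us @ [v @ u] @ vs, p)"
proof (induction u arbitrary: v)
  case (Cons t u)
  have "(deform m)\<^sup>*\<^sup>* (us @ [t # (u @ v)] @ vs, p) (us @ [u @ (v @ [t])] @ vs, p)"
    using deform.rotate[of m us t "u @ v" vs p] by (simp add: r_into_rtranclp)
  also have "(deform m)\<^sup>*\<^sup>* (us @ [u @ (v @ [t])] @ vs, p) (us @ [(v @ [t]) @ u] @ vs, p)" by (rule Cons.IH)
  finally show ?case by simp
qed simp

lemma word_unique:
  assumes "count_list (concat ws) t \<le> 1" "w \<in> set ws" "w' \<in> set ws" "t \<in> set w" "t \<in> set w'"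
  shows "w = w'"
proof (rule ccontr)
  assume ne: "w \<noteq> w'"
  obtain us vs where ws: "ws = us @ w # vs" using split_list[OF assms(2)] by blast
  then have "w' \<in> set (us @ vs)" using assms(3) ne by auto
  then have "t \<in> set (concat (us @ vs))" using assms(5) by auto
  then have "count_list (concat (us @ vs)) t \<noteq> 0" "count_list w t \<noteq> 0"
    using assms(4) unfolding count_list_0_iff by auto
  then show False using assms(1) unfolding ws by (simp add: count_list_append)
qed

context resolving
begin

text \<open>Rotations and permutations reach one of the two shapes to which a rule applies. The set
  of tokens is recorded so that it stays known which letters are untreated.\<close>

lemma bring_to_front:
  assumes inv: "invar ws p" and A: "Letter A \<in> set (concat ws)"
  shows "\<exists>us W vs x y. (W = [Letter A # x @ Letter A # y] \<or> W = [Letter A # x, Letter A # y]) \<and>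
    (deform m)\<^sup>*\<^sup>* (ws, p) (us @ W @ vs, p) \<and> set (concat (us @ W @ vs)) = set (concat ws)"
proof -
  have "unresolved ws p A" using invar_letter[OF inv A] by blast
  then have two: "count_list (concat ws) (Letter A) = 2" by (simp add: unresolved_def)
  obtain w where w: "w \<in> set ws" "Letter A \<in> set w" using A by auto
  obtain us vs where ws: "ws = us @ [w] @ vs" using split_list[OF w(1)] by auto
  obtain u v where uv: "w = u @ Letter A # v" using split_list[OF w(2)] by blast
  have d: "(deform m)\<^sup>*\<^sup>* (ws, p) (us @ [Letter A # v @ u] @ vs, p)"
    using deform_rotations[of m us u "Letter A # v" vs p] unfolding ws uv by simp
  show ?thesis
  proof (cases "Letter A \<in> set (v @ u)")
    case True
    then obtain x y where xy: "v @ u = x @ Letter A # y" using split_list by fast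
    then have "set v \<union> set u = set x \<union> set (Letter A # y)" by (metis set_append)
    then have "set (concat (us @ [Letter A # x @ Letter A # y] @ vs)) = set (concat ws)"
      unfolding ws uv by auto
    then show ?thesis using d xy by metis
  next
    case False
    then have "count_list w (Letter A) = 1"
      unfolding uv by (auto simp: count_list_append count_list_0_iff)
    then have "count_list (concat (us @ vs)) (Letter A) = 1"
      using two unfolding ws by (simp add: count_list_append)
    then have "Letter A \<in> set (concat (us @ vs))" by (metis count_notin zero_neq_one)
    then obtain w' where w': "w' \<in> set (us @ vs)" "Letter A \<in> set w'" by auto
    obtain us' vs' where us': "us @ vs = us' @ [w'] @ vs'" using split_list[OF w'(1)] by auto
    obtain u' v' where uv': "w' = u' @ Letter A # v'" using split_list[OF w'(2)] by blast
    have "mset us + mset vs = mset us' + (add_mset w' (mset vs'))"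
      using arg_cong[OF us', of mset] by simp
    then have "mset (us @ [Letter A # v @ u] @ vs) = mset ([Letter A # v @ u] @ [w'] @ (us' @ vs'))"
      by simp
    then have "deform m (us @ [Letter A # v @ u] @ vs, p) ([Letter A # v @ u] @ [w'] @ (us' @ vs'), p)"
      by (rule deform.permute)
    with d have "(deform m)\<^sup>*\<^sup>* (ws, p) ([Letter A # v @ u] @ [w'] @ (us' @ vs'), p)"
      by (rule rtranclp.rtrancl_into_rtrancl)
    also have "(deform m)\<^sup>*\<^sup>* ([Letter A # v @ u] @ [w'] @ (us' @ vs'), p)
        ([Letter A # v @ u] @ [Letter A # v' @ u'] @ (us' @ vs'), p)"
      using deform_rotations[of m "[Letter A # v @ u]" u' "Letter A # v'" "us' @ vs'" p] unfolding uv' by simp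
    finally have dd: "(deform m)\<^sup>*\<^sup>* (ws, p) ([] @ [Letter A # v @ u, Letter A # v' @ u'] @ (us' @ vs'), p)"
      by simp
    have "set us \<union> set vs = set us' \<union> {w'} \<union> set vs'" using arg_cong[OF us', of set] by auto
    then have "set (concat us) \<union> set (concat vs) = set (concat us') \<union> set w' \<union> set (concat vs')"
      by (metis (no_types, lifting) UN_Un UN_insert UN_empty set_concat sup_bot_right)
    then have "set (concat ([] @ [Letter A # v @ u, Letter A # v' @ u'] @ (us' @ vs'))) = set (concat ws)"
      unfolding ws uv uv' by auto
    then show ?thesis using dd by blast
  qed
qed

lemma resolve_letter:
  assumes inv: "invar ws p" and A: "Letter A \<in> set (concat ws)"
  shows "\<exists>ws' p'. (deform m)\<^sup>*\<^sup>* (ws, p) (ws', p') \<and> Letter A \<notin> set (concat ws') \<and>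
    (\<forall>B. B \<noteq> A \<longrightarrow> (Letter B \<in> set (concat ws') \<longleftrightarrow> Letter B \<in> set (concat ws)))"
proof -
  obtain us W vs x y where W: "W = [Letter A # x @ Letter A # y] \<or> W = [Letter A # x, Letter A # y]"
    and d: "(deform m)\<^sup>*\<^sup>* (ws, p) (us @ W @ vs, p)" and s: "set (concat (us @ W @ vs)) = set (concat ws)"
    using bring_to_front[OF assms] by blast
  have inv': "invar (us @ W @ vs) p" using deforms_invar[OF d] inv by simp
  have A': "A \<in> Al" "unresolved (us @ W @ vs) p A" using invar_letter[OF inv', of A] A unfolding s by blast+
  have pm: "m A = p A \<or> m A = - p A" using marker[OF A'(1)] A'(2) by (auto simp: unresolved_def)
  obtain W' p' where W': "deform m (us @ W @ vs, p) (us @ W' @ vs, p')"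
    "set (concat W') \<union> {Letter A} = set (concat W) \<union> {Reminder A}"
    using W
  proof
    assume W: "W = [Letter A # x @ Letter A # y]"
    from pm show thesis
    proof
      assume "m A = p A"
      from deform.split_eq[of m A p us x y vs, OF this] that[of "[Reminder A # x, Reminder A # y]" p] W
      show thesis by auto
    next
      assume "m A = - p A"
      from deform.split_neg[of m A p us x y vs, OF this] that[of "[Reminder A # rev x @ Reminder A # y]" "flip_proj x p"] W
      show thesis by auto
    qed
  next
    assume W: "W = [Letter A # x, Letter A # y]"
    from pm show thesis
    proof
      assume "m A = p A"
      from deform.join_eq[of m A p us x y vs, OF this] that[of "[Reminder A # x @ Reminder A # y]" p] W
      show thesis by auto
    next
      assume "m A = - p A"
      from deform.join_neg[of m A p us x y vs, OF this] that[of "[Reminder A # rev x @ Reminder A # y]" "flip_proj x p"] W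
      show thesis by auto
    qed
  qed
  have d': "(deform m)\<^sup>*\<^sup>* (ws, p) (us @ W' @ vs, p')" using d W'(1) by (rule rtranclp.rtrancl_into_rtrancl)
  have "invar (us @ W' @ vs) p'" using deforms_invar[OF d'] inv by simp
  moreover have "Reminder A \<in> set (concat (us @ W' @ vs))" using W'(2) by auto
  \<comment> \<open>An unresolved letter has no reminder, so the reminder just introduced shows that
    \<open>A\<close> is treated.\<close>
  ultimately have "treated (us @ W' @ vs) A" using A'(1) unfolding invar_def unresolved_def by blast
  then have "Letter A \<notin> set (concat (us @ W' @ vs))" unfolding treated_def by blast
  moreover have "Letter B \<in> set (concat (us @ W' @ vs)) \<longleftrightarrow> Letter B \<in> set (concat ws)" if "B \<noteq> A" for B
  proof -
    have "Letter B \<in> set (concat W') \<longleftrightarrow> Letter B \<in> set (concat W)"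
      using W'(2) that by (metis Un_iff singletonD token.inject(1) token.distinct(1))
    then have "Letter B \<in> set (concat (us @ W' @ vs)) \<longleftrightarrow> Letter B \<in> set (concat (us @ W @ vs))" by simp
    then show ?thesis by (simp only: s)
  qed
  ultimately show ?thesis using d' by blast
qed

text \<open>\<open>L\<close> is arbitrary because two choices occur: all letters, for the existence
  of a resolution, and all letters but one, for treating that letter last.\<close>

lemma resolve_letters:
  assumes "finite L" "invar ws p"
  shows "\<exists>ws' p'. (deform m)\<^sup>*\<^sup>* (ws, p) (ws', p') \<and> (\<forall>A\<in>L. Letter A \<notin> set (concat ws')) \<and>
    (\<forall>B. B \<notin> L \<longrightarrow> (Letter B \<in> set (concat ws') \<longleftrightarrow> Letter B \<in> set (concat ws)))"
  using assms(1)
proof (induction rule: finite_induct)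
  case empty
  show ?case by (intro exI[of _ ws] exI[of _ p]) simp
next
  case (insert A L)
  then obtain ws' p' where d: "(deform m)\<^sup>*\<^sup>* (ws, p) (ws', p')"
    and L: "\<forall>A\<in>L. Letter A \<notin> set (concat ws')"
      "\<forall>B. B \<notin> L \<longrightarrow> (Letter B \<in> set (concat ws') \<longleftrightarrow> Letter B \<in> set (concat ws))"
    by blast
  show ?case
  proof (cases "Letter A \<in> set (concat ws')")
    case False
    then show ?thesis using d L by (intro exI[of _ ws'] exI[of _ p'] conjI) (blast+)
  next
    case True
    have "invar ws' p'" using deforms_invar[OF d] assms(2) by simp
    from resolve_letter[OF this True] obtain ws'' p'' where d': "(deform m)\<^sup>*\<^sup>* (ws', p') (ws'', p'')"
      and L': "Letter A \<notin> set (concat ws'')"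
        "\<forall>B. B \<noteq> A \<longrightarrow> (Letter B \<in> set (concat ws'') \<longleftrightarrow> Letter B \<in> set (concat ws'))"
      by blast
    have "(deform m)\<^sup>*\<^sup>* (ws, p) (ws'', p'')" using d d' by simp
    moreover have "\<forall>B\<in>insert A L. Letter B \<notin> set (concat ws'')" using L L' by (metis insert_iff)
    moreover have "\<forall>B. B \<notin> insert A L \<longrightarrow> (Letter B \<in> set (concat ws'') \<longleftrightarrow> Letter B \<in> set (concat ws))"
      using L L' by (metis insert_iff)
    ultimately show ?thesis by blast
  qed
qed

definition linked :: "'a set \<Rightarrow> (gap \<times> gap) set" where
  "linked L = {(g, h). \<exists>A\<in>L. {g, h} \<in> K (m A) A}"

lemma sym_linked: "sym (linked L)"
  by (auto simp: sym_def linked_def insert_commute)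

lemma treated_linked:
  assumes "treated ws A" "(g, h) \<in> all_neighbours ws (Reminder A)" "A \<in> L"
  shows "(g, h) \<in> linked L"
  using assms by (force simp: treated_def linked_def links_def)

text \<open>Consecutive gaps of a word are linked, and a link never leaves a word, since its ends
  are neighbours of one reminder and each gap occurs in one word only. The right side depends on the
  markers and \<open>K\<close> alone, so every resolution yields the same blocks.\<close>

lemma gap_block_eq:
  assumes inv: "invar ws p" and res: "\<forall>A\<in>Al. treated ws A" and w: "w \<in> set ws" "g \<in> gap_block w"
  shows "gap_block w = (linked Al)\<^sup>* `` {g}"
proof (rule equalityI; rule subsetI)
  fix h assume h: "h \<in> gap_block w"
  have nb: "neighbours w t \<subseteq> linked Al" if t: "\<not> is_gap t" for t
  proof (rule subrelI)
    fix a b assume ab: "(a, b) \<in> neighbours w t"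
    have tw: "t \<in> set (concat ws)" using neighbours_memb(1)[OF ab] w by auto
    have "\<exists>A\<in>Al. t = Reminder A"
    proof (cases t)
      case (Letter A)
      then show ?thesis using tw res inv unfolding invar_def treated_def by blast
    next
      case (Reminder A)
      then show ?thesis using tw inv unfolding invar_def by blast
    qed (use t in simp)
    then obtain A where A: "A \<in> Al" "t = Reminder A" by blast
    have "(a, b) \<in> all_neighbours ws (Reminder A)" using ab w A by (auto simp: all_neighbours_def)
    then show "(a, b) \<in> linked Al" using treated_linked res A by blast
  qed
  have "cyclic_alternating w" using inv w by (simp add: invar_def)
  then have "(g, h) \<in> (linked Al)\<^sup>*"
    using cyclic_alternating_connected[OF _ nb sym_linked] w(2) h by (simp add: gap_block_def)
  then show "h \<in> (linked Al)\<^sup>* `` {g}" by simp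
next
  fix h assume "h \<in> (linked Al)\<^sup>* `` {g}"
  then have "(g, h) \<in> (linked Al)\<^sup>*" by simp
  then show "h \<in> gap_block w"
  proof (induction rule: rtrancl_induct)
    case base
    show ?case by (rule w(2))
  next
    case (step a b)
    obtain A where A: "A \<in> Al" "{a, b} \<in> K (m A) A" using step.hyps(2) by (auto simp: linked_def)
    then have "{a, b} \<in> links (all_neighbours ws (Reminder A))" using res by (auto simp: treated_def)
    then obtain c d w' where cd: "{a, b} = {c, d}" "w' \<in> set ws" "(c, d) \<in> neighbours w' (Reminder A)"
      by (auto simp: links_def all_neighbours_def)
    have "Gap c \<in> set w'" "Gap d \<in> set w'" using neighbours_memb[OF cd(3)] by auto
    then have "Gap a \<in> set w'" "Gap b \<in> set w'" using cd(1) by (auto simp: doubleton_eq_iff)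
    moreover have "Gap a \<in> set w" using step.IH by (simp add: gap_block_def)
    moreover have "count_list (concat ws) (Gap a) \<le> 1"
    proof -
      have "count_list (concat ws) (Gap a) = of_bool (a \<in> X)" using inv unfolding invar_def by blast
      then show ?thesis by simp
    qed
    ultimately have "w = w'" using word_unique w(1) cd(2) by metis
    then show ?case using \<open>Gap b \<in> set w'\<close> by (simp add: gap_block_def)
  qed
qed

lemma invar_gap: "invar ws p \<Longrightarrow> Gap g \<in> set (concat ws) \<longleftrightarrow> g \<in> X"
proof -
  assume "invar ws p"
  then have "count_list (concat ws) (Gap g) = of_bool (g \<in> X)" unfolding invar_def by blast
  then show ?thesis using count_list_0_iff[of "concat ws" "Gap g"] by (cases "g \<in> X") auto
qed

lemma gap_blocks:
  assumes inv: "invar ws p" and res: "\<forall>A\<in>Al. treated ws A"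
  shows "gap_block ` set ws = X // (linked Al)\<^sup>*"
    and "A \<in> Al \<Longrightarrow> gap_block ` {w \<in> set ws. Reminder A \<in> set w} =
      {c \<in> X // (linked Al)\<^sup>*. c \<inter> \<Union>(K (m A) A) \<noteq> {}}"
proof -
  have word: "\<exists>g\<in>X. g \<in> gap_block w \<and> gap_block w = (linked Al)\<^sup>* `` {g}" if w: "w \<in> set ws" for w
  proof -
    have "cyclic_alternating w" using inv w by (simp add: invar_def)
    then obtain g where "Gap g \<in> set w" using cyclic_alternating_gap by blast
    then show ?thesis using gap_block_eq[OF inv res w, of g] invar_gap[OF inv, of g] w
      by (auto simp: gap_block_def)
  qed
  have gap: "\<exists>w\<in>set ws. g \<in> gap_block w \<and> gap_block w = (linked Al)\<^sup>* `` {g}" if g: "g \<in> X" for g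
  proof -
    obtain w where "w \<in> set ws" "Gap g \<in> set w" using invar_gap[OF inv, of g] g by auto
    moreover from this have "g \<in> gap_block w" by (simp add: gap_block_def)
    ultimately show ?thesis using gap_block_eq[OF inv res] by blast
  qed
  show 1: "gap_block ` set ws = X // (linked Al)\<^sup>*"
  proof (rule equalityI; rule subsetI)
    fix c assume "c \<in> gap_block ` set ws"
    then obtain w where "w \<in> set ws" "c = gap_block w" by blast
    then show "c \<in> X // (linked Al)\<^sup>*" using word[of w] unfolding quotient_def by blast
  next
    fix c assume "c \<in> X // (linked Al)\<^sup>*"
    then obtain g where "g \<in> X" "c = (linked Al)\<^sup>* `` {g}" by (rule quotientE)
    then show "c \<in> gap_block ` set ws" using gap[of g] by blast
  qed
  assume A: "A \<in> Al"
  have K: "K (m A) A = links (all_neighbours ws (Reminder A))" using res A by (simp add: treated_def)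
  \<comment> \<open>A reminder is not visible in a block of gaps; it is detected by the ends of the
    links at \<open>A\<close>.\<close>
  have "Reminder A \<in> set w \<longleftrightarrow> gap_block w \<inter> \<Union>(K (m A) A) \<noteq> {}" if w: "w \<in> set ws" for w
  proof
    assume "Reminder A \<in> set w"
    moreover have "cyclic_alternating w" using inv w by (simp add: invar_def)
    ultimately obtain g h where gh: "(g, h) \<in> neighbours w (Reminder A)"
      using neighbours_nonempty[of w "Reminder A"] by auto
    then have "{g, h} \<in> K (m A) A" unfolding K links_def all_neighbours_def using w by force
    moreover have "g \<in> gap_block w" using neighbours_memb[OF gh] by (simp add: gap_block_def)
    ultimately show "gap_block w \<inter> \<Union>(K (m A) A) \<noteq> {}" by blast
  next
    assume "gap_block w \<inter> \<Union>(K (m A) A) \<noteq> {}"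
    then obtain g k where g: "Gap g \<in> set w" "g \<in> k" "k \<in> K (m A) A" by (auto simp: gap_block_def)
    then obtain c d w' where cd: "k = {c, d}" "w' \<in> set ws" "(c, d) \<in> neighbours w' (Reminder A)"
      unfolding K by (auto simp: links_def all_neighbours_def)
    have "Gap g \<in> set w'" using neighbours_memb[OF cd(3)] g(2) cd(1) by auto
    moreover have "count_list (concat ws) (Gap g) \<le> 1"
    proof -
      have "count_list (concat ws) (Gap g) = of_bool (g \<in> X)" using inv unfolding invar_def by blast
      then show ?thesis by simp
    qed
    ultimately have "w = w'" using word_unique w cd(2) g(1) by metis
    then show "Reminder A \<in> set w" using neighbours_memb(1)[OF cd(3)] by simp
  qed
  then have "{w \<in> set ws. Reminder A \<in> set w} = {w \<in> set ws. gap_block w \<inter> \<Union>(K (m A) A) \<noteq> {}}" by blast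
  then show "gap_block ` {w \<in> set ws. Reminder A \<in> set w} =
      {c \<in> X // (linked Al)\<^sup>*. c \<inter> \<Union>(K (m A) A) \<noteq> {}}"
    unfolding 1[symmetric] by blast
qed

text \<open>All other letters are deformed first. The arcs \<open>x\<close> and \<open>y\<close>
  then left at \<open>A\<close> are connected by links of other letters, so the two ends of each arc
  are equivalent. As \<open>A\<close> is still untreated, its links for both markers are available
  at once; \<open>e\<close> is the projection of \<open>A\<close> at that moment.\<close>

lemma smoothing_pairs:
  assumes fin: "finite Al" and inv: "invar ws p" and A: "A \<in> Al" "Letter A \<in> set (concat ws)"
  shows "\<exists>e g h g' h'. (e = 1 \<or> e = -1) \<and> K e A = {{g, h'}, {g', h}} \<and> K (- e) A = {{g, g'}, {h, h'}} \<and>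
    {g, h, g', h'} \<subseteq> X \<and>
    ((g, h') \<in> (linked (Al - {A}))\<^sup>* \<and> (g', h) \<in> (linked (Al - {A}))\<^sup>* \<or>
     (g, h) \<in> (linked (Al - {A}))\<^sup>* \<and> (g', h') \<in> (linked (Al - {A}))\<^sup>*)"
proof -
  obtain ws' p' where d: "(deform m)\<^sup>*\<^sup>* (ws, p) (ws', p')"
    and L: "\<forall>B\<in>Al - {A}. Letter B \<notin> set (concat ws')"
      "\<forall>B. B \<notin> Al - {A} \<longrightarrow> (Letter B \<in> set (concat ws') \<longleftrightarrow> Letter B \<in> set (concat ws))"
    using resolve_letters[of "Al - {A}" ws p] fin inv by blast
  have inv': "invar ws' p'" using deforms_invar[OF d] inv by simp
  have A': "Letter A \<in> set (concat ws')" using L(2) A by blast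
  obtain us W vs x y where W: "W = [Letter A # x @ Letter A # y] \<or> W = [Letter A # x, Letter A # y]"
    and d': "(deform m)\<^sup>*\<^sup>* (ws', p') (us @ W @ vs, p')" and s: "set (concat (us @ W @ vs)) = set (concat ws')"
    using bring_to_front[OF inv' A'] by blast
  let ?v = "us @ W @ vs"
  have inv'': "invar ?v p'" using deforms_invar[OF d'] inv' by simp
  have un: "unresolved ?v p' A" using invar_letter[OF inv'', of A] s A' by blast
  have tr: "treated ?v B" if "B \<in> Al - {A}" for B
  proof -
    have "Letter B \<notin> set (concat ?v)" using L(1) that by (simp only: s) blast
    then have "\<not> unresolved ?v p' B" unfolding unresolved_def by (metis count_notin zero_neq_numeral)
    then show ?thesis using inv'' that unfolding invar_def by blast
  qed
  have "\<forall>w\<in>set W. cyclic_alternating w" using inv'' by (auto simp: invar_def)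
  then have xy: "alternating x" "alternating y"
    using W by (auto simp: cyclic_alternating_Cons alternating_append_iff)
  have "count_list (concat W) (Letter A) = count_list x (Letter A) + count_list y (Letter A) + 2"
    using W by (auto simp: count_list_append)
  then have "count_list (concat us) (Letter A) = 0" "count_list (concat vs) (Letter A) = 0"
    "count_list x (Letter A) = 0" "count_list y (Letter A) = 0"
    using un by (auto simp: unresolved_def count_list_append)
  then have nA: "Letter A \<notin> set (concat us)" "Letter A \<notin> set (concat vs)" "Letter A \<notin> set x" "Letter A \<notin> set y"
    unfolding count_list_0_iff .
  have inner: "inner_neighbours z t \<subseteq> linked (Al - {A})" if z: "z = x \<or> z = y" and t: "\<not> is_gap t" for z t
  proof (rule subrelI)
    fix a b assume ab: "(a, b) \<in> inner_neighbours z t"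
    then have tz: "t \<in> set z" by (auto simp: inner_neighbours_def)
    then have tv: "t \<in> set (concat ?v)" using z W by auto
    have tA: "t \<noteq> Letter A" using tz z nA by blast
    have "\<exists>B\<in>Al - {A}. t = Reminder B"
    proof (cases t)
      case (Letter B)
      then have "B \<in> Al" using tv inv'' unfolding invar_def by blast
      then show ?thesis using Letter tA tr tv unfolding treated_def by blast
    next
      case (Reminder B)
      then have "B \<in> Al" "B \<noteq> A" using tv inv'' un unfolding invar_def unresolved_def by blast+
      then show ?thesis using Reminder by blast
    qed (use t in simp)
    then obtain B where B: "B \<in> Al - {A}" "t = Reminder B" by blast
    have "(a, b) \<in> all_neighbours W t"
      using W all_neighbours_joined[OF t is_gap_simps(2) xy, of A]
        all_neighbours_separate[OF t is_gap_simps(2) xy, of A] ab z by auto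
    then show "(a, b) \<in> linked (Al - {A})" using treated_linked[OF tr[OF B(1)] _ B(1)] B(2) by auto
  qed
  obtain lx hx where x: "hd x = Gap hx" "last x = Gap lx" using hd_last_gaps[OF xy(1)] .
  obtain ly hy where y: "hd y = Gap hy" "last y = Gap ly" using hd_last_gaps[OF xy(2)] .
  have ne: "x \<noteq> []" "y \<noteq> []" using xy by (auto elim: alternating_hd)
  have gm: "Gap hx \<in> set x" "Gap lx \<in> set x" "Gap hy \<in> set y" "Gap ly \<in> set y"
    using x y ne hd_in_set last_in_set by metis+
  have conn: "(hx, lx) \<in> (linked (Al - {A}))\<^sup>*" "(lx, hx) \<in> (linked (Al - {A}))\<^sup>*"
      "(hy, ly) \<in> (linked (Al - {A}))\<^sup>*" "(ly, hy) \<in> (linked (Al - {A}))\<^sup>*"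
    using alternating_connected[OF xy(1) inner sym_linked] alternating_connected[OF xy(2) inner sym_linked] gm
    by blast+
  have X: "{hx, lx, hy, ly} \<subseteq> X"
  proof -
    have "set x \<subseteq> set (concat ?v)" "set y \<subseteq> set (concat ?v)" using W by auto
    then show ?thesis using gm invar_gap[OF inv''] by blast
  qed
  have inner0: "inner_neighbours x (Letter A) = {}" "inner_neighbours y (Letter A) = {}"
    using nA inner_neighbours_empty by metis+
  have nb: "all_neighbours ?v (Letter A) = all_neighbours W (Letter A)"
    using all_neighbours_empty[OF nA(1)] all_neighbours_empty[OF nA(2)] by simp
  have p': "p' A = 1 \<or> p' A = -1" using un by (simp add: unresolved_def)
  have sm: "smoothing True (all_neighbours W (Letter A)) (K (p' A) A)"
    "smoothing False (all_neighbours W (Letter A)) (K (- p' A) A)"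
    using un p' unfolding unresolved_def nb by auto
  from W show ?thesis
  proof
    assume J: "W = [Letter A # x @ Letter A # y]"
    have N: "all_neighbours W (Letter A) = {(ly, hx), (lx, hy)}"
      unfolding J all_neighbours_joined[OF is_gap_simps(2) is_gap_simps(2) xy] using x y inner0 by auto
    \<comment> \<open>Here \<open>g\<close>, \<open>h'\<close> are the ends of \<open>y\<close> and
      \<open>g'\<close>, \<open>h\<close> those of \<open>x\<close>: the first alternative.\<close>
    show ?thesis
      using sm X conn p' unfolding N smoothing_iff
      by (intro exI[of _ "p' A"] exI[of _ ly] exI[of _ hx] exI[of _ lx] exI[of _ hy]) simp
  next
    assume S: "W = [Letter A # x, Letter A # y]"
    have N: "all_neighbours W (Letter A) = {(lx, hx), (ly, hy)}"
      unfolding S all_neighbours_separate[OF is_gap_simps(2) is_gap_simps(2) xy] using x y inner0 by auto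
    \<comment> \<open>Here \<open>g\<close>, \<open>h\<close> are the ends of \<open>x\<close> and
      \<open>g'\<close>, \<open>h'\<close> those of \<open>y\<close>: the second
      alternative.\<close>
    show ?thesis
      using sm X conn p' unfolding N smoothing_iff
      by (intro exI[of _ "p' A"] exI[of _ lx] exI[of _ hx] exI[of _ ly] exI[of _ hy]) simp
  qed
qed

end

section \<open>Components as classes of a relation on gaps\<close>

lemma alternating_letters:
  "alternating (Gap g # concat (map (\<lambda>(j, A). [Letter A, Gap (i, j)]) (List.enumerate n w)))"
  by (induction w arbitrary: g n) (auto intro: alternating.intros)

lemma cyclic_alternating_gapped_word: "cyclic_alternating (gapped_word i w)"
proof (cases w)
  case Nil
  then show ?thesis
    using rotations_refl[of "[Gap (i, 0)]"] by (auto simp: gapped_word_def cyclic_alternating_def)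
next
  case (Cons A w')
  then show ?thesis
    using alternating_letters[of "(i, 0)" i 1 w'] by (simp add: gapped_word_def cyclic_alternating_Cons)
qed

lemma count_gap_letters:
  "count_list (concat (map (\<lambda>(j, A). [Letter A, Gap (i, j)]) (List.enumerate n w))) (Gap (a, b)) =
     of_bool (a = i \<and> n \<le> b \<and> b < n + length w)"
  by (induction w arbitrary: n) auto

lemma count_gap_gapped_word: "count_list (gapped_word i w) (Gap (a, b)) \<le> of_bool (a = i)"
  by (cases w) (auto simp: gapped_word_def count_gap_letters)

lemma count_gap_gapped_words:
  "count_list (concat (map (\<lambda>(i, w). gapped_word i w) (List.enumerate n ws))) (Gap (a, b)) \<le> of_bool (n \<le> a)"
proof (induction ws arbitrary: n)
  case (Cons w ws)
  show ?case
    using Cons[of "Suc n"] count_gap_gapped_word[of n w a b]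
    by (auto simp: count_list_append of_bool_def split: if_splits)
qed simp

lemma count_letter_letters:
  "count_list (concat (map (\<lambda>(j, A). [Letter A, Gap (i, j)]) (List.enumerate n w))) (Letter A) = count_list w A"
  by (induction w arbitrary: n) auto

lemma count_letter_gapped_word: "count_list (gapped_word i w) (Letter A) = count_list w A"
  by (auto simp: gapped_word_def count_letter_letters)

lemma count_letter_gapped_words:
  "count_list (concat (map (\<lambda>(i, w). gapped_word i w) (List.enumerate n ws))) (Letter A) = count_list (concat ws) A"
  by (induction ws arbitrary: n) (auto simp: count_list_append count_letter_gapped_word)

lemma cyclic_alternating_gapped_words: "w \<in> set (gapped_words P) \<Longrightarrow> cyclic_alternating w"
  by (auto simp: gapped_words_def cyclic_alternating_gapped_word)

lemma reminder_gapped_words: "Reminder A \<notin> set (concat (gapped_words P))"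
  by (auto simp: gapped_words_def gapped_word_def split: if_splits)

definition gap_set :: "('a, int) nanophrase \<Rightarrow> gap set" where
  "gap_set P = {g. Gap g \<in> set (concat (gapped_words P))}"

text \<open>Read off from the initial phrase and its projection, hence independent of the state:
  this is the one family \<open>K\<close> used for all states. By \<open>smoothing_iff\<close> the
  choice is unique wherever it exists.\<close>

definition smoothing_links :: "('a, int) nanophrase \<Rightarrow> int \<Rightarrow> 'a \<Rightarrow> gap set set" where
  "smoothing_links P e A =
     (SOME k. smoothing (e = proj P A) (all_neighbours (gapped_words P) (Letter A)) k)"

abbreviation state_links :: "('a, int) nanophrase \<Rightarrow> ('a \<Rightarrow> int) \<Rightarrow> 'a set \<Rightarrow> (gap \<times> gap) set" where
  "state_links P s L \<equiv> resolving.linked s (smoothing_links P) L"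

lemma state_links_iff:
  "(g, h) \<in> state_links P s L \<longleftrightarrow> (\<exists>A\<in>L. {g, h} \<in> smoothing_links P (s A) A)"
proof -
  \<comment> \<open>\<open>linked\<close> has only the markers and the family of links as
    parameters, so the empty alphabet serves here and makes \<open>marker\<close> trivial.\<close>
  interpret resolving s "{}" "{}" "smoothing_links P" by unfold_locales simp
  show ?thesis by (simp add: linked_def)
qed

lemma sym_state_links: "sym (state_links P s L)"
  by (auto simp: sym_def state_links_iff insert_commute)

locale nano =
  fixes P :: "('a, int) nanophrase"
  assumes nano: "nanophrase_over {-1, 1} P"
begin

lemma fin: "finite (alphabet P)"
  using nano by (simp add: nanophrase_over_def)

lemma finite_gap_set: "finite (gap_set P)"
proof -
  have "gap_set P = Gap -` set (concat (gapped_words P))" by (auto simp: gap_set_def)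
  moreover have "finite (Gap -` set (concat (gapped_words P)) :: gap set)"
    by (rule finite_vimageI) (auto simp: inj_def)
  ultimately show ?thesis by simp
qed

lemma count_letter_initial: "A \<in> alphabet P \<Longrightarrow> count_list (concat (gapped_words P)) (Letter A) = 2"
  using nano count_letter_gapped_words[of 0 "words P" A]
  by (simp add: nanophrase_over_def gapped_words_def)

lemma initial:
  assumes s: "s \<in> states P"
  shows "resolving s (alphabet P)"
    and "resolving.invar s (alphabet P) (gap_set P) (smoothing_links P) (gapped_words P) (proj P)"
proof -
  show r: "resolving s (alphabet P)"
    using s by unfold_locales (auto simp: states_def PiE_iff)
  interpret resolving s "alphabet P" "gap_set P" "smoothing_links P" by (rule r)
  show "invar (gapped_words P) (proj P)"
    unfolding invar_def
  proof (intro conjI ballI allI impI)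
    fix w assume "w \<in> set (gapped_words P)"
    then show "cyclic_alternating w" by (rule cyclic_alternating_gapped_words)
  next
    fix g :: gap
    obtain a b where g: "g = (a, b)" by (cases g)
    have "count_list (concat (gapped_words P)) (Gap g) \<le> 1"
      using count_gap_gapped_words[of 0 "words P" a b] g by (simp add: gapped_words_def)
    moreover have "count_list (concat (gapped_words P)) (Gap g) = 0 \<longleftrightarrow> g \<notin> gap_set P"
      unfolding count_list_0_iff gap_set_def by blast
    ultimately show "count_list (concat (gapped_words P)) (Gap g) = of_bool (g \<in> gap_set P)"
      by (cases "g \<in> gap_set P") simp_all
  next
    fix A assume A: "A \<notin> alphabet P"
    then have "A \<notin> set (concat (words P))" using nano by (auto simp: nanophrase_over_def)
    then have "count_list (concat (gapped_words P)) (Letter A) = 0"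
      using count_letter_gapped_words[of 0 "words P" A] by (simp add: gapped_words_def)
    then show "Letter A \<notin> set (concat (gapped_words P))" unfolding count_list_0_iff .
    show "Reminder A \<notin> set (concat (gapped_words P))" by (rule reminder_gapped_words)
  next
    fix A assume A: "A \<in> alphabet P"
    have two: "count_list (concat (gapped_words P)) (Letter A) = 2" by (rule count_letter_initial[OF A])
    obtain xs where xs: "length xs = 2" "all_neighbours (gapped_words P) (Letter A) = set xs"
      using all_neighbours_list[of "gapped_words P" "Letter A"] cyclic_alternating_gapped_words[of _ P] two by auto
    have "smoothing (e = proj P A) (all_neighbours (gapped_words P) (Letter A)) (smoothing_links P e A)" for e
      unfolding smoothing_links_def xs(2) by (rule someI_ex) (rule smoothing_exists[OF xs(1)])
    moreover have "proj P A = 1 \<or> proj P A = - 1" using nano A by (auto simp: nanophrase_over_def)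
    ultimately show "unresolved (gapped_words P) (proj P) A \<or> treated (gapped_words P) A"
      using two reminder_gapped_words[of A P] unfolding unresolved_def by blast
  qed
qed

text \<open>The invariant holds for every resolution, and \<open>gap_blocks\<close> then determines
  its blocks; so it does not matter which one \<open>resolved\<close> picks. That there is one to
  pick is shown first.\<close>

lemma resolved_blocks:
  assumes s: "s \<in> states P"
  shows "components P s = gap_set P // (state_links P s (alphabet P))\<^sup>*"
    and "A \<in> alphabet P \<Longrightarrow> components_containing P s A =
      {c \<in> components P s. c \<inter> \<Union>(smoothing_links P (s A) A) \<noteq> {}}"
    and "\<Union>(components P s) \<subseteq> gap_set P"
proof -
  interpret resolving s "alphabet P" "gap_set P" "smoothing_links P" by (rule initial(1)[OF s])
  note inv = initial(2)[OF s]
  have notin: "(\<forall>w\<in>set ws. \<forall>A. Letter A \<notin> set w) \<longleftrightarrow> (\<forall>A\<in>alphabet P. Letter A \<notin> set (concat ws))"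
    if "invar ws p" for ws p
    using that unfolding invar_def by fastforce
  obtain ws' p' where d: "(deform s)\<^sup>*\<^sup>* (gapped_words P, proj P) (ws', p')"
    and L: "\<forall>A\<in>alphabet P. Letter A \<notin> set (concat ws')"
    using resolve_letters[OF fin inv] by blast
  have "resolution P s ws'"
    unfolding resolution_def using d L notin[of ws' p'] deforms_invar[OF d] inv by auto
  then have "resolution P s (resolved P s)" unfolding resolved_def by (rule someI)
  then obtain p where p: "(deform s)\<^sup>*\<^sup>* (gapped_words P, proj P) (resolved P s, p)"
    and no: "\<forall>w\<in>set (resolved P s). \<forall>A. Letter A \<notin> set w"
    unfolding resolution_def by blast
  have inv': "invar (resolved P s) p" using deforms_invar[OF p] inv by simp
  have tr: "\<forall>A\<in>alphabet P. treated (resolved P s) A"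
  proof
    fix A assume A: "A \<in> alphabet P"
    have "Letter A \<notin> set (concat (resolved P s))" using no by auto
    then have "\<not> unresolved (resolved P s) p A" unfolding unresolved_def by (metis count_notin zero_neq_numeral)
    then show "treated (resolved P s) A" using inv' A unfolding invar_def by blast
  qed
  show 1: "components P s = gap_set P // (linked (alphabet P))\<^sup>*"
    unfolding components_def by (rule gap_blocks(1)[OF inv' tr])
  show "components_containing P s A =
      {c \<in> components P s. c \<inter> \<Union>(smoothing_links P (s A) A) \<noteq> {}}" if "A \<in> alphabet P"
    unfolding components_containing_def 1 by (rule gap_blocks(2)[OF inv' tr that])
  \<comment> \<open>The classes are formed in the type of all gaps; that they contain gaps of
    \<open>P\<close> only is seen from the words.\<close>
  show "\<Union>(components P s) \<subseteq> gap_set P"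
    unfolding components_def using invar_gap[OF inv'] by (auto simp: gap_block_def)
qed

lemma partition_components:
  assumes s: "s \<in> states P"
  shows "partition_on (gap_set P) (components P s)"
proof -
  let ?R = "(state_links P s (alphabet P))\<^sup>*"
  have sym: "sym ?R" by (rule sym_rtrancl[OF sym_state_links])
  have cls: "?R `` {x} = ?R `` {y}" if "(x, y) \<in> ?R" for x y
    using that sym by (auto dest: symD intro: rtrancl_trans)
  note eq = resolved_blocks(1)[OF s]
  show ?thesis
  proof (rule partition_onI)
    show "\<Union>(components P s) = gap_set P"
      using resolved_blocks(3)[OF s] unfolding eq by (auto simp: quotient_def)
    show "{} \<notin> components P s" unfolding eq by (auto simp: quotient_def)
    fix p q assume pq: "p \<in> components P s" "q \<in> components P s" "p \<noteq> q"
    obtain x y where xy: "p = ?R `` {x}" "q = ?R `` {y}"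
      using pq(1,2) unfolding eq by (meson quotientE)
    show "disjnt p q"
    proof (rule ccontr)
      assume "\<not> disjnt p q"
      then obtain z where "(x, z) \<in> ?R" "(y, z) \<in> ?R" unfolding disjnt_def xy by blast
      then have "p = q" unfolding xy using cls by metis
      then show False using pq(3) by simp
    qed
  qed
qed

lemma finite_components: "s \<in> states P \<Longrightarrow> finite (components P s)"
  using finite_elements[OF finite_gap_set partition_components] .

lemma links_pairs:
  assumes s: "s \<in> states P" and A: "A \<in> alphabet P"
  shows "\<exists>e g h g' h'. (e = 1 \<or> e = -1) \<and> smoothing_links P e A = {{g, h'}, {g', h}} \<and>
    smoothing_links P (- e) A = {{g, g'}, {h, h'}} \<and> {g, h, g', h'} \<subseteq> gap_set P \<and>
    ((g, h') \<in> (state_links P s (alphabet P - {A}))\<^sup>* \<and> (g', h) \<in> (state_links P s (alphabet P - {A}))\<^sup>* \<or>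
     (g, h) \<in> (state_links P s (alphabet P - {A}))\<^sup>* \<and> (g', h') \<in> (state_links P s (alphabet P - {A}))\<^sup>*)"
proof -
  interpret resolving s "alphabet P" "gap_set P" "smoothing_links P" by (rule initial(1)[OF s])
  have "Letter A \<in> set (concat (gapped_words P))"
    using count_letter_initial[OF A] by (metis count_notin zero_neq_numeral)
  from smoothing_pairs[OF fin initial(2)[OF s] A this] show ?thesis .
qed

end

text \<open>By \<open>F\<close> the gaps \<open>g\<close>, \<open>h'\<close> lie in one class
  \<open>B\<close> and \<open>g'\<close>, \<open>h\<close> in one class \<open>C\<close>. Both new
  links run between \<open>B\<close> and \<open>C\<close>, so they merge these classes if they
  differ and change nothing otherwise.\<close>

lemma quotient_merge:
  fixes R :: "('x \<times> 'x) set"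
  assumes sym: "sym R" and X: "{g, h, g', h'} \<subseteq> X"
    and F: "(g, h') \<in> R\<^sup>*" "(g', h) \<in> R\<^sup>*"
    and R': "R' = R \<union> {(a, b). {a, b} \<in> {{g, g'}, {h, h'}}}"
  shows "X // R'\<^sup>* = X // R\<^sup>* \<or>
    (\<exists>b c. merges (X // R\<^sup>*) (X // R'\<^sup>*) b c \<and>
      {d \<in> X // R\<^sup>*. d \<inter> {g, h, g', h'} \<noteq> {}} = {b, c} \<and>
      {d \<in> X // R'\<^sup>*. d \<inter> {g, h, g', h'} \<noteq> {}} = {b \<union> c})"
proof -
  have symF: "(y, x) \<in> R\<^sup>*" if "(x, y) \<in> R\<^sup>*" for x y
    using sym_rtrancl[OF sym] that by (auto dest: symD)
  have cls: "R\<^sup>* `` {x} = R\<^sup>* `` {y}" if "(x, y) \<in> R\<^sup>*" for x y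
    using that symF[OF that] by (auto intro: rtrancl_trans)
  define B where "B = R\<^sup>* `` {g}"
  define C where "C = R\<^sup>* `` {g'}"
  have B: "g \<in> B" "h' \<in> B" and C: "g' \<in> C" "h \<in> C" using F by (auto simp: B_def C_def)
  have clsB: "R\<^sup>* `` {x} = B" if "x \<in> B" for x using cls[of g x] that by (simp add: B_def)
  have clsC: "R\<^sup>* `` {x} = C" if "x \<in> C" for x using cls[of g' x] that by (simp add: C_def)
  have mono: "R\<^sup>* \<subseteq> R'\<^sup>*" by (rule rtrancl_mono) (simp add: R')
  have gg': "(g, g') \<in> R'\<^sup>*" "(g', g) \<in> R'\<^sup>*" by (rule r_into_rtrancl; simp add: R' insert_commute)+
  have closed: "y \<in> B \<union> C" if "(x, y) \<in> R'\<^sup>*" "x \<in> B \<union> C" for x y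
    using that(1)
  proof (induction rule: rtrancl_induct)
    case (step a b)
    then have "(a, b) \<in> R \<or> b \<in> {g, g', h, h'}" by (auto simp: R' doubleton_eq_iff)
    then show ?case
    proof
      assume "(a, b) \<in> R"
      then show ?thesis using step.IH by (auto simp: B_def C_def intro: rtrancl_into_rtrancl)
    qed (use B C in auto)
  qed (rule that(2))
  have inB: "R'\<^sup>* `` {x} = B \<union> C" if x: "x \<in> B \<union> C" for x
  proof
    show "R'\<^sup>* `` {x} \<subseteq> B \<union> C" using closed x by blast
    have xg: "(x, g) \<in> R'\<^sup>* \<and> (x, g') \<in> R'\<^sup>*"
      using x gg' symF mono by (auto simp: B_def C_def intro: rtrancl_trans)
    then show "B \<union> C \<subseteq> R'\<^sup>* `` {x}"
      using mono by (auto simp: B_def C_def intro: rtrancl_trans)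
  qed
  \<comment> \<open>A path that starts outside \<open>B \<union> C\<close> never reaches an end of a
    new link.\<close>
  have outB: "R'\<^sup>* `` {x} = R\<^sup>* `` {x}" if x: "x \<notin> B \<union> C" for x
  proof
    show "R\<^sup>* `` {x} \<subseteq> R'\<^sup>* `` {x}" using mono by blast
    have "(x, y) \<in> R\<^sup>*" if "(x, y) \<in> R'\<^sup>*" for y
      using that
    proof (induction rule: rtrancl_induct)
      case (step a b)
      have "a \<notin> B \<union> C"
      proof
        assume "a \<in> B \<union> C"
        then have "R\<^sup>* `` {a} = B \<or> R\<^sup>* `` {a} = C" using clsB clsC by blast
        then show False using x symF[OF step.IH] by blast
      qed
      then have "a \<notin> {g, g', h, h'}" using B C by blast
      then have "(a, b) \<in> R" using step.hyps(2) by (auto simp: R' doubleton_eq_iff)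
      then show ?case using step.IH by (rule rtrancl_into_rtrancl[rotated])
    qed simp
    then show "R'\<^sup>* `` {x} \<subseteq> R\<^sup>* `` {x}" by blast
  qed
  have gX: "g \<in> X" "g' \<in> X" using X by auto
  have mem: "B \<in> X // R\<^sup>*" "C \<in> X // R\<^sup>*"
    unfolding B_def C_def by (rule quotientI[OF gX(1)], rule quotientI[OF gX(2)])
  have memBC: "B \<union> C \<in> X // R'\<^sup>*"
    using quotientI[OF gX(1), of "R'\<^sup>*"] unfolding inB[OF UnI1[OF B(1)]] .
  have ins: "X // R'\<^sup>* = insert (B \<union> C) (X // R\<^sup>* - {B, C})"
  proof (rule equalityI; rule subsetI)
    fix d assume "d \<in> X // R'\<^sup>*"
    then obtain x where x: "x \<in> X" "d = R'\<^sup>* `` {x}" by (rule quotientE)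
    show "d \<in> insert (B \<union> C) (X // R\<^sup>* - {B, C})"
    proof (cases "x \<in> B \<union> C")
      case True then show ?thesis using inB x by simp
    next
      case False
      have "x \<in> R\<^sup>* `` {x}" by simp
      then have "R\<^sup>* `` {x} \<noteq> B" "R\<^sup>* `` {x} \<noteq> C" using False by blast+
      then show ?thesis using outB[OF False] x by (simp add: quotientI)
    qed
  next
    fix d assume "d \<in> insert (B \<union> C) (X // R\<^sup>* - {B, C})"
    then consider "d = B \<union> C" | "d \<in> X // R\<^sup>*" "d \<noteq> B" "d \<noteq> C" by blast
    then show "d \<in> X // R'\<^sup>*"
    proof cases
      case 1 then show ?thesis using memBC by simp
    next
      case 2
      then obtain x where x: "x \<in> X" "d = R\<^sup>* `` {x}" by (meson quotientE)
      then have "x \<notin> B \<union> C" using 2 clsB clsC by blast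
      then show ?thesis using outB x by (metis quotientI)
    qed
  qed
  show ?thesis
  proof (cases "B = C")
    case True
    then have "X // R'\<^sup>* = X // R\<^sup>*" unfolding ins using mem by auto
    then show ?thesis by blast
  next
    case False
    have m: "merges (X // R\<^sup>*) (X // R'\<^sup>*) B C" using False mem ins by (simp add: merges_def)
    have meet: "d = B \<or> d = C" if d: "d \<in> X // R\<^sup>*" "d \<inter> {g, h, g', h'} \<noteq> {}" for d
    proof -
      obtain x where x: "d = R\<^sup>* `` {x}" using d(1) by (rule quotientE)
      obtain y where y: "y \<in> d" "y \<in> B \<union> C" using d(2) B C by blast
      then have "d = R\<^sup>* `` {y}" using x cls by blast
      then show ?thesis using y clsB clsC by blast
    qed
    have "{d \<in> X // R\<^sup>*. d \<inter> {g, h, g', h'} \<noteq> {}} = {B, C}"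
      using meet mem B C by blast
    moreover have "{d \<in> X // R'\<^sup>*. d \<inter> {g, h, g', h'} \<noteq> {}} = {B \<union> C}"
      unfolding ins using meet B by blast
    ultimately show ?thesis using m by blast
  qed
qed

section \<open>Edges of the cube of states\<close>

lemma doubleton_eq_singleton: "{a, b} = {c} \<Longrightarrow> a = b"
  by blast

context nano
begin

lemma states_flip:
  "s \<in> states P \<Longrightarrow> A \<in> alphabet P \<Longrightarrow> s(A := -1) \<in> states P"
  by (auto simp: states_def PiE_iff extensional_def)

text \<open>\<open>R\<close> collects the links of all other letters and is common to both states.
  If \<open>R\<close> already connects \<open>g\<close> with \<open>h'\<close> and \<open>g'\<close>
  with \<open>h\<close>, the links for the marker \<open>e\<close> add nothing, and those for
  \<open>- e\<close> merge two classes or none. Otherwise either marker connects both arcs at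
  \<open>A\<close>, and the partitions agree. Whether \<open>e\<close> is 1 or -1 decides between
  merge and split.\<close>

lemma component_edge:
  assumes s: "s \<in> states P" and A: "A \<in> alphabet P" "s A = 1" and t: "t = s(A := -1)"
  shows "(components P s = components P t \<and> components_containing P s A = components_containing P t A) \<or>
    (\<exists>b c. merges (components P s) (components P t) b c \<and>
       components_containing P s A = {b, c} \<and> components_containing P t A = {b \<union> c}) \<or>
    (\<exists>b c. merges (components P t) (components P s) b c \<and>
       components_containing P t A = {b, c} \<and> components_containing P s A = {b \<union> c})"
proof -
  have t': "t \<in> states P" using states_flip[OF s A(1)] t by simp
  define R where "R = state_links P s (alphabet P - {A})"
  define R' where "R' e = R \<union> {(a, b). {a, b} \<in> smoothing_links P e A}" for e
  define comp where "comp e = gap_set P // (R' e)\<^sup>*" for e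
  define cont where "cont e = {c \<in> comp e. c \<inter> \<Union>(smoothing_links P e A) \<noteq> {}}" for e
  have symR: "sym R" unfolding R_def by (rule sym_state_links)
  have "state_links P s (alphabet P) = R' 1"
  proof -
    have "(a, b) \<in> state_links P s (alphabet P) \<longleftrightarrow> (a, b) \<in> R' 1" for a b
    proof -
      have "(a, b) \<in> state_links P s (alphabet P) \<longleftrightarrow>
        (\<exists>B\<in>alphabet P - {A}. {a, b} \<in> smoothing_links P (s B) B) \<or> {a, b} \<in> smoothing_links P (s A) A"
        using A(1) unfolding state_links_iff by blast
      also have "\<dots> \<longleftrightarrow> (a, b) \<in> R' 1" unfolding R'_def R_def A(2) by (simp add: state_links_iff)
      finally show ?thesis .
    qed
    then show ?thesis by auto
  qed
  then have S: "components P s = comp 1" "components_containing P s A = cont 1"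
    using resolved_blocks(1,2)[OF s] A by (simp_all add: comp_def cont_def)
  have "state_links P t (alphabet P) = R' (-1)"
  proof -
    have "(a, b) \<in> state_links P t (alphabet P) \<longleftrightarrow> (a, b) \<in> R' (-1)" for a b
    proof -
      have "(a, b) \<in> state_links P t (alphabet P) \<longleftrightarrow>
        (\<exists>B\<in>alphabet P - {A}. {a, b} \<in> smoothing_links P (t B) B) \<or> {a, b} \<in> smoothing_links P (t A) A"
        using A(1) unfolding state_links_iff by blast
      also have "\<dots> \<longleftrightarrow> (\<exists>B\<in>alphabet P - {A}. {a, b} \<in> smoothing_links P (s B) B) \<or> {a, b} \<in> smoothing_links P (- 1) A"
        unfolding t by auto
      also have "\<dots> \<longleftrightarrow> (a, b) \<in> R' (-1)" unfolding R'_def R_def by (simp add: state_links_iff)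
      finally show ?thesis .
    qed
    then show ?thesis by auto
  qed
  then have T: "components P t = comp (-1)" "components_containing P t A = cont (-1)"
    using resolved_blocks(1,2)[OF t'] A t by (simp_all add: comp_def cont_def)
  obtain e g h g' h' where e: "e = 1 \<or> e = -1" and K: "smoothing_links P e A = {{g, h'}, {g', h}}"
    "smoothing_links P (- e) A = {{g, g'}, {h, h'}}" and X: "{g, h, g', h'} \<subseteq> gap_set P"
    and F: "(g, h') \<in> R\<^sup>* \<and> (g', h) \<in> R\<^sup>* \<or> (g, h) \<in> R\<^sup>* \<and> (g', h') \<in> R\<^sup>*"
    using links_pairs[OF s A(1), folded R_def] by (elim exE conjE) (rule that; assumption)
  have symF: "(y, x) \<in> R\<^sup>*" if "(x, y) \<in> R\<^sup>*" for x y
    using sym_rtrancl[OF symR] that by (auto dest: symD)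
  have N: "\<Union>(smoothing_links P e A) = {g, h, g', h'}" "\<Union>(smoothing_links P (- e) A) = {g, h, g', h'}"
    unfolding K by auto
  have Re: "R' e = R \<union> {(a, b). {a, b} \<in> {{g, h'}, {g', h}}}"
    "R' (- e) = R \<union> {(a, b). {a, b} \<in> {{g, g'}, {h, h'}}}"
    unfolding R'_def K by simp_all
  have edge: "(comp e = comp (- e) \<and> cont e = cont (- e)) \<or>
    (\<exists>b c. merges (comp e) (comp (- e)) b c \<and> cont e = {b, c} \<and> cont (- e) = {b \<union> c})"
    using F
  proof
    assume F: "(g, h') \<in> R\<^sup>* \<and> (g', h) \<in> R\<^sup>*"
    then have F': "(h', g) \<in> R\<^sup>*" "(h, g') \<in> R\<^sup>*" using symF by blast+
    have "R' e \<subseteq> R\<^sup>*" unfolding Re using F F' by (auto simp: doubleton_eq_iff)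
    then have "(R' e)\<^sup>* \<subseteq> R\<^sup>*" by (rule rtrancl_subset_rtrancl)
    moreover have "R\<^sup>* \<subseteq> (R' e)\<^sup>*" by (rule rtrancl_mono) (simp add: Re)
    ultimately have Req: "(R' e)\<^sup>* = R\<^sup>*" by blast
    have "comp (- e) = comp e \<or> (\<exists>b c. merges (comp e) (comp (- e)) b c \<and> cont e = {b, c} \<and> cont (- e) = {b \<union> c})"
      unfolding comp_def cont_def N Req
      by (rule quotient_merge[OF symR X conjunct1[OF F] conjunct2[OF F] Re(2)])
    moreover have "cont e = cont (- e)" if "comp (- e) = comp e"
      unfolding cont_def N that ..
    ultimately show ?thesis by metis
  next
    assume F: "(g, h) \<in> R\<^sup>* \<and> (g', h') \<in> R\<^sup>*"
    then have F': "(h, g) \<in> R\<^sup>*" "(h', g') \<in> R\<^sup>*" using symF by blast+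
    have mono: "R\<^sup>* \<subseteq> (R' d)\<^sup>*" for d by (rule rtrancl_mono) (simp add: R'_def)
    note fs = subsetD[OF mono conjunct1[OF F]] subsetD[OF mono conjunct2[OF F]]
      subsetD[OF mono F'(1)] subsetD[OF mono F'(2)]
    have 1: "(g, g') \<in> (R' (- e))\<^sup>*" "(g', g) \<in> (R' (- e))\<^sup>*" "(h, h') \<in> (R' (- e))\<^sup>*" "(h', h) \<in> (R' (- e))\<^sup>*"
      by (rule r_into_rtrancl; simp add: Re insert_commute)+
    have 2: "(g, h') \<in> (R' e)\<^sup>*" "(h', g) \<in> (R' e)\<^sup>*" "(g', h) \<in> (R' e)\<^sup>*" "(h, g') \<in> (R' e)\<^sup>*"
      by (rule r_into_rtrancl; simp add: Re insert_commute)+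
    \<comment> \<open>Together with the arcs from \<open>g\<close> to \<open>h\<close> and from
      \<open>g'\<close> to \<open>h'\<close>, the links of either marker generate those of the
      other.\<close>
    have 3: "(g, h') \<in> (R' (- e))\<^sup>*" "(h', g) \<in> (R' (- e))\<^sup>*" "(g', h) \<in> (R' (- e))\<^sup>*" "(h, g') \<in> (R' (- e))\<^sup>*"
      using 1 fs by (meson rtrancl_trans)+
    have 4: "(g, g') \<in> (R' e)\<^sup>*" "(g', g) \<in> (R' e)\<^sup>*" "(h, h') \<in> (R' e)\<^sup>*" "(h', h) \<in> (R' e)\<^sup>*"
      using 2 fs by (meson rtrancl_trans)+
    have "R' e \<subseteq> (R' (- e))\<^sup>*" unfolding Re(1) using 3 mono[of "- e"] by (auto simp: doubleton_eq_iff)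
    moreover have "R' (- e) \<subseteq> (R' e)\<^sup>*" unfolding Re(2) using 4 mono[of e] by (auto simp: doubleton_eq_iff)
    ultimately have "(R' e)\<^sup>* = (R' (- e))\<^sup>*"
      using rtrancl_subset_rtrancl by (metis subset_antisym)
    then have "comp e = comp (- e)" unfolding comp_def by simp
    then show ?thesis unfolding cont_def N by simp
  qed
  from e show ?thesis
  proof
    assume "e = 1"
    then show ?thesis using edge unfolding S T by blast
  next
    assume e1: "e = -1"
    then have "(comp (- 1) = comp 1 \<and> cont (- 1) = cont 1) \<or>
      (\<exists>b c. merges (comp (- 1)) (comp 1) b c \<and> cont (- 1) = {b, c} \<and> cont 1 = {b \<union> c})"
      using edge by simp
    then show ?thesis unfolding S T by (elim disjE) (simp, blast)
  qed
qed

text \<open>If the partition changes, the components at \<open>A\<close> are exactly the changed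
  blocks, and the two sets of conditions coincide. If it does not, both sides fail: the components
  at \<open>A\<close> are the same set before and after, which cannot be both a pair and a
  singleton.\<close>

lemma incident_at_iff:
  assumes s: "s \<in> states P" and A: "A \<in> alphabet P" "s A = 1" and t: "t = s(A := -1)"
  shows "incident_at P A (s, \<sigma>) (t, \<tau>) \<longleftrightarrow> entry (components P s) (components P t) \<sigma> \<tau>"
proof -
  have t': "t \<in> states P" using states_flip[OF s A(1)] t by simp
  note part = partition_components[OF s] partition_components[OF t']
  note fins = finite_components[OF s] finite_components[OF t']
  let ?p = "components P s" and ?r = "components P t"
  let ?cs = "components_containing P s A" and ?ct = "components_containing P t A"
  have iff: "incident_at P A (s, \<sigma>) (t, \<tau>) \<longleftrightarrow>
    (\<forall>c\<in>?p - ?cs. \<sigma> c = \<tau> c) \<and>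
    ((\<exists>b1 b2 c. b1 \<noteq> b2 \<and> ?cs = {b1, b2} \<and> ?ct = {c} \<and> merge_rule (\<sigma> b1) (\<sigma> b2) (\<tau> c)) \<or>
     (\<exists>b c1 c2. c1 \<noteq> c2 \<and> ?cs = {b} \<and> ?ct = {c1, c2} \<and> split_rule (\<sigma> b) (\<tau> c1) (\<tau> c2)))"
    unfolding incident_at_def merge_rule_def split_rule_def using A t by simp
  from component_edge[OF s A t] show ?thesis
  proof (elim disjE conjE exE)
    assume eq: "?p = ?r" "?cs = ?ct"
    have "\<not> entry ?p ?r \<sigma> \<tau>" unfolding eq(1) by (rule entry_same[OF part(2) fins(2)])
    then show ?thesis unfolding iff eq(2) by (metis doubleton_eq_singleton)
  next
    fix b c assume m: "merges ?p ?r b c" and k: "?cs = {b, c}" "?ct = {b \<union> c}"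
    have ne: "b \<noteq> c" using m by (simp add: merges_def)
    have 1: "(\<exists>b1 b2 d. b1 \<noteq> b2 \<and> ?cs = {b1, b2} \<and> ?ct = {d} \<and> merge_rule (\<sigma> b1) (\<sigma> b2) (\<tau> d)) \<longleftrightarrow>
      merge_rule (\<sigma> b) (\<sigma> c) (\<tau> (b \<union> c))"
    proof
      assume "\<exists>b1 b2 d. b1 \<noteq> b2 \<and> ?cs = {b1, b2} \<and> ?ct = {d} \<and> merge_rule (\<sigma> b1) (\<sigma> b2) (\<tau> d)"
      then obtain b1 b2 d where "?cs = {b1, b2}" "?ct = {d}" and h3: "merge_rule (\<sigma> b1) (\<sigma> b2) (\<tau> d)"
        by (elim exE conjE) (rule that)
      then have h: "{b, c} = {b1, b2}" "{b \<union> c} = {d}" by (simp_all only: k)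
      have "b1 = b \<and> b2 = c \<or> b1 = c \<and> b2 = b" using h(1) by (metis doubleton_eq_iff)
      moreover have "d = b \<union> c" using h(2) by (metis singleton_inject)
      ultimately show "merge_rule (\<sigma> b) (\<sigma> c) (\<tau> (b \<union> c))" using h3 merge_rule_sym by metis
    next
      assume "merge_rule (\<sigma> b) (\<sigma> c) (\<tau> (b \<union> c))"
      then show "\<exists>b1 b2 d. b1 \<noteq> b2 \<and> ?cs = {b1, b2} \<and> ?ct = {d} \<and> merge_rule (\<sigma> b1) (\<sigma> b2) (\<tau> d)"
        using ne k by (intro exI conjI)
    qed
    have 2: "\<not> (\<exists>d c1 c2. c1 \<noteq> c2 \<and> ?cs = {d} \<and> ?ct = {c1, c2} \<and> split_rule (\<sigma> d) (\<tau> c1) (\<tau> c2))"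
    proof (rule notI, elim exE conjE)
      fix d assume "?cs = {d}"
      then have "{b, c} = {d}" by (simp only: k)
      then show False using ne by (metis doubleton_eq_singleton)
    qed
    have mm: "merged ?p ?r" using m unfolding merged_def by blast
    show ?thesis
      unfolding iff 1 entry_merged[OF part(1) fins(1) mm] merge_entry_iff[OF part(1) m]
      by (simp only: 2 simp_thms) (simp only: k(1))
  next
    fix b c assume m: "merges ?r ?p b c" and k: "?ct = {b, c}" "?cs = {b \<union> c}"
    have ne: "b \<noteq> c" using m by (simp add: merges_def)
    have 1: "(\<exists>d c1 c2. c1 \<noteq> c2 \<and> ?cs = {d} \<and> ?ct = {c1, c2} \<and> split_rule (\<sigma> d) (\<tau> c1) (\<tau> c2)) \<longleftrightarrow>
      split_rule (\<sigma> (b \<union> c)) (\<tau> b) (\<tau> c)"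
    proof
      assume "\<exists>d c1 c2. c1 \<noteq> c2 \<and> ?cs = {d} \<and> ?ct = {c1, c2} \<and> split_rule (\<sigma> d) (\<tau> c1) (\<tau> c2)"
      then obtain b1 b2 d where "?ct = {b1, b2}" "?cs = {d}" and h3: "split_rule (\<sigma> d) (\<tau> b1) (\<tau> b2)"
        by (elim exE conjE) (rule that)
      then have h: "{b, c} = {b1, b2}" "{b \<union> c} = {d}" by (simp_all only: k)
      have "b1 = b \<and> b2 = c \<or> b1 = c \<and> b2 = b" using h(1) by (metis doubleton_eq_iff)
      moreover have "d = b \<union> c" using h(2) by (metis singleton_inject)
      ultimately show "split_rule (\<sigma> (b \<union> c)) (\<tau> b) (\<tau> c)" using h3 split_rule_sym by metis
    next
      assume "split_rule (\<sigma> (b \<union> c)) (\<tau> b) (\<tau> c)"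
      then show "\<exists>d c1 c2. c1 \<noteq> c2 \<and> ?cs = {d} \<and> ?ct = {c1, c2} \<and> split_rule (\<sigma> d) (\<tau> c1) (\<tau> c2)"
        using ne k by (intro exI conjI)
    qed
    have 2: "\<not> (\<exists>b1 b2 d. b1 \<noteq> b2 \<and> ?cs = {b1, b2} \<and> ?ct = {d} \<and> merge_rule (\<sigma> b1) (\<sigma> b2) (\<tau> d))"
    proof (rule notI, elim exE conjE)
      fix d assume "?ct = {d}"
      then have "{b, c} = {d}" by (simp only: k)
      then show False using ne by (metis doubleton_eq_singleton)
    qed
    have 3: "?p - {b \<union> c} = ?r - {b, c}"
      using m merges_union_notin[OF part(2) m] by (auto simp: merges_def)
    have mm: "merged ?r ?p" using m unfolding merged_def by blast
    show ?thesis
      unfolding iff 1 entry_split[OF part(2) fins(2) mm] split_entry_iff[OF part(2) m]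
      by (simp only: 2 simp_thms) (simp only: k(2) 3)
  qed
qed

text \<open>
  The marker of \<open>B\<close> is the same in \<open>s\<close> and \<open>t\<close>. If \<open>s\<close> and \<open>u\<close> had the same components, the links of
  \<open>t\<close> at \<open>B\<close> would hold within components of \<open>u\<close>, so the components of \<open>t\<close> would refine those of \<open>u\<close>.
\<close>

lemma no_merge_split_loop:
  assumes s: "s \<in> states P" and A: "A \<in> alphabet P" and B: "B \<in> alphabet P" "s B = 1" "A \<noteq> B"
    and t: "t = s(A := -1)" and u: "u = t(B := -1)"
    and m: "merged (components P u) (components P t)"
  shows "components P s \<noteq> components P u"
proof
  assume eq: "components P s = components P u"
  have t': "t \<in> states P" and u': "u \<in> states P" using states_flip s A B t u by auto
  let ?R = "\<lambda>s. (state_links P s (alphabet P))\<^sup>*"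
  have symR: "(y, x) \<in> ?R s'" if "(x, y) \<in> ?R s'" for x y s'
    using sym_rtrancl[OF sym_state_links] that by (auto dest: symD)
  have block: "?R s' `` {x} \<in> components P s'" if "s' \<in> states P" "x \<in> gap_set P" for s' x
    unfolding resolved_blocks(1)[OF that(1)] using that(2) by (rule quotientI)
  have "state_links P t (alphabet P) \<subseteq> ?R u"
  proof (rule subrelI)
    fix x y assume xy: "(x, y) \<in> state_links P t (alphabet P)"
    then obtain C where C: "C \<in> alphabet P" "{x, y} \<in> smoothing_links P (t C) C"
      by (auto simp: state_links_iff)
    show "(x, y) \<in> ?R u"
    proof (cases "C = B")
      case False
      then have "(x, y) \<in> state_links P u (alphabet P)" using C u by (auto simp: state_links_iff)
      then show ?thesis by blast
    next
      case True
      then have k: "{x, y} \<in> smoothing_links P 1 B" using C(2) B t by auto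
      then have "(x, y) \<in> state_links P s (alphabet P)"
        using B unfolding state_links_iff by (intro bexI[of _ B]) simp_all
      then have xs: "(x, y) \<in> ?R s" by blast
      \<comment> \<open>This places \<open>x\<close> in the gap set, so that its class in
        \<open>s\<close> is a component, and by the assumed equality also a component of
        \<open>u\<close>.\<close>
      obtain e g h g' h' where e: "e = 1 \<or> e = -1" and K: "smoothing_links P e B = {{g, h'}, {g', h}}"
        "smoothing_links P (- e) B = {{g, g'}, {h, h'}}" and X: "{g, h, g', h'} \<subseteq> gap_set P"
        using links_pairs[OF s B(1)] by (elim exE conjE) (rule that; assumption)
      have "\<Union>(smoothing_links P 1 B) \<subseteq> {g, h, g', h'}" using e K by auto
      then have "x \<in> gap_set P" using k X by blast
      then have "?R s `` {x} \<in> components P u" using block[OF s] eq by simp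
      then obtain z where z: "?R s `` {x} = ?R u `` {z}"
        unfolding resolved_blocks(1)[OF u'] by (rule quotientE)
      have "(z, x) \<in> ?R u" "(z, y) \<in> ?R u" using z xs by blast+
      then show ?thesis using symR rtrancl_trans by metis
    qed
  qed
  then have sub: "?R t \<subseteq> ?R u" by (rule rtrancl_subset_rtrancl)
  obtain b c where bc: "merges (components P u) (components P t) b c" using m by (auto simp: merged_def)
  then have mem: "b \<in> components P u" "c \<in> components P u" "b \<noteq> c" "b \<union> c \<in> components P t"
    by (auto simp: merges_def)
  obtain z where z: "b \<union> c = ?R t `` {z}" "z \<in> gap_set P"
    using mem(4) unfolding resolved_blocks(1)[OF t'] by (auto elim: quotientE)
  have d: "?R u `` {z} \<in> components P u" by (rule block[OF u' z(2)])
  \<comment> \<open>A class of \<open>t\<close> lies in a single class of \<open>u\<close>, so the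
    distinct blocks \<open>b\<close> and \<open>c\<close> of \<open>u\<close> would both equal that
    class.\<close>
  have le: "b \<union> c \<subseteq> ?R u `` {z}" unfolding z(1) using sub by blast
  have "b = ?R u `` {z}" "c = ?R u `` {z}"
    using partition_subset_eq[OF partition_components[OF u'] mem(1) d]
      partition_subset_eq[OF partition_components[OF u'] mem(2) d] le by blast+
  then have "b = c" by (rule trans[OF _ sym])
  then show False using mem(3) by blast
qed

lemma finite_enhanced_states: "finite (enhanced_states P)"
proof -
  have "finite (UNIV :: sign set)"
    by (rule finite_subset[of _ "{Plus, Minus}"]) (use sign_exhaust in auto)
  moreover have "finite (states P)" unfolding states_def using fin by (intro finite_PiE) auto
  ultimately show ?thesis
    unfolding enhanced_states_def using finite_components by (intro finite_SigmaI finite_PiE) auto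
qed

end

section \<open>The boundary\<close>

context nano
begin

lemma incident_stepD:
  assumes "\<exists>A\<in>alphabet P. incident_at P A (s, \<sigma>) (t, \<tau>)" "s \<in> states P" "t \<in> states P"
  shows "\<exists>A\<in>alphabet P. s A = 1 \<and> t = s(A := -1) \<and> entry (components P s) (components P t) \<sigma> \<tau>"
proof -
  obtain A where A: "A \<in> alphabet P" "incident_at P A (s, \<sigma>) (t, \<tau>)" using assms(1) by blast
  then have sA: "s A = 1" "t A = -1" "\<forall>B\<in>alphabet P - {A}. s B = t B" by (auto simp: incident_at_def)
  have "t B = (s(A := -1)) B" for B
  proof (cases "B \<in> alphabet P")
    case False
    \<comment> \<open>States are extensional, so they agree off the alphabet as well.\<close>
    then have "s B = undefined" "t B = undefined" "B \<noteq> A"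
      using assms(2,3) A(1) by (auto simp: states_def PiE_iff extensional_def)
    then show ?thesis by simp
  qed (use sA in \<open>auto simp: fun_upd_def\<close>)
  then have t: "t = s(A := -1)" by blast
  then show ?thesis using A sA incident_at_iff[OF assms(2) A(1) sA(1) t] by blast
qed

lemma adjacent_flip:
  assumes "s \<in> states P" "A \<in> alphabet P" "s A = 1"
  shows "adjacent (components P s) (components P (s(A := -1)))"
  using component_edge[OF assms refl] unfolding adjacent_def merged_def
  by (elim disjE exE conjE) (simp_all only: simp_thms, blast+)

text \<open>If there is any path, its ends determine the two letters at which the marker drops, so
  the intermediate state is one of \<open>a\<close>, \<open>b\<close>. The paths then fall into the
  two sets counted in \<open>even_paths_square\<close>.\<close>

lemma even_two_step:
  assumes S: "S \<in> enhanced_states P" and U: "U \<in> enhanced_states P"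
  shows "even (card {T \<in> enhanced_states P. (\<exists>A\<in>alphabet P. incident_at P A S T) \<and>
    (\<exists>B\<in>alphabet P. incident_at P B T U)})" (is "even (card ?M)")
proof (cases "?M = {}")
  case True
  then show ?thesis by (simp only: card.empty even_zero)
next
  case False
  obtain s \<sigma> where S': "S = (s, \<sigma>)" by (cases S)
  obtain u \<upsilon> where U': "U = (u, \<upsilon>)" by (cases U)
  have s: "s \<in> states P" and u: "u \<in> states P" using S U S' U' by (auto simp: enhanced_states_def)
  have D: "\<exists>A B. A \<in> alphabet P \<and> B \<in> alphabet P \<and> A \<noteq> B \<and> s A = 1 \<and> s B = 1 \<and> t = s(A := -1) \<and>
      u = s(A := -1, B := -1) \<and> \<tau> \<in> components P t \<rightarrow>\<^sub>E UNIV \<and>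
      entry (components P s) (components P t) \<sigma> \<tau> \<and> entry (components P t) (components P u) \<tau> \<upsilon>"
    if T: "(t, \<tau>) \<in> ?M" for t \<tau>
  proof -
    have t: "t \<in> states P" "\<tau> \<in> components P t \<rightarrow>\<^sub>E UNIV" using T by (auto simp: enhanced_states_def)
    obtain A where A: "A \<in> alphabet P" "s A = 1" "t = s(A := -1)"
      "entry (components P s) (components P t) \<sigma> \<tau>"
      using incident_stepD[OF _ s t(1), of \<sigma> \<tau>] T unfolding S' by blast
    obtain B where B: "B \<in> alphabet P" "t B = 1" "u = t(B := -1)"
      "entry (components P t) (components P u) \<tau> \<upsilon>"
      using incident_stepD[OF _ t(1) u, of \<tau> \<upsilon>] T unfolding U' by blast
    have "A \<noteq> B" "s B = 1" using B(2) A(3) by (auto split: if_splits)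
    then show ?thesis using A B t(2) by blast
  qed
  obtain A B where A: "A \<in> alphabet P" "s A = 1" and B: "B \<in> alphabet P" "s B = 1" and AB: "A \<noteq> B"
    and u_eq: "u = s(A := -1, B := -1)"
    using False D by (metis (no_types, lifting) ex_in_conv prod.exhaust_sel)
  define a where "a = s(A := -1)"
  define b where "b = s(B := -1)"
  have ab: "a \<in> states P" "b \<in> states P" using states_flip s A B by (simp_all add: a_def b_def)
  have ua: "u = a(B := -1)" and ub: "u = b(A := -1)"
    using AB by (auto simp: u_eq a_def b_def fun_upd_twist)
  have aB: "a B = 1" and bA: "b A = 1" using A B AB by (simp_all add: a_def b_def)
  have ne: "a \<noteq> b" using bA by (auto simp: a_def)
  let ?P = "\<lambda>t. paths_through (components P s) (components P t) (components P u) \<sigma> \<upsilon>"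
  have "?M = Pair a ` ?P a \<union> Pair b ` ?P b"
  proof (rule equalityI; rule subsetI)
    fix T assume T: "T \<in> ?M"
    obtain t \<tau> where T': "T = (t, \<tau>)" by (cases T)
    obtain A' B' where h: "A' \<in> alphabet P" "B' \<in> alphabet P" "A' \<noteq> B'" "s A' = 1" "s B' = 1"
      "t = s(A' := -1)" "u = s(A' := -1, B' := -1)" "\<tau> \<in> components P t \<rightarrow>\<^sub>E UNIV"
      "entry (components P s) (components P t) \<sigma> \<tau>" "entry (components P t) (components P u) \<tau> \<upsilon>"
      using D T unfolding T' by blast
    have "u A' = -1" unfolding h(7) by simp
    then have "A' = A \<or> A' = B" using h(4) unfolding u_eq by (auto split: if_splits)
    then have "t = a \<or> t = b" using h(6) by (auto simp: a_def b_def)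
    moreover have "\<tau> \<in> ?P t" using h(8-10) by (simp add: paths_through_def)
    ultimately show "T \<in> Pair a ` ?P a \<union> Pair b ` ?P b" unfolding T' by blast
  next
    fix T assume "T \<in> Pair a ` ?P a \<union> Pair b ` ?P b"
    then obtain t \<tau> where T: "T = (t, \<tau>)" "\<tau> \<in> ?P t" "t = a \<or> t = b" by blast
    have e: "\<tau> \<in> components P t \<rightarrow>\<^sub>E UNIV" "entry (components P s) (components P t) \<sigma> \<tau>"
      "entry (components P t) (components P u) \<tau> \<upsilon>"
      using T(2) by (simp_all add: paths_through_def)
    have "(\<exists>A\<in>alphabet P. incident_at P A (s, \<sigma>) (t, \<tau>)) \<and> (\<exists>B\<in>alphabet P. incident_at P B (t, \<tau>) (u, \<upsilon>))"
      using T(3)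
    proof
      assume t: "t = a"
      have "incident_at P A (s, \<sigma>) (t, \<tau>)"
        using incident_at_iff[OF s A, of t \<sigma> \<tau>] e(2) t by (simp add: a_def)
      moreover have "incident_at P B (t, \<tau>) (u, \<upsilon>)"
        using incident_at_iff[OF ab(1) B(1) aB ua, of \<tau> \<upsilon>] e(3) t by simp
      ultimately show ?thesis using A(1) B(1) by blast
    next
      assume t: "t = b"
      have "incident_at P B (s, \<sigma>) (t, \<tau>)"
        using incident_at_iff[OF s B, of t \<sigma> \<tau>] e(2) t by (simp add: b_def)
      moreover have "incident_at P A (t, \<tau>) (u, \<upsilon>)"
        using incident_at_iff[OF ab(2) A(1) bA ub, of \<tau> \<upsilon>] e(3) t by simp
      ultimately show ?thesis using A(1) B(1) by blast
    qed
    moreover have "(t, \<tau>) \<in> enhanced_states P" using e(1) T(3) ab by (auto simp: enhanced_states_def)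
    ultimately show "T \<in> ?M" unfolding T(1) S' U' by blast
  qed
  moreover have "finite (?P t)" if "t \<in> states P" for t
  proof -
    have "finite (UNIV :: sign set)"
      by (rule finite_subset[of _ "{Plus, Minus}"]) (use sign_exhaust in auto)
    then have "finite (components P t \<rightarrow>\<^sub>E (UNIV :: sign set))"
      using finite_components[OF that] by (intro finite_PiE) auto
    then show ?thesis unfolding paths_through_def by (rule rev_finite_subset) blast
  qed
  moreover have "Pair a ` ?P a \<inter> Pair b ` ?P b = {}" using ne by blast
  ultimately have "card ?M = card (Pair a ` ?P a) + card (Pair b ` ?P b)"
    using ab by (simp only: card_Un_disjoint finite_imageI)
  also have "\<dots> = card (?P a) + card (?P b)" by (simp add: card_image inj_on_def)
  also have "even \<dots>"
  proof (rule even_paths_square[OF finite_gap_set])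
    show "partition_on (gap_set P) (components P s)" "partition_on (gap_set P) (components P a)"
      "partition_on (gap_set P) (components P b)" "partition_on (gap_set P) (components P u)"
      by (rule partition_components; fact s ab u)+
    show "adjacent (components P s) (components P a)" unfolding a_def by (rule adjacent_flip[OF s A])
    show "adjacent (components P s) (components P b)" unfolding b_def by (rule adjacent_flip[OF s B])
    show "adjacent (components P a) (components P u)" unfolding ua by (rule adjacent_flip[OF ab(1) B(1) aB])
    show "adjacent (components P b) (components P u)" unfolding ub by (rule adjacent_flip[OF ab(2) A(1) bA])
    show "components P s \<noteq> components P u" if "merged (components P u) (components P a)"
      using no_merge_split_loop[OF s A(1) B AB a_def ua that] .
    show "components P s \<noteq> components P u" if "merged (components P u) (components P b)"
      using no_merge_split_loop[OF s B(1) A AB[symmetric] b_def ub that] .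
  qed
  finally show ?thesis .
qed

text \<open>Incidence numbers are 0 or 1, so the sum is the number of intermediate enhanced
  states.\<close>

lemma even_incidence_sum:
  assumes "S \<in> enhanced_states P" "U \<in> enhanced_states P"
  shows "even (\<Sum>T\<in>enhanced_states P. incidence P S T * incidence P T U)"
proof -
  let ?c = "\<lambda>T. (\<exists>A\<in>alphabet P. incident_at P A S T) \<and> (\<exists>B\<in>alphabet P. incident_at P B T U)"
  have "(\<Sum>T\<in>enhanced_states P. incidence P S T * incidence P T U) = (\<Sum>T\<in>enhanced_states P. of_bool (?c T))"
    by (intro sum.cong refl) (auto simp: incidence_def)
  also have "\<dots> = int (card (enhanced_states P \<inter> {T. ?c T}))"
    using finite_enhanced_states by simp
  also have "enhanced_states P \<inter> {T. ?c T} = {T \<in> enhanced_states P. ?c T}" by blast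
  also have "even (int (card \<dots>))" using even_two_step[OF assms] by (simp only: even_of_nat)
  finally show ?thesis .
qed

lemma boundary_of:
  "boundary P (frag_of S) = (\<Sum>T\<in>enhanced_states P. frag_cmul (incidence P S T) (frag_of T))"
  by (simp add: boundary_def)

lemma boundary_boundary_of:
  "boundary P (boundary P (frag_of S)) = (\<Sum>U\<in>enhanced_states P.
     frag_cmul (\<Sum>T\<in>enhanced_states P. incidence P S T * incidence P T U) (frag_of U))"
proof -
  have sum_cmul: "(\<Sum>T\<in>E. frag_cmul (f T) x) = frag_cmul (sum f E) x" if "finite E"
    for E and f :: "'a enhanced_state \<Rightarrow> int" and x :: "'a enhanced_state \<Rightarrow>\<^sub>0 int"
    using that by (induction rule: finite_induct) (simp_all add: frag_cmul_distrib)
  have "boundary P (boundary P (frag_of S)) =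
      (\<Sum>T\<in>enhanced_states P. boundary P (frag_cmul (incidence P S T) (frag_of T)))"
    unfolding boundary_of[of S] unfolding boundary_def
    by (subst frag_extend_sum[OF finite_enhanced_states]) (simp add: comp_def)
  also have "\<dots> = (\<Sum>T\<in>enhanced_states P. frag_cmul (incidence P S T) (boundary P (frag_of T)))"
    unfolding boundary_def by (simp only: frag_extend_cmul)
  also have "\<dots> = (\<Sum>T\<in>enhanced_states P. \<Sum>U\<in>enhanced_states P.
      frag_cmul (incidence P S T * incidence P T U) (frag_of U))"
    unfolding boundary_of by (simp add: frag_cmul_sum)
  also have "\<dots> = (\<Sum>U\<in>enhanced_states P. \<Sum>T\<in>enhanced_states P.
      frag_cmul (incidence P S T * incidence P T U) (frag_of U))"
    by (rule sum.swap)
  also have "\<dots> = (\<Sum>U\<in>enhanced_states P.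
     frag_cmul (\<Sum>T\<in>enhanced_states P. incidence P S T * incidence P T U) (frag_of U))"
    by (simp only: sum_cmul[OF finite_enhanced_states])
  finally show ?thesis .
qed

text \<open>On a generator the witness \<open>y\<close> has half of the even path counts as
  coefficients; \<open>frag_induction\<close> builds all chains from generators by differences,
  along which witnesses are subtracted.\<close>

lemma boundary_boundary_even:
  assumes "Poly_Mapping.keys x \<subseteq> enhanced_states P"
  shows "\<exists>y. Poly_Mapping.keys y \<subseteq> enhanced_states P \<and> boundary P (boundary P x) = frag_cmul 2 y"
  using assms
proof (induction rule: frag_induction)
  case zero
  have "boundary P (boundary P 0) = frag_cmul 2 0" by (simp add: boundary_def)
  then show ?case by (intro exI[of _ 0]) simp
next
  case (one S)
  let ?n = "\<lambda>U. \<Sum>T\<in>enhanced_states P. incidence P S T * incidence P T U"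
  let ?y = "\<Sum>U\<in>enhanced_states P. frag_cmul (?n U div 2) (frag_of U)"
  have "frag_cmul (?n U) (frag_of U) = frag_cmul 2 (frag_cmul (?n U div 2) (frag_of U))"
    if "U \<in> enhanced_states P" for U
    using even_incidence_sum[OF one that] by simp
  then have "boundary P (boundary P (frag_of S)) = frag_cmul 2 ?y"
    unfolding boundary_boundary_of frag_cmul_sum by (intro sum.cong refl) blast
  moreover have "Poly_Mapping.keys ?y \<subseteq> enhanced_states P"
  proof (rule subset_trans[OF keys_sum])
    show "(\<Union>U\<in>enhanced_states P. Poly_Mapping.keys (frag_cmul (?n U div 2) (frag_of U))) \<subseteq> enhanced_states P"
      by auto
  qed
  ultimately show ?case by blast
next
  case (diff x x')
  then obtain y y' where y: "Poly_Mapping.keys y \<subseteq> enhanced_states P" "boundary P (boundary P x) = frag_cmul 2 y"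
    "Poly_Mapping.keys y' \<subseteq> enhanced_states P" "boundary P (boundary P x') = frag_cmul 2 y'"
    by blast
  have "boundary P (boundary P (x - x')) = frag_cmul 2 (y - y')"
  proof -
    have "frag_cmul 2 y = frag_cmul 2 (y - y') + frag_cmul 2 y'"
      using frag_cmul_distrib2[of 2 "y - y'" y'] by simp
    then show ?thesis
      unfolding y(2,4)[symmetric] by (simp add: boundary_def frag_extend_diff eq_diff_eq)
  qed
  moreover have "Poly_Mapping.keys (y - y') \<subseteq> enhanced_states P"
    using keys_diff[of y y'] y(1,3) by blast
  ultimately show ?case by blast
qed

end

theorem theorem4p1:
  fixes P :: "('a, int) nanophrase"
  assumes "nanophrase_over {-1, 1} P"
  shows "\<forall>x\<in>carrier (chain_group P). \<exists>y\<in>carrier (chain_group P).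
           boundary P (boundary P x) = frag_cmul 2 y"
proof -
  interpret nano P by unfold_locales (rule assms)
  show ?thesis
  proof
    fix x assume "x \<in> carrier (chain_group P)"
    then have "Poly_Mapping.keys x \<subseteq> enhanced_states P" by (simp add: chain_group_def)
    from boundary_boundary_even[OF this] obtain y
      where "Poly_Mapping.keys y \<subseteq> enhanced_states P" "boundary P (boundary P x) = frag_cmul 2 y"
      by blast
    then show "\<exists>y\<in>carrier (chain_group P). boundary P (boundary P x) = frag_cmul 2 y"
      by (intro bexI[of _ y]) (simp_all add: chain_group_def)
  qed
qed

end
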